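(* Let $H_1\subset H_2\subset\cdots$ be separable infinite-dimensional complex Hilbert spaces (each a closed subspace of the next), let $H$ be the completion of $\bigcup_N H_N$, put $H_0=\{0\}$, and choose unit vectors $f_N\in H_N\ominus H_{N-1}$, $N\ge1$. Let $H_-$ be the closed span of $\{f_1,f_2,\dots\}$, $H_+=H_-^\perp$, let $F$ be the orthogonal projection of $H$ onto $H_-$, and $\Phi(x)=FxF$. Let $\mathcal U=\lim_\to U(H_N)$ and $U(\infty)=\lim_\to U(\langle f_1,\dots,f_N\rangle)$, and let $I\times U(\infty)\subset\mathcal U$ denote $U(\infty)$ acting as the identity on $H_+$. (1) Let $C_1$ be the set of all normalized holomorphic positive definite functions on $\mathcal U$ that are invariant under conjugation by $I\times U(\infty)$ and whose restriction to $(U(H_+)\cap\mathcal U)\times I$ (the subgroup of elements of $\mathcal U$ acting as the identity on $H_-$) is identically $1$. Let $C_2$ be the set of all normalized central holomorphic positive definite functions on $U(\infty)$. Then the convex sets $C_1$ and $C_2$ are affinely isomorphic. (2) Let $\phi$ be any holomorphic generalized character of the pair $(\mathcal U, I\times U(\infty))$ that belongs to $C_1$. Then there exists a unique holomorphic finite character $\chi$ of $U(\infty)$ such that $\phi=\widehat\chi\circ\Phi$ on $\mathcal U$.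
   Context: Unitaries of a subspace are extended by the identity on its orthogonal complement; each $U(H_N)$ carries the strong operator topology, and inductive limits carry the inductive limit topology. Positive definite functions are assumed continuous; "normalized" means value $1$ at the identity. Holomorphic: a unitary representation of a finite-dimensional unitary group $U(n)$, or a strongly continuous one of $U(K)$ with $K$ separable infinite-dimensional, is holomorphic if all irreducible constituents have non-negative signatures (i.e. occur in tensor powers $K^{\otimes n}$, $n\ge0$, of the defining representation). A positive definite function on such a group is holomorphic if its GNS representation is; for a normalized one this means it has the form $\sum_{n\ge0}c_n\mathrm{Tr}[A_n\pi_0^{\otimes n}(\cdot)]$ with $\pi_0$ the defining representation, $A_n\ge0$ of trace $1$ on $K^{\otimes n}$, $c_n\ge0$, $\sum c_n=1$. A positive definite function on an inductive limit group ($\mathcal U$ or $U(\infty)$) is holomorphic if its restriction to each group in the defining sequence is. Extension $\widehat\chi$: let $\Gamma(\infty)=\lim_\to\Gamma(\langle f_1,\dots,f_N\rangle)$, where $\Gamma(K)$ is the $*$-semigroup of contractions on $K$ (extended by the identity). A holomorphic positive definite function $\chi$ on $U(\infty)$ extends to $\widehat\chi$ on $\Gamma(\infty)$ by evaluating the formula $\sum_n c_n\mathrm{Tr}[A_n\pi_0^{\otimes n}(\cdot)]$ for $\chi|_{U(\langle f_1,\dots,f_N\rangle)}$ at contractions, using $\pi_0^{\otimes n}(x)=x^{\otimes n}$. For $W\in U(H_N)$, $\Phi(W)=FWF$, regarded as an operator on $H_-$, is a contraction of $\langle f_1,\dots,f_N\rangle$ extended by the identity, so $\widehat\chi\circ\Phi$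 is defined on $\mathcal U$. Generalized character: for a topological group $L$ with subgroup $K$, a generalized character of $(L,K)$ is an extreme point of the convex set of normalized positive definite functions on $L$ invariant under conjugation by $K$. A finite character of $U(\infty)$ is an extreme point of the convex set of normalized central positive definite functions on $U(\infty)$. *)

theory Defs
  imports "HOL-Analysis.Analysis" "HOL-Algebra.Group"
begin

unbundle no m_inv_syntax

section \<open>Complex Hilbert spaces\<close>

text \<open>The inner product is linear in the second argument.  The last axiom contains positive
  definiteness, as \<open>norm\<close> is a norm.\<close>

class complex_hilbert = real_normed_vector + complete_space +
  fixes scaleC :: "complex \<Rightarrow> 'a \<Rightarrow> 'a" (infixr \<open>*\<^sub>C\<close> 75)
    and cinner :: "'a \<Rightarrow> 'a \<Rightarrow> complex"
  assumes scaleC_add_right: "a *\<^sub>C (x + y) = a *\<^sub>C x + a *\<^sub>C y"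
    and scaleC_add_left: "(a + b) *\<^sub>C x = a *\<^sub>C x + b *\<^sub>C x"
    and scaleC_scaleC: "a *\<^sub>C (b *\<^sub>C x) = (a * b) *\<^sub>C x"
    and scaleR_scaleC: "r *\<^sub>R x = complex_of_real r *\<^sub>C x"
    and cinner_commute: "cinner x y = cnj (cinner y x)"
    and cinner_add_right: "cinner x (y + z) = cinner x y + cinner x z"
    and cinner_scaleC_right: "cinner x (a *\<^sub>C y) = a * cinner x y"
    and cinner_self: "cinner x x = complex_of_real ((norm x)\<^sup>2)"

global_interpretation complex_vector: vector_space
  "scaleC :: complex \<Rightarrow> 'a \<Rightarrow> 'a::complex_hilbert"
  by standard
    (simp_all add: scaleC_add_right scaleC_add_left scaleC_scaleC
      scaleR_scaleC[of 1, simplified, symmetric])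

definition orthocomp :: "'a::complex_hilbert set \<Rightarrow> 'a set"
  where "orthocomp K = {x. \<forall>y\<in>K. cinner y x = 0}"

definition is_onb :: "'a::complex_hilbert set \<Rightarrow> bool"
  where "is_onb B \<longleftrightarrow>
    (\<forall>b\<in>B. \<forall>b'\<in>B. cinner b b' = (if b = b' then 1 else 0)) \<and>
    closure (complex_vector.span B) = UNIV"

definition orth_proj :: "'a::complex_hilbert set \<Rightarrow> 'a \<Rightarrow> 'a"
  where "orth_proj K x = (THE y. y \<in> K \<and> x - y \<in> orthocomp K)"

definition bounded_clinear :: "('a::complex_hilbert \<Rightarrow> 'b::complex_hilbert) \<Rightarrow> bool"
  where "bounded_clinear T \<longleftrightarrow> bounded_linear T \<and> (\<forall>a x. T (a *\<^sub>C x) = a *\<^sub>C T x)"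


section \<open>The Hilbert space of square-summable functions\<close>

typedef 'i ell2 = "{x :: 'i \<Rightarrow> complex. (\<lambda>i. (cmod (x i))\<^sup>2) summable_on UNIV}"
  morphisms coord Abs_ell2
  by (rule exI[of _ "\<lambda>_. 0"]) simp

setup_lifting type_definition_ell2

lemma ell2_summable_iff:
  "(\<lambda>i. (cmod (x i))\<^sup>2) summable_on UNIV \<longleftrightarrow> (\<exists>C. \<forall>F. finite F \<longrightarrow> L2_set (\<lambda>i. cmod (x i)) F \<le> C)"
proof
  assume s: "(\<lambda>i. (cmod (x i))\<^sup>2) summable_on UNIV"
  have "L2_set (\<lambda>i. cmod (x i)) F \<le> sqrt (infsum (\<lambda>i. (cmod (x i))\<^sup>2) UNIV)" if "finite F" for F
    unfolding L2_set_def using finite_sum_le_infsum[OF s that] by simp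
  then show "\<exists>C. \<forall>F. finite F \<longrightarrow> L2_set (\<lambda>i. cmod (x i)) F \<le> C" by blast
next
  assume "\<exists>C. \<forall>F. finite F \<longrightarrow> L2_set (\<lambda>i. cmod (x i)) F \<le> C"
  then obtain C where C: "\<And>F. finite F \<Longrightarrow> L2_set (\<lambda>i. cmod (x i)) F \<le> C" by blast
  have "(\<Sum>i\<in>F. (cmod (x i))\<^sup>2) \<le> C\<^sup>2" if "finite F" for F
    using power_mono[OF C[OF that], of 2] by (simp add: L2_set_def sum_nonneg)
  then show "(\<lambda>i. (cmod (x i))\<^sup>2) summable_on UNIV"
    by (intro nonneg_bdd_above_summable_on) (auto intro!: bdd_aboveI[of _ "C\<^sup>2"])
qed

lemma ell2_sqrt_le:
  assumes "\<And>F. finite F \<Longrightarrow> L2_set (\<lambda>i. cmod (x i)) F \<le> C"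
  shows "sqrt (infsum (\<lambda>i. (cmod (x i))\<^sup>2) UNIV) \<le> C"
proof -
  have s: "(\<lambda>i. (cmod (x i))\<^sup>2) summable_on UNIV"
    using assms ell2_summable_iff by blast
  have C0: "0 \<le> C" using assms[of "{}"] by simp
  have "infsum (\<lambda>i. (cmod (x i))\<^sup>2) UNIV \<le> C\<^sup>2"
    by (rule infsum_le_finite_sums[OF s])
      (use power_mono[OF assms, of _ 2] in \<open>simp add: L2_set_def sum_nonneg\<close>)
  then show ?thesis using C0 real_le_lsqrt by blast
qed

lemma L2_set_le_ell2:
  assumes "(\<lambda>i. (cmod (x i))\<^sup>2) summable_on UNIV" "finite F"
  shows "L2_set (\<lambda>i. cmod (x i)) F \<le> sqrt (infsum (\<lambda>i. (cmod (x i))\<^sup>2) UNIV)"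
  unfolding L2_set_def using finite_sum_le_infsum[OF assms] by simp

lemma ell2_L2_add:
  assumes "finite F" "L2_set (\<lambda>i. cmod (x i)) F \<le> a" "L2_set (\<lambda>i. cmod (y i)) F \<le> b"
  shows "L2_set (\<lambda>i. cmod (x i + y i)) F \<le> a + b"
proof -
  have "L2_set (\<lambda>i. cmod (x i + y i)) F \<le> L2_set (\<lambda>i. cmod (x i) + cmod (y i)) F"
    by (rule L2_set_mono) (auto intro: norm_triangle_ineq)
  also have "\<dots> \<le> L2_set (\<lambda>i. cmod (x i)) F + L2_set (\<lambda>i. cmod (y i)) F"
    by (rule L2_set_triangle_ineq)
  finally show ?thesis using assms by linarith
qed

lemma ell2_add_closed:
  assumes "(\<lambda>i. (cmod (x i))\<^sup>2) summable_on UNIV" "(\<lambda>i. (cmod (y i))\<^sup>2) summable_on UNIV"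
  shows "(\<lambda>i. (cmod (x i + y i))\<^sup>2) summable_on UNIV"
  unfolding ell2_summable_iff[of "\<lambda>i. x i + y i"]
  using ell2_L2_add[OF _ L2_set_le_ell2[OF assms(1)] L2_set_le_ell2[OF assms(2)]] by blast

lemma ell2_scale_closed:
  assumes "(\<lambda>i. (cmod (x i))\<^sup>2) summable_on UNIV"
  shows "(\<lambda>i. (cmod (a * x i))\<^sup>2) summable_on UNIV"
  using summable_on_cmult_right[OF assms, of "(cmod a)\<^sup>2"]
  by (simp add: norm_mult power_mult_distrib)

lemma ell2_inner_summable:
  assumes "(\<lambda>i. (cmod (x i))\<^sup>2) summable_on UNIV" "(\<lambda>i. (cmod (y i))\<^sup>2) summable_on UNIV"
  shows "(\<lambda>i. cnj (x i) * y i) summable_on UNIV"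
proof (rule abs_summable_summable, rule summable_on_comparison_test)
  show "(\<lambda>i. (cmod (x i))\<^sup>2 + (cmod (y i))\<^sup>2) summable_on UNIV"
    using assms by (rule summable_on_add)
  show "cmod (cnj (x i) * y i) \<le> (cmod (x i))\<^sup>2 + (cmod (y i))\<^sup>2" for i
  proof -
    have "2 * (cmod (x i) * cmod (y i)) \<le> (cmod (x i))\<^sup>2 + (cmod (y i))\<^sup>2"
      using sum_squares_bound[of "cmod (x i)" "cmod (y i)"] by simp
    moreover have "0 \<le> cmod (x i) * cmod (y i)" by simp
    ultimately show ?thesis unfolding norm_mult complex_mod_cnj by linarith
  qed
qed simp

instantiation ell2 :: (type) real_normed_vector
begin

lift_definition zero_ell2 :: "'a ell2" is "\<lambda>_. 0" by simp
lift_definition plus_ell2 :: "'a ell2 \<Rightarrow> 'a ell2 \<Rightarrow> 'a ell2" is "\<lambda>x y i. x i + y i"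
  by (simp add: ell2_add_closed)
lift_definition uminus_ell2 :: "'a ell2 \<Rightarrow> 'a ell2" is "\<lambda>x i. - x i" by simp
lift_definition minus_ell2 :: "'a ell2 \<Rightarrow> 'a ell2 \<Rightarrow> 'a ell2" is "\<lambda>x y i. x i - y i"
  subgoal for x y using ell2_add_closed[of x "\<lambda>i. - y i"] by simp done
lift_definition scaleR_ell2 :: "real \<Rightarrow> 'a ell2 \<Rightarrow> 'a ell2" is "\<lambda>r x i. complex_of_real r * x i"
  by (rule ell2_scale_closed) simp
lift_definition norm_ell2 :: "'a ell2 \<Rightarrow> real"
  is "\<lambda>x. sqrt (infsum (\<lambda>i. (cmod (x i))\<^sup>2) UNIV)" .

definition dist_ell2 :: "'a ell2 \<Rightarrow> 'a ell2 \<Rightarrow> real" where "dist_ell2 x y = norm (x - y)"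
definition sgn_ell2 :: "'a ell2 \<Rightarrow> 'a ell2" where "sgn_ell2 x = scaleR (inverse (norm x)) x"
definition uniformity_ell2 :: "('a ell2 \<times> 'a ell2) filter"
  where "uniformity_ell2 = (INF e\<in>{0 <..}. principal {(x, y). dist x y < e})"
definition open_ell2 :: "'a ell2 set \<Rightarrow> bool"
  where "open_ell2 S = (\<forall>x\<in>S. \<forall>\<^sub>F (x', y) in uniformity. x' = x \<longrightarrow> y \<in> S)"

instance
proof
  fix x y z :: "'a ell2" and a b :: real
  show "x + y + z = x + (y + z)" by transfer (simp add: add.assoc)
  show "x + y = y + x" by transfer (simp add: add.commute)
  show "0 + x = x" by transfer simp
  show "- x + x = 0" by transfer simp
  show "x - y = x + - y" by transfer simp
  show "a *\<^sub>R (x + y) = a *\<^sub>R x + a *\<^sub>R y" by transfer (simp add: algebra_simps)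
  show "(a + b) *\<^sub>R x = a *\<^sub>R x + b *\<^sub>R x" by transfer (simp add: algebra_simps)
  show "a *\<^sub>R b *\<^sub>R x = (a * b) *\<^sub>R x" by transfer (simp add: mult.assoc)
  show "1 *\<^sub>R x = x" by transfer simp
  show "dist x y = norm (x - y)" by (rule dist_ell2_def)
  show "sgn x = inverse (norm x) *\<^sub>R x" by (rule sgn_ell2_def)
  show "uniformity = (INF e\<in>{0 <..}. principal {(x, y::'a ell2). dist x y < e})"
    by (rule uniformity_ell2_def)
  show "open S = (\<forall>x\<in>S. \<forall>\<^sub>F (x', y) in uniformity. x' = x \<longrightarrow> y \<in> S)" for S :: "'a ell2 set"
    by (rule open_ell2_def)
  show "norm x = 0 \<longleftrightarrow> x = 0"
  proof
    assume "norm x = 0"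
    then have n: "sqrt (infsum (\<lambda>i. (cmod (coord x i))\<^sup>2) UNIV) = 0"
      by (simp add: norm_ell2.rep_eq)
    have "coord x i = coord 0 i" for i
    proof -
      have "L2_set (\<lambda>i. cmod (coord x i)) {i} \<le> 0"
        using L2_set_le_ell2[of "coord x" "{i}"] coord[of x] n by simp
      then show ?thesis by (simp add: L2_set_def zero_ell2.rep_eq)
    qed
    then show "x = 0" by (intro coord_inject[THEN iffD1] ext)
  next
    assume "x = 0" then show "norm x = 0" by transfer simp
  qed
  show "norm (x + y) \<le> norm x + norm y"
    unfolding norm_ell2.rep_eq plus_ell2.rep_eq
    by (rule ell2_sqrt_le, rule ell2_L2_add, assumption)
      (rule L2_set_le_ell2, use coord in auto)+
  show "norm (a *\<^sub>R x) = \<bar>a\<bar> * norm x"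
    by transfer
      (simp add: norm_mult power_mult_distrib infsum_cmult_right' real_sqrt_mult)
qed

end

lemma cmod_coord_le: "cmod (coord x i) \<le> norm x"
  using L2_set_le_ell2[of "coord x" "{i}"] coord[of x] by (simp add: norm_ell2.rep_eq L2_set_def)

lemma coord_diff: "coord (x - y) i = coord x i - coord y i"
  by transfer simp

instance ell2 :: (type) complete_space
proof
  fix X :: "nat \<Rightarrow> 'a ell2"
  assume X: "Cauchy X"
  have "Cauchy (\<lambda>n. coord (X n) i)" for i
  proof (rule CauchyI)
    fix e :: real assume "e > 0"
    then obtain M where M: "\<And>m n. m \<ge> M \<Longrightarrow> n \<ge> M \<Longrightarrow> norm (X m - X n) < e"
      using CauchyD[OF X] by blast
    have "cmod (coord (X m) i - coord (X n) i) < e" if "m \<ge> M" "n \<ge> M" for m n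
      using M[OF that] cmod_coord_le[of "X m - X n" i] by (simp add: coord_diff)
    then show "\<exists>M. \<forall>m\<ge>M. \<forall>n\<ge>M. cmod (coord (X m) i - coord (X n) i) < e" by blast
  qed
  then obtain L where L: "\<And>i. (\<lambda>n. coord (X n) i) \<longlonglongrightarrow> L i"
    unfolding Cauchy_convergent_iff convergent_def by metis
  have close: "\<exists>M. \<forall>n\<ge>M. \<forall>F. finite F \<longrightarrow> L2_set (\<lambda>i. cmod (coord (X n) i - L i)) F \<le> e"
    if e: "e > 0" for e
  proof -
    obtain M where M: "\<And>n m. n \<ge> M \<Longrightarrow> m \<ge> M \<Longrightarrow> norm (X n - X m) < e"
      using CauchyD[OF X e] by blast
    have "L2_set (\<lambda>i. cmod (coord (X n) i - L i)) F \<le> e" if "n \<ge> M" "finite F" for n F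
    proof (rule LIMSEQ_le_const2)
      show "(\<lambda>m. L2_set (\<lambda>i. cmod (coord (X n) i - coord (X m) i)) F)
          \<longlonglongrightarrow> L2_set (\<lambda>i. cmod (coord (X n) i - L i)) F"
        unfolding L2_set_def by (intro tendsto_intros L)
      have "L2_set (\<lambda>i. cmod (coord (X n) i - coord (X m) i)) F \<le> norm (X n - X m)" for m
        using L2_set_le_ell2[of "coord (X n - X m)" F] that(2) coord[of "X n - X m"]
        by (simp add: norm_ell2.rep_eq coord_diff)
      then show "\<exists>N. \<forall>m\<ge>N. L2_set (\<lambda>i. cmod (coord (X n) i - coord (X m) i)) F \<le> e"
        using M[OF that(1)] by (intro exI[of _ M] allI impI) (rule order_trans, assumption, simp add: less_imp_le)
    qed
    then show ?thesis by blast
  qed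
  obtain M where M: "\<And>F. finite F \<Longrightarrow> L2_set (\<lambda>i. cmod (coord (X M) i - L i)) F \<le> 1"
    using close[of 1] by auto
  have "(\<lambda>i. (cmod (coord (X M) i - L i))\<^sup>2) summable_on UNIV"
    using M by (intro ell2_summable_iff[THEN iffD2] exI[of _ 1]) auto
  moreover have "(\<lambda>i. (cmod (coord (X M) i))\<^sup>2) summable_on UNIV"
    using coord[of "X M"] by simp
  ultimately have "(\<lambda>i. (cmod (L i))\<^sup>2) summable_on UNIV"
    using ell2_add_closed[of "coord (X M)" "\<lambda>i. L i - coord (X M) i"]
    by (simp add: norm_minus_commute[of "coord (X M) _" "L _"])
  then have cL: "coord (Abs_ell2 L) = L" by (simp add: Abs_ell2_inverse)
  have "X \<longlonglongrightarrow> Abs_ell2 L"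
  proof (rule LIMSEQ_I)
    fix r :: real assume r: "r > 0"
    obtain M where M: "\<And>n F. n \<ge> M \<Longrightarrow> finite F \<Longrightarrow> L2_set (\<lambda>i. cmod (coord (X n) i - L i)) F \<le> r/2"
      using close[of "r/2"] r by auto
    have "norm (X n - Abs_ell2 L) \<le> r / 2" if "n \<ge> M" for n
      using ell2_sqrt_le[OF M[OF that]] by (simp add: norm_ell2.rep_eq coord_diff cL)
    then show "\<exists>M. \<forall>n\<ge>M. norm (X n - Abs_ell2 L) < r"
      using r by (intro exI[of _ M] allI impI) (rule le_less_trans, assumption, simp)
  qed
  then show "convergent X" by (auto simp: convergent_def)
qed

instantiation ell2 :: (type) complex_hilbert
begin

lift_definition scaleC_ell2 :: "complex \<Rightarrow> 'a ell2 \<Rightarrow> 'a ell2" is "\<lambda>a x i. a * x i"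
  by (rule ell2_scale_closed) simp
lift_definition cinner_ell2 :: "'a ell2 \<Rightarrow> 'a ell2 \<Rightarrow> complex"
  is "\<lambda>x y. infsum (\<lambda>i. cnj (x i) * y i) UNIV" .

instance
proof
  fix x y z :: "'a ell2" and a b :: complex and r :: real
  show "a *\<^sub>C (x + y) = a *\<^sub>C x + a *\<^sub>C y" by transfer (simp add: algebra_simps)
  show "(a + b) *\<^sub>C x = a *\<^sub>C x + b *\<^sub>C x" by transfer (simp add: algebra_simps)
  show "a *\<^sub>C (b *\<^sub>C x) = (a * b) *\<^sub>C x" by transfer (simp add: mult.assoc)
  show "r *\<^sub>R x = complex_of_real r *\<^sub>C x" by transfer simp
  show "cinner x y = cnj (cinner y x)"
    by transfer (simp flip: infsum_cnj add: mult.commute)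
  show "cinner x (y + z) = cinner x y + cinner x z"
    by transfer (simp add: distrib_left infsum_add ell2_inner_summable)
  show "cinner x (a *\<^sub>C y) = a * cinner x y"
    by transfer (simp add: mult.left_commute infsum_cmult_right')
  show "cinner x x = complex_of_real ((norm x)\<^sup>2)"
  proof -
    have s: "(\<lambda>i. (cmod (coord x i))\<^sup>2) summable_on UNIV" using coord[of x] by simp
    have "((\<lambda>i. complex_of_real ((cmod (coord x i))\<^sup>2)) has_sum
        complex_of_real (infsum (\<lambda>i. (cmod (coord x i))\<^sup>2) UNIV)) UNIV"
      using s by (intro has_sum_of_real has_sum_infsum)
    moreover have "complex_of_real ((cmod (coord x i))\<^sup>2) = cnj (coord x i) * coord x i" for i
      using complex_norm_square[of "coord x i"] by (simp add: mult.commute)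
    ultimately have "infsum (\<lambda>i. cnj (coord x i) * coord x i) UNIV =
        complex_of_real (infsum (\<lambda>i. (cmod (coord x i))\<^sup>2) UNIV)"
      by (simp add: infsumI)
    then show ?thesis
      by (simp add: cinner_ell2.rep_eq norm_ell2.rep_eq infsum_nonneg)
  qed
qed

end

lift_definition ket :: "'i \<Rightarrow> 'i ell2" is "\<lambda>i j. if j = i then 1 else 0"
proof -
  fix i :: 'i
  have "(\<lambda>j. (cmod (if j = i then 1 else 0))\<^sup>2) summable_on {i}" by simp
  then show "(\<lambda>j. (cmod (if j = i then 1 else 0))\<^sup>2) summable_on UNIV"
    by (rule summable_on_cong_neutral[THEN iffD1, rotated -1]) auto
qed

text \<open>For a trace class operator \<open>T\<close> the family below is absolutely summable, and its sum is the
  trace.  A bounded \<open>T \<ge> 0\<close> is trace class iff the family is summable; otherwise \<open>infsum\<close> gives 0.\<close>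

definition trace :: "('i ell2 \<Rightarrow> 'i ell2) \<Rightarrow> complex"
  where "trace T = (\<Sum>\<^sub>\<infinity>i. cinner (ket i) (T (ket i)))"


section \<open>Tensor powers\<close>

text \<open>With respect to an orthonormal basis \<open>B\<close> of a Hilbert space \<open>H\<close> (type \<open>'h\<close>), the \<open>n\<close>-th
  Hilbert tensor power of \<open>H\<close> is the space of square-summable functions on \<open>B\<^sup>n\<close>, i.e. of those
  elements of \<open>'h list ell2\<close> that are supported on the lists of length \<open>n\<close> with entries in \<open>B\<close>;
  the elementary tensor \<open>v\<^sub>1 \<otimes> \<dots> \<otimes> v\<^sub>n\<close> is the function mapping \<open>(b\<^sub>1, \<dots>, b\<^sub>n)\<close> to
  \<open>\<langle>b\<^sub>1, v\<^sub>1\<rangle> \<cdots> \<langle>b\<^sub>n, v\<^sub>n\<rangle>\<close>, so that inner products of elementary tensors are products of inner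
  products.  The choice of \<open>B\<close> only affects the realization.\<close>

definition hbasis :: "'h::complex_hilbert set"
  where "hbasis = (SOME B. is_onb B)"

definition simple_tensor :: "'h::complex_hilbert list \<Rightarrow> 'h list ell2"
  where "simple_tensor vs = Abs_ell2 (\<lambda>bs.
    if length bs = length vs \<and> set bs \<subseteq> hbasis
    then \<Prod>k<length vs. cinner (bs ! k) (vs ! k) else 0)"

definition tensor_power :: "'h::complex_hilbert set \<Rightarrow> nat \<Rightarrow> 'h list ell2 set"
  where "tensor_power K n =
    closure (complex_vector.span (simple_tensor ` {vs. length vs = n \<and> set vs \<subseteq> K}))"

text \<open>The operator \<open>x\<^sup>\<otimes>\<^sup>n\<close> on the \<open>n\<close>-th tensor power of \<open>H\<close>, extended by 0.\<close>

definition tensor_op :: "nat \<Rightarrow> ('h::complex_hilbert \<Rightarrow> 'h) \<Rightarrow> 'h list ell2 \<Rightarrow> 'h list ell2"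
  where "tensor_op n x = (THE T. bounded_clinear T \<and>
    (\<forall>vs. length vs = n \<longrightarrow> T (simple_tensor vs) = simple_tensor (map x vs)) \<and>
    (\<forall>w\<in>orthocomp (tensor_power UNIV n). T w = 0))"

text \<open>Positive operators of trace 1 on a closed subspace \<open>S\<close>, extended by 0 on its orthogonal
  complement.\<close>

definition density_operator :: "'i ell2 set \<Rightarrow> ('i ell2 \<Rightarrow> 'i ell2) \<Rightarrow> bool"
  where "density_operator S A \<longleftrightarrow> bounded_clinear A \<and>
    (\<forall>w. A w \<in> S) \<and> (\<forall>w\<in>orthocomp S. A w = 0) \<and>
    (\<forall>w. cinner w (A w) \<in> \<real>\<^sub>\<ge>\<^sub>0) \<and> trace A = 1"


section \<open>Unitary groups, contractions and inductive limits\<close>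

text \<open>Operators on a closed subspace \<open>K\<close> are identified with operators on the whole space that
  preserve \<open>K\<close> and are the identity on the orthogonal complement of \<open>K\<close>.  For a unitary, preserving
  \<open>K\<close> follows from being the identity on the complement.\<close>

definition unitaries :: "'h::complex_hilbert set \<Rightarrow> ('h \<Rightarrow> 'h) set"
  where "unitaries K = {u. bounded_clinear u \<and> surj u \<and> (\<forall>x y. cinner (u x) (u y) = cinner x y) \<and>
    (\<forall>x\<in>orthocomp K. u x = x)}"

definition contractions :: "'h::complex_hilbert set \<Rightarrow> ('h \<Rightarrow> 'h) set"
  where "contractions K = {x. bounded_clinear x \<and> (\<forall>v. norm (x v) \<le> norm v) \<and> x ` K \<subseteq> K \<and>
    (\<forall>v\<in>orthocomp K. x v = v)}"

text \<open>The group \<open>lim U(E N)\<close> for an increasing sequence of closed subspaces \<open>E 1 \<subseteq> E 2 \<subseteq> \<dots>\<close>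
  (\<open>E 0\<close> is irrelevant).\<close>

definition limit_unitary_group :: "(nat \<Rightarrow> 'h::complex_hilbert set) \<Rightarrow> ('h \<Rightarrow> 'h) monoid"
  where "limit_unitary_group E =
    \<lparr>carrier = (\<Union>N\<in>{1..}. unitaries (E N)), mult = (\<circ>), one = id\<rparr>"

text \<open>The topology of the function type \<open>'h \<Rightarrow> 'h\<close> is that of pointwise convergence, so
  \<open>top_of_set (unitaries K)\<close> is the strong operator topology.\<close>

definition limit_unitary_topology :: "(nat \<Rightarrow> 'h::complex_hilbert set) \<Rightarrow> ('h \<Rightarrow> 'h) topology"
  where "limit_unitary_topology E = topology (\<lambda>S. S \<subseteq> (\<Union>N\<in>{1..}. unitaries (E N)) \<and>
    (\<forall>N\<ge>1. openin (top_of_set (unitaries (E N))) (S \<inter> unitaries (E N))))"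

lemma openin_limit_unitary_topology:
  "openin (limit_unitary_topology E) S \<longleftrightarrow> S \<subseteq> (\<Union>N\<in>{1..}. unitaries (E N)) \<and>
    (\<forall>N\<ge>1. openin (top_of_set (unitaries (E N))) (S \<inter> unitaries (E N)))"
proof -
  let ?P = "\<lambda>S. S \<subseteq> (\<Union>N\<in>{1..}. unitaries (E N)) \<and>
    (\<forall>N\<ge>1. openin (top_of_set (unitaries (E N))) (S \<inter> unitaries (E N)))"
  have "istopology ?P"
    unfolding istopology_def
  proof (intro conjI allI impI)
    fix S T assume S: "?P S" and T: "?P T"
    then show "S \<inter> T \<subseteq> (\<Union>N\<in>{1..}. unitaries (E N))" by blast
    fix N :: nat assume N: "N \<ge> 1"
    have "openin (top_of_set (unitaries (E N))) ((S \<inter> unitaries (E N)) \<inter> (T \<inter> unitaries (E N)))"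
      by (rule openin_Int[OF S[THEN conjunct2, rule_format, OF N] T[THEN conjunct2, rule_format, OF N]])
    moreover have "(S \<inter> unitaries (E N)) \<inter> (T \<inter> unitaries (E N)) = S \<inter> T \<inter> unitaries (E N)"
      by blast
    ultimately show "openin (top_of_set (unitaries (E N))) (S \<inter> T \<inter> unitaries (E N))" by simp
  next
    fix \<S> assume \<S>: "\<forall>S\<in>\<S>. ?P S"
    then show "\<Union>\<S> \<subseteq> (\<Union>N\<in>{1..}. unitaries (E N))" by blast
    fix N :: nat assume N: "N \<ge> 1"
    have "openin (top_of_set (unitaries (E N))) (\<Union>S\<in>\<S>. S \<inter> unitaries (E N))"
      by (rule openin_Union) (use \<S> N in blast)
    then show "openin (top_of_set (unitaries (E N))) (\<Union>\<S> \<inter> unitaries (E N))"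
      by (simp only: Int_Union2)
  qed
  then show ?thesis unfolding limit_unitary_topology_def by (simp only: topology_inverse')
qed


section \<open>Positive definite functions and generalized characters\<close>

definition positive_definite :: "('g, 'm) monoid_scheme \<Rightarrow> ('g \<Rightarrow> complex) \<Rightarrow> bool"
  where "positive_definite G \<phi> \<longleftrightarrow> (\<forall>S c. finite S \<and> S \<subseteq> carrier G \<longrightarrow>
    (\<Sum>g\<in>S. \<Sum>h\<in>S. c g * cnj (c h) * \<phi> (m_inv G h \<otimes>\<^bsub>G\<^esub> g)) \<in> \<real>\<^sub>\<ge>\<^sub>0)"

text \<open>Functions on a group \<open>G\<close> are functions on the ambient type that are \<open>undefined\<close> off
  \<open>carrier G\<close>; this set is closed under convex combinations.\<close>

definition normalized_pd ::
    "('g, 'm) monoid_scheme \<Rightarrow> 'g topology \<Rightarrow> ('g \<Rightarrow> complex) set"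
  where "normalized_pd G T = {\<phi> \<in> extensional (carrier G).
    continuous_map T euclidean \<phi> \<and> positive_definite G \<phi> \<and> \<phi> \<one>\<^bsub>G\<^esub> = 1}"

definition conj_invariant :: "('g, 'm) monoid_scheme \<Rightarrow> 'g set \<Rightarrow> ('g \<Rightarrow> complex) \<Rightarrow> bool"
  where "conj_invariant G K \<phi> \<longleftrightarrow>
    (\<forall>g\<in>carrier G. \<forall>k\<in>K. \<phi> (k \<otimes>\<^bsub>G\<^esub> g \<otimes>\<^bsub>G\<^esub> m_inv G k) = \<phi> g)"

definition convex_comb :: "real \<Rightarrow> ('g \<Rightarrow> complex) \<Rightarrow> ('g \<Rightarrow> complex) \<Rightarrow> 'g \<Rightarrow> complex"
  where "convex_comb t \<phi> \<psi> = (\<lambda>g. complex_of_real t * \<phi> g + complex_of_real (1 - t) * \<psi> g)"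

definition convex_functions :: "('g \<Rightarrow> complex) set \<Rightarrow> bool"
  where "convex_functions C \<longleftrightarrow> (\<forall>\<phi>\<in>C. \<forall>\<psi>\<in>C. \<forall>t\<in>{0..1}. convex_comb t \<phi> \<psi> \<in> C)"

definition extreme_functions :: "('g \<Rightarrow> complex) set \<Rightarrow> ('g \<Rightarrow> complex) set"
  where "extreme_functions C = {\<phi>\<in>C. \<forall>\<phi>1\<in>C. \<forall>\<phi>2\<in>C. \<forall>t\<in>{0<..<1}.
    \<phi> = convex_comb t \<phi>1 \<phi>2 \<longrightarrow> \<phi>1 = \<phi> \<and> \<phi>2 = \<phi>}"

definition affinely_isomorphic :: "('g \<Rightarrow> complex) set \<Rightarrow> ('k \<Rightarrow> complex) set \<Rightarrow> bool"
  where "affinely_isomorphic C D \<longleftrightarrow> convex_functions C \<and> convex_functions D \<and>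
    (\<exists>T. bij_betw T C D \<and>
      (\<forall>\<phi>\<in>C. \<forall>\<psi>\<in>C. \<forall>t\<in>{0..1}. T (convex_comb t \<phi> \<psi>) = convex_comb t (T \<phi>) (T \<psi>)))"

definition generalized_characters ::
    "('g, 'm) monoid_scheme \<Rightarrow> 'g topology \<Rightarrow> 'g set \<Rightarrow> ('g \<Rightarrow> complex) set"
  where "generalized_characters G T K =
    extreme_functions {\<phi> \<in> normalized_pd G T. conj_invariant G K \<phi>}"

definition finite_characters ::
    "('g, 'm) monoid_scheme \<Rightarrow> 'g topology \<Rightarrow> ('g \<Rightarrow> complex) set"
  where "finite_characters G T =
    extreme_functions {\<psi> \<in> normalized_pd G T. conj_invariant G (carrier G) \<psi>}"


section \<open>Holomorphic positive definite functions\<close>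

text \<open>\<open>holomorphic_expansion K c A \<phi>\<close> says that \<open>\<phi>(u) = \<Sum>\<^sub>n c\<^sub>n Tr[A\<^sub>n u\<^sup>\<otimes>\<^sup>n]\<close> on \<open>U(K)\<close>, with \<open>A\<^sub>n \<ge> 0\<close>
  of trace 1 on the \<open>n\<close>-th tensor power of \<open>K\<close>, \<open>c\<^sub>n \<ge> 0\<close> and \<open>\<Sum>\<^sub>n c\<^sub>n = 1\<close>.  A normalized positive
  definite function on \<open>U(K)\<close> is holomorphic if it has such an expansion.\<close>

definition holomorphic_expansion :: "'h::complex_hilbert set \<Rightarrow> (nat \<Rightarrow> real) \<Rightarrow>
    (nat \<Rightarrow> 'h list ell2 \<Rightarrow> 'h list ell2) \<Rightarrow> (('h \<Rightarrow> 'h) \<Rightarrow> complex) \<Rightarrow> bool"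
  where "holomorphic_expansion K c A \<phi> \<longleftrightarrow>
    (\<forall>n. 0 \<le> c n) \<and> c sums 1 \<and> (\<forall>n. density_operator (tensor_power K n) (A n)) \<and>
    (\<forall>u\<in>unitaries K. (\<lambda>n. complex_of_real (c n) * trace (A n \<circ> tensor_op n u)) sums \<phi> u)"

definition holomorphic :: "(nat \<Rightarrow> 'h::complex_hilbert set) \<Rightarrow> (('h \<Rightarrow> 'h) \<Rightarrow> complex) \<Rightarrow> bool"
  where "holomorphic E \<phi> \<longleftrightarrow> (\<forall>N\<ge>1. \<exists>c A. holomorphic_expansion (E N) c A \<phi>)"

text \<open>The extension of a holomorphic function on \<open>lim U(E N)\<close> to the union of the contraction
  semigroups of the \<open>E N\<close>; for finite-dimensional \<open>E N\<close> the value depends neither on \<open>N\<close> nor on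
  the expansion.\<close>

definition holomorphic_extension ::
    "(nat \<Rightarrow> 'h::complex_hilbert set) \<Rightarrow> (('h \<Rightarrow> 'h) \<Rightarrow> complex) \<Rightarrow> ('h \<Rightarrow> 'h) \<Rightarrow> complex"
  where "holomorphic_extension E \<psi> x = (THE z. \<exists>N\<ge>1. \<exists>c A.
    x \<in> contractions (E N) \<and> holomorphic_expansion (E N) c A \<psi> \<and>
    (\<lambda>n. complex_of_real (c n) * trace (A n \<circ> tensor_op n x)) sums z)"


section \<open>The pair of groups attached to a flag with orthonormal vectors\<close>

definition fspan :: "(nat \<Rightarrow> 'h::complex_hilbert) \<Rightarrow> nat \<Rightarrow> 'h set"
  where "fspan f N = complex_vector.span (f ` {1..N})"

definition Hminus :: "(nat \<Rightarrow> 'h::complex_hilbert) \<Rightarrow> 'h set"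
  where "Hminus f = closure (complex_vector.span (f ` {1..}))"

definition Phi :: "(nat \<Rightarrow> 'h::complex_hilbert) \<Rightarrow> ('h \<Rightarrow> 'h) \<Rightarrow> 'h \<Rightarrow> 'h"
  where "Phi f x = orth_proj (Hminus f) \<circ> x \<circ> orth_proj (Hminus f)"

text \<open>\<open>Phi f W\<close> is 0 on the complement of \<open>Hminus f\<close>.  As an operator on \<open>Hminus f\<close> it is
  represented, as above, by its extension by the identity.\<close>

definition extend_id :: "'h::complex_hilbert set \<Rightarrow> ('h \<Rightarrow> 'h) \<Rightarrow> 'h \<Rightarrow> 'h"
  where "extend_id K x = (\<lambda>v. x (orth_proj K v) + (v - orth_proj K v))"

text \<open>As operators on the whole space, \<open>limit_unitary_group (fspan f)\<close> is both \<open>U(\<infinity>)\<close> and the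
  subgroup \<open>I \<times> U(\<infinity>)\<close> of \<open>limit_unitary_group H\<close>.\<close>

definition C1 :: "(nat \<Rightarrow> 'h::complex_hilbert set) \<Rightarrow> (nat \<Rightarrow> 'h) \<Rightarrow> (('h \<Rightarrow> 'h) \<Rightarrow> complex) set"
  where "C1 H f = {\<phi> \<in> normalized_pd (limit_unitary_group H) (limit_unitary_topology H).
    holomorphic H \<phi> \<and>
    conj_invariant (limit_unitary_group H) (carrier (limit_unitary_group (fspan f))) \<phi> \<and>
    (\<forall>W\<in>carrier (limit_unitary_group H). (\<forall>v\<in>Hminus f. W v = v) \<longrightarrow> \<phi> W = 1)}"

definition C2 :: "(nat \<Rightarrow> 'h::complex_hilbert) \<Rightarrow> (('h \<Rightarrow> 'h) \<Rightarrow> complex) set"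
  where "C2 f =
    {\<psi> \<in> normalized_pd (limit_unitary_group (fspan f)) (limit_unitary_topology (fspan f)).
      holomorphic (fspan f) \<psi> \<and>
      conj_invariant (limit_unitary_group (fspan f)) (carrier (limit_unitary_group (fspan f))) \<psi>}"

end

theory Submission
  imports Defs "HOL-Complex_Analysis.Complex_Analysis"
begin

text \<open>On \<open>U(K)\<close>, a normalized holomorphic function is \<open>u \<mapsto> \<Sum>\<^sub>k \<langle>w\<^sub>k, \<Gamma>(u) w\<^sub>k\<rangle>\<close>, with \<open>\<Gamma>(u)\<close> the direct sum of
  all \<open>u\<^sup>\<otimes>\<^sup>n\<close> and vectors \<open>w\<^sub>k\<close> in the Fock space \<open>\<Oplus>\<^sub>n K\<^sup>\<otimes>\<^sup>n\<close> with \<open>\<Sum>\<^sub>k \<parallel>w\<^sub>k\<parallel>\<^sup>2 = 1\<close>.  If \<open>\<phi>\<close> is in \<open>C1\<close>, put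
  \<open>F\<^sub>N = \<langle>f\<^sub>1, \<dots>, f\<^sub>N\<rangle>\<close>; then \<open>\<phi> = 1\<close> on the unitaries that are a scalar \<open>z\<close> on \<open>H\<^sub>N \<ominus> F\<^sub>N\<close> and trivial elsewhere, so
  these fix every \<open>w\<^sub>k\<close>, and every \<open>w\<^sub>k\<close> lies in the Fock space of \<open>F\<^sub>N\<close>.  Hence \<open>\<phi>(W)\<close> only depends on the
  compression of \<open>W\<close> to \<open>F\<^sub>N\<close>, and the same \<open>w\<^sub>k\<close> represent the restriction of \<open>\<phi>\<close> to \<open>U(F\<^sub>N)\<close>.  The value at a
  contraction is determined by the values at unitaries: a contraction of a finite-dimensional space is a
  product of unitaries and of operators \<open>1 + (z - 1) |e\<rangle>\<langle>e|\<close> with \<open>\<bar>z\<bar> \<le> 1\<close>, and in each \<open>z\<close> the maximum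
  principle applies.  So restriction and \<open>\<chi> \<mapsto> \<chi>^ \<circ> \<Phi>\<close> are mutually inverse.  For extreme points one needs that
  a central positive definite function dominated by a holomorphic one is holomorphic; this is a
  Radon-Nikodym argument in a multiple of the Fock space.\<close>

section \<open>Hilbert spaces\<close>

text \<open>Weights and density operators are merged into one sequence of vectors in Fock space. The
  grading is then hidden, and statements about a contraction \<open>x\<close> rest on its second
  quantization being a contraction; degrees return only when an expansion has to be exhibited.
  Density operators are cut into rank one pieces by elimination along a basis, not along
  eigenvectors, and a positive operator is written as a series of squares, not as the square of a
  root. The affine isomorphism alone does not settle extremality: \<open>\<phi>\<close> is extreme
  among all invariant functions, and its restriction must be extreme among all central functions,
  holomorphic or not. Hence \<open>C2 f\<close> has to be a face of the latter set. The sum of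
  matrix coefficients becomes a single vector state on an infinite multiple of Fock space. The
  vectors found by Radon-Nikodym lie in the cyclic subspace of that state, so their components stay
  in the Fock space of the same finite-dimensional space, and holomorphy survives.\<close>

instance complex_hilbert \<subseteq> banach ..

lemma cinner_add_left: "cinner (x + y) z = cinner x z + cinner y (z::'a::complex_hilbert)"
  by (metis cinner_add_right cinner_commute complex_cnj_add)

lemma cinner_scaleC_left: "cinner (a *\<^sub>C x) y = cnj a * cinner x (y::'a::complex_hilbert)"
  by (metis cinner_scaleC_right cinner_commute complex_cnj_mult)

lemma norm_scaleC: "norm (a *\<^sub>C x) = cmod a * norm (x::'a::complex_hilbert)"
proof -
  have "complex_of_real ((norm (a *\<^sub>C x))\<^sup>2) = cnj a * a * complex_of_real ((norm x)\<^sup>2)"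
    unfolding cinner_self[symmetric] by (simp add: cinner_scaleC_left cinner_scaleC_right)
  also have "\<dots> = complex_of_real ((cmod a * norm x)\<^sup>2)"
    by (simp add: power_mult_distrib complex_norm_square mult.commute del: of_real_power)
  finally have "(norm (a *\<^sub>C x))\<^sup>2 = (cmod a * norm x)\<^sup>2"
    using of_real_eq_iff by blast
  then show ?thesis by (simp add: power2_eq_iff_nonneg)
qed

lemma norm_add_square:
  "(norm (x + y))\<^sup>2 = (norm x)\<^sup>2 + (norm y)\<^sup>2 + 2 * Re (cinner x (y::'a::complex_hilbert))"
proof -
  have "complex_of_real ((norm (x + y))\<^sup>2) =
      complex_of_real ((norm x)\<^sup>2) + complex_of_real ((norm y)\<^sup>2) + (cinner x y + cnj (cinner x y))"
    unfolding cinner_self[symmetric] using cinner_commute[of y x]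
    by (simp add: cinner_add_left cinner_add_right)
  also have "\<dots> = complex_of_real ((norm x)\<^sup>2 + (norm y)\<^sup>2 + 2 * Re (cinner x y))"
    by (simp only: complex_add_cnj of_real_add)
  finally show ?thesis using of_real_eq_iff by blast
qed

lemma cinner_zero_right [simp]: "cinner x (0::'a::complex_hilbert) = 0"
  using cinner_add_right[of x 0 0] by simp

lemma cinner_zero_left [simp]: "cinner (0::'a::complex_hilbert) x = 0"
  using cinner_commute[of 0 x] by simp

lemma Re_cinner_self: "Re (cinner x x) = (norm (x::'a::complex_hilbert))\<^sup>2"
  by (simp add: cinner_self)

lemma scaleC_minus1: "(-1) *\<^sub>C x = - (x::'a::complex_hilbert)"
  using complex_vector.scale_minus_left[of 1 x] by simp

lemma cinner_Cauchy_Schwarz: "cmod (cinner x y) \<le> norm x * norm (y::'a::complex_hilbert)"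
proof (cases "x = 0")
  case False
  let ?c = "cinner x y" and ?n = "(norm x)\<^sup>2"
  let ?a = "- ?c / complex_of_real ?n"
  have n: "?n > 0" using False by simp
  have "0 \<le> (norm (y + ?a *\<^sub>C x))\<^sup>2" by simp
  also have "\<dots> = (norm y)\<^sup>2 + (cmod ?a * norm x)\<^sup>2 + 2 * Re (?a * cnj ?c)"
    unfolding norm_add_square norm_scaleC cinner_scaleC_right using cinner_commute[of y x] by simp
  also have "(cmod ?a * norm x)\<^sup>2 = (cmod ?c)\<^sup>2 / ?n"
    using n by (simp add: norm_divide power_mult_distrib power_divide norm_power norm_mult)
      (simp add: power2_eq_square power4_eq_xxxx)
  also have "Re (?a * cnj ?c) = - ((cmod ?c)\<^sup>2 / ?n)"
  proof -
    have "?a * cnj ?c = complex_of_real (- ((cmod ?c)\<^sup>2 / ?n))"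
      by (simp add: complex_norm_square[of ?c] of_real_divide del: of_real_power)
    then show ?thesis by (simp only: Re_complex_of_real)
  qed
  finally have "(cmod ?c)\<^sup>2 / ?n \<le> (norm y)\<^sup>2" by simp
  then have "(cmod ?c)\<^sup>2 \<le> (norm x * norm y)\<^sup>2"
    using n by (simp add: divide_le_eq power_mult_distrib mult.commute)
  then show ?thesis by (rule power2_le_imp_le) simp
qed simp

lemma cinner_scaleR_right: "cinner x (r *\<^sub>R y) = r *\<^sub>R cinner x (y::'a::complex_hilbert)"
  by (simp add: scaleR_scaleC cinner_scaleC_right scaleR_conv_of_real)

lemma cinner_scaleR_left: "cinner (r *\<^sub>R x) y = r *\<^sub>R cinner x (y::'a::complex_hilbert)"
  by (simp add: scaleR_scaleC cinner_scaleC_left scaleR_conv_of_real)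

interpretation cinner: bounded_bilinear "cinner :: 'a::complex_hilbert \<Rightarrow> 'a \<Rightarrow> complex"
  by standard
    (auto simp: cinner_add_left cinner_add_right cinner_scaleR_left cinner_scaleR_right
      intro!: exI[of _ 1] cinner_Cauchy_Schwarz)

lemma norm_diff_square:
  "(norm (x - y))\<^sup>2 = (norm x)\<^sup>2 + (norm y)\<^sup>2 - 2 * Re (cinner x (y::'a::complex_hilbert))"
  using norm_add_square[of x "- y"] by (simp add: cinner.minus_right)

lemma cinner_eqI: "(\<And>y. cinner x y = cinner x' y) \<Longrightarrow> x = (x'::'a::complex_hilbert)"
proof -
  assume a: "\<And>y. cinner x y = cinner x' y"
  then have "cinner (x - x') (x - x') = 0" by (simp only: cinner.diff_left diff_self)
  then show ?thesis by (simp add: cinner_self)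
qed

lemma bounded_linear_scaleC: "bounded_linear (\<lambda>x::'a::complex_hilbert. a *\<^sub>C x)"
  by (rule bounded_linear_intro[of _ "cmod a"])
    (simp_all add: scaleC_add_right scaleR_scaleC scaleC_scaleC norm_scaleC mult.commute)

lemma bounded_bilinear_scaleC: "bounded_bilinear (\<lambda>a (x::'a::complex_hilbert). a *\<^sub>C x)"
  by standard
    (auto simp: scaleC_add_right scaleC_add_left scaleR_scaleC scaleC_scaleC norm_scaleC
      scaleR_conv_of_real mult.commute intro!: exI[of _ 1])

lemma bounded_clinearI:
  assumes "\<And>x y. T (x + y) = T x + T y" "\<And>a x. T (a *\<^sub>C x) = a *\<^sub>C T x"
    "\<And>x. norm (T x) \<le> C * norm x"
  shows "bounded_clinear T"
  unfolding bounded_clinear_def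
  by (auto intro!: bounded_linear_intro[of _ C] simp: assms scaleR_scaleC mult.commute[of _ C])

lemma bounded_clinear_bounded_linear: "bounded_clinear T \<Longrightarrow> bounded_linear T"
  by (simp add: bounded_clinear_def)

lemma bounded_clinear_add: "bounded_clinear T \<Longrightarrow> T (x + y) = T x + T y"
  by (simp add: bounded_clinear_def linear_simps)

lemma bounded_clinear_diff: "bounded_clinear T \<Longrightarrow> T (x - y) = T x - T y"
  by (simp add: bounded_clinear_def linear_simps)

lemma bounded_clinear_zero: "bounded_clinear T \<Longrightarrow> T 0 = 0"
  by (simp add: bounded_clinear_def linear_simps)

lemma bounded_clinear_scaleC: "bounded_clinear T \<Longrightarrow> T (a *\<^sub>C x) = a *\<^sub>C T x"
  by (simp add: bounded_clinear_def)

lemma bounded_clinear_sum: "bounded_clinear T \<Longrightarrow> T (\<Sum>i\<in>S. g i) = (\<Sum>i\<in>S. T (g i))"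
  using linear_sum bounded_linear.linear bounded_clinear_bounded_linear by blast

lemma bounded_clinear_continuous_on: "bounded_clinear T \<Longrightarrow> continuous_on S T"
  by (rule linear_continuous_on) (rule bounded_clinear_bounded_linear)

lemma bounded_clinear_comp:
  "bounded_clinear S \<Longrightarrow> bounded_clinear T \<Longrightarrow> bounded_clinear (S \<circ> T)"
  by (simp add: bounded_clinear_def bounded_linear_compose comp_def)

lemma bounded_clinear_id: "bounded_clinear id"
  by (simp add: bounded_clinear_def id_def)

lemma bounded_clinear_scaleC_const: "bounded_clinear (\<lambda>x. a *\<^sub>C x)"
  by (simp add: bounded_clinear_def bounded_linear_scaleC scaleC_scaleC mult.commute)

lemma bounded_clinear_plus:
  "bounded_clinear S \<Longrightarrow> bounded_clinear T \<Longrightarrow> bounded_clinear (\<lambda>x. S x + T x)"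
  by (simp add: bounded_clinear_def bounded_linear_add scaleC_add_right)

lemma bounded_clinear_minus:
  "bounded_clinear S \<Longrightarrow> bounded_clinear T \<Longrightarrow> bounded_clinear (\<lambda>x. S x - T x)"
  by (simp add: bounded_clinear_def bounded_linear_sub complex_vector.scale_right_diff_distrib)

section \<open>Closed subspaces, the Riesz representation and orthogonal projections\<close>

lemma subspace_closure:
  assumes "complex_vector.subspace M"
  shows "complex_vector.subspace (closure (M::'a::complex_hilbert set))"
proof (rule complex_vector.subspaceI)
  show "0 \<in> closure M" using complex_vector.subspace_0[OF assms] closure_subset by blast
  show "x + y \<in> closure M" if xy: "x \<in> closure M" "y \<in> closure M" for x y
  proof -
    obtain a b where "\<And>n. a n \<in> M" "a \<longlonglongrightarrow> x" "\<And>n. b n \<in> M" "b \<longlonglongrightarrow> y"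
      using xy by (metis closure_sequential)
    then show ?thesis unfolding closure_sequential
      by (intro exI[of _ "\<lambda>n. a n + b n"])
        (auto intro: tendsto_add complex_vector.subspace_add[OF assms])
  qed
  show "c *\<^sub>C x \<in> closure M" if x: "x \<in> closure M" for c x
  proof -
    obtain a where "\<And>n. a n \<in> M" "a \<longlonglongrightarrow> x"
      using x by (metis closure_sequential)
    then show ?thesis unfolding closure_sequential
      by (intro exI[of _ "\<lambda>n. c *\<^sub>C a n"])
        (auto intro: bounded_linear.tendsto[OF bounded_linear_scaleC] complex_vector.subspace_scale[OF assms])
  qed
qed

text \<open>The representing vector minimizes the functional \<open>\<parallel>v\<parallel>\<^sup>2 - 2 Re (l v)\<close>.\<close>

lemma riesz_on_subspace:
  fixes M :: "'a::complex_hilbert set"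
  assumes M: "complex_vector.subspace M"
    and add: "\<And>x y. x \<in> M \<Longrightarrow> y \<in> M \<Longrightarrow> l (x + y) = l x + l y"
    and scale: "\<And>a x. x \<in> M \<Longrightarrow> l (a *\<^sub>C x) = a * l x"
    and bd: "\<And>x. x \<in> M \<Longrightarrow> cmod (l x) \<le> C * norm x"
  shows "\<exists>\<xi>\<in>closure M. \<forall>x\<in>M. cinner \<xi> x = l x"
proof -
  define J where "J v = (norm v)\<^sup>2 - 2 * Re (l v)" for v
  have Jlow: "J v \<ge> - (C\<^sup>2)" if "v \<in> M" for v
  proof -
    have "Re (l v) \<le> C * norm v" using bd[OF that] complex_Re_le_cmod[of "l v"] by linarith
    moreover have "0 \<le> (norm v - C)\<^sup>2" by simp
    ultimately show ?thesis by (simp add: J_def power2_diff mult.commute)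
  qed
  define d where "d = (INF v\<in>M. J v)"
  have bb: "bdd_below (J ` M)" using Jlow by (intro bdd_belowI2)
  have dle: "d \<le> J v" if "v \<in> M" for v
    unfolding d_def by (rule cINF_lower[OF bb that])
  have "\<exists>v\<in>M. J v < d + inverse (real (Suc n))" for n
    using cINF_less_iff[OF _ bb, of "d + inverse (real (Suc n))"] complex_vector.subspace_0[OF M]
    unfolding d_def by (auto simp: less_add_same_cancel1)
  then obtain v where v: "\<And>n. v n \<in> M" and Jv: "\<And>n. J (v n) < d + inverse (real (Suc n))"
    by metis
  \<comment> \<open>Parallelogram identity; the linear part of \<open>J\<close> cancels. Near the
    infimum the right side is small, so the minimizing sequence is Cauchy.\<close>
  have mid: "(norm (a - b))\<^sup>2 = 2 * J a + 2 * J b - 4 * J ((1/2) *\<^sub>C (a + b))"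
    if "a \<in> M" "b \<in> M" for a b
    using that unfolding J_def
    by (simp add: norm_scaleC norm_add_square norm_diff_square scale add complex_vector.subspace_add[OF M]
        power_mult_distrib power_divide) (simp add: field_simps)
  have close: "(norm (v m - v n))\<^sup>2 \<le> 2 * inverse (real (Suc m)) + 2 * inverse (real (Suc n))" for m n
  proof -
    have "(1/2) *\<^sub>C (v m + v n) \<in> M"
      by (intro complex_vector.subspace_scale[OF M] complex_vector.subspace_add[OF M] v)
    from dle[OF this] show ?thesis using mid[OF v[of m] v[of n]] Jv[of m] Jv[of n] by linarith
  qed
  have "Cauchy v"
  proof (rule CauchyI)
    fix e :: real assume e: "e > 0"
    obtain N where N: "inverse (real (Suc N)) < e\<^sup>2 / 4"
      using reals_Archimedean[of "e\<^sup>2 / 4"] e by auto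
    have "norm (v m - v n) < e" if "m \<ge> N" "n \<ge> N" for m n
    proof -
      have "inverse (real (Suc m)) \<le> inverse (real (Suc N))" "inverse (real (Suc n)) \<le> inverse (real (Suc N))"
        using that by (auto simp: field_simps)
      then have "(norm (v m - v n))\<^sup>2 < e\<^sup>2" using close[of m n] N by linarith
      then show ?thesis using e by (simp add: power2_less_imp_less)
    qed
    then show "\<exists>M. \<forall>m\<ge>M. \<forall>n\<ge>M. norm (v m - v n) < e" by blast
  qed
  then obtain \<xi> where \<xi>: "v \<longlonglongrightarrow> \<xi>" using Cauchy_convergent_iff convergent_def by blast
  have "\<xi> \<in> closure M" using v \<xi> closure_sequential by blast
  moreover have "cinner \<xi> x = l x" if x: "x \<in> M" for x
  proof -
    define \<delta> where "\<delta> = cinner \<xi> x - l x"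
    \<comment> \<open>Minimality tested at \<open>v n + a *\<^sub>C x\<close>: the slack in
      \<open>J (v n)\<close> vanishes in the limit, and the first and second order terms in
      \<open>a\<close> remain.\<close>
    have ineq: "0 \<le> 2 * Re (a * \<delta>) + (cmod a)\<^sup>2 * (norm x)\<^sup>2" for a
    proof (rule LIMSEQ_le)
      show "(\<lambda>n. - inverse (real (Suc n))) \<longlonglongrightarrow> 0"
        using tendsto_minus[OF LIMSEQ_inverse_real_of_nat] by simp
      show "(\<lambda>n. 2 * Re (a * (cinner (v n) x - l x)) + (cmod a)\<^sup>2 * (norm x)\<^sup>2)
          \<longlonglongrightarrow> 2 * Re (a * \<delta>) + (cmod a)\<^sup>2 * (norm x)\<^sup>2"
        unfolding \<delta>_def by (intro tendsto_intros cinner.tendsto \<xi>)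
      have "- inverse (real (Suc n)) \<le> 2 * Re (a * (cinner (v n) x - l x)) + (cmod a)\<^sup>2 * (norm x)\<^sup>2" for n
      proof -
        have "d \<le> J (v n + a *\<^sub>C x)"
          by (intro dle complex_vector.subspace_scale[OF M] complex_vector.subspace_add[OF M] v x)
        also have "\<dots> = J (v n) + 2 * Re (a * (cinner (v n) x - l x)) + (cmod a)\<^sup>2 * (norm x)\<^sup>2"
          unfolding J_def using x v[of n]
          by (simp add: norm_scaleC norm_add_square scale add complex_vector.subspace_scale[OF M]
              cinner_scaleC_right power_mult_distrib algebra_simps)
        finally show ?thesis using Jv[of n] by linarith
      qed
      then show "\<exists>N. \<forall>n\<ge>N. - inverse (real (Suc n))
          \<le> 2 * Re (a * (cinner (v n) x - l x)) + (cmod a)\<^sup>2 * (norm x)\<^sup>2" by blast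
    qed
    have "\<delta> = 0"
    proof (rule ccontr)
      assume "\<delta> \<noteq> 0"
      \<comment> \<open>For \<open>a = - s * cnj \<delta>\<close> the first order term is
        \<open>- 2 * s * (cmod \<delta>)\<^sup>2\<close>, and this \<open>s\<close> keeps the second
        order term below half its size. The summand 1 covers \<open>x = 0\<close>.\<close>
      define s where "s = 1 / ((norm x)\<^sup>2 + 1)"
      have s: "s > 0" "s * (norm x)\<^sup>2 < 1" by (auto simp: s_def add_nonneg_pos divide_less_eq)
      have "2 * Re ((- complex_of_real s * cnj \<delta>) * \<delta>) = - 2 * s * (cmod \<delta>)\<^sup>2"
        unfolding cmod_power2 by (simp add: power2_eq_square algebra_simps)
      moreover have "(cmod (- complex_of_real s * cnj \<delta>))\<^sup>2 * (norm x)\<^sup>2 = s * (cmod \<delta>)\<^sup>2 * (s * (norm x)\<^sup>2)"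
        using s by (simp add: norm_mult power_mult_distrib power2_eq_square)
      moreover have "s * (cmod \<delta>)\<^sup>2 * (s * (norm x)\<^sup>2) \<le> s * (cmod \<delta>)\<^sup>2 * 1"
        using s by (intro mult_left_mono) auto
      moreover have "s * (cmod \<delta>)\<^sup>2 > 0" using s \<open>\<delta> \<noteq> 0\<close> by simp
      ultimately show False using ineq[of "- complex_of_real s * cnj \<delta>"] by linarith
    qed
    then show ?thesis by (simp add: \<delta>_def)
  qed
  ultimately show ?thesis by blast
qed

lemma orthocomp_subspace: "complex_vector.subspace (orthocomp K)"
  by (rule complex_vector.subspaceI) (auto simp: orthocomp_def cinner_add_right cinner_scaleC_right)

lemma orthocomp_disjoint: "x \<in> K \<Longrightarrow> x \<in> orthocomp K \<Longrightarrow> x = 0"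
  by (auto simp: orthocomp_def cinner_self dest!: bspec)

lemma orthocomp_anti_mono: "K \<subseteq> L \<Longrightarrow> orthocomp L \<subseteq> orthocomp K"
  by (auto simp: orthocomp_def)

lemma orthocompD: "x \<in> orthocomp K \<Longrightarrow> y \<in> K \<Longrightarrow> cinner y x = 0"
  by (simp add: orthocomp_def)

lemma orthocompD': "x \<in> orthocomp K \<Longrightarrow> y \<in> K \<Longrightarrow> cinner x y = 0"
  using cinner_commute[of x y] by (simp add: orthocomp_def)

lemma cinner_closure_eq_0:
  assumes "x \<in> closure S" "\<And>y. y \<in> S \<Longrightarrow> cinner y v = 0"
  shows "cinner x v = 0"
proof -
  obtain a where a: "\<And>n. a n \<in> S" "a \<longlonglongrightarrow> x" using assms(1) by (metis closure_sequential)
  have "(\<lambda>n. cinner (a n) v) \<longlonglongrightarrow> cinner x v" by (intro cinner.tendsto a tendsto_const)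
  then show ?thesis using assms(2)[OF a(1)] by (simp add: LIMSEQ_const_iff)
qed

lemma cinner_span_eq_0:
  assumes "x \<in> complex_vector.span S" "\<And>y. y \<in> S \<Longrightarrow> cinner y v = 0"
  shows "cinner x v = 0"
  using assms(1)
proof (induction rule: complex_vector.span_induct_alt)
  case (step c x y) then show ?case by (simp add: cinner_add_left cinner_scaleC_left assms(2))
qed simp

lemma orthocomp_closure_span [simp]: "orthocomp (closure (complex_vector.span S)) = orthocomp S"
proof
  show "orthocomp (closure (complex_vector.span S)) \<subseteq> orthocomp S"
    using complex_vector.span_superset closure_subset by (intro orthocomp_anti_mono) blast
  show "orthocomp S \<subseteq> orthocomp (closure (complex_vector.span S))"
    unfolding orthocomp_def by (blast intro: cinner_closure_eq_0 cinner_span_eq_0)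
qed

lemma subspace_closure_span: "complex_vector.subspace (closure (complex_vector.span S))"
  by (intro subspace_closure complex_vector.subspace_span)

locale closed_complex_subspace =
  fixes K :: "'a::complex_hilbert set"
  assumes subspace: "complex_vector.subspace K" and closed: "closed K"
begin

lemma ex1_proj: "\<exists>!p. p \<in> K \<and> u - p \<in> orthocomp K"
proof -
  obtain p where p: "p \<in> closure K" "\<And>x. x \<in> K \<Longrightarrow> cinner p x = cinner u x"
    using riesz_on_subspace[OF subspace, of "cinner u" "norm u"]
    by (auto simp: cinner_add_right cinner_scaleC_right cinner_Cauchy_Schwarz)
  have "u - p \<in> orthocomp K"
    using p(2) by (auto simp: orthocomp_def cinner.diff_right) (metis cinner_commute)
  moreover have "p \<in> K" using p(1) closed by simp
  moreover have "q = p" if q: "q \<in> K" "u - q \<in> orthocomp K" for q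
  proof -
    have "p - q \<in> K" using \<open>p \<in> K\<close> q complex_vector.subspace_diff[OF subspace] by blast
    moreover have "p - q \<in> orthocomp K"
      using complex_vector.subspace_diff[OF orthocomp_subspace q(2) \<open>u - p \<in> orthocomp K\<close>] by simp
    ultimately show ?thesis using orthocomp_disjoint by fastforce
  qed
  ultimately show ?thesis by blast
qed

lemma proj_in: "orth_proj K u \<in> K" and proj_orth: "u - orth_proj K u \<in> orthocomp K"
  using theI'[OF ex1_proj, of u] by (auto simp: orth_proj_def)

lemma proj_eqI: "p \<in> K \<Longrightarrow> u - p \<in> orthocomp K \<Longrightarrow> orth_proj K u = p"
  using ex1_proj proj_in proj_orth by blast

lemma proj_fix: "u \<in> K \<Longrightarrow> orth_proj K u = u"
  by (rule proj_eqI) (auto simp: orthocomp_def)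

lemma proj_zero: "u \<in> orthocomp K \<Longrightarrow> orth_proj K u = 0"
  by (rule proj_eqI) (auto simp: complex_vector.subspace_0[OF subspace])

lemma norm_proj_square: "(norm u)\<^sup>2 = (norm (orth_proj K u))\<^sup>2 + (norm (u - orth_proj K u))\<^sup>2"
  using norm_add_square[of "orth_proj K u" "u - orth_proj K u"] orthocompD[OF proj_orth proj_in, of u u] by simp

lemma norm_proj_le: "norm (orth_proj K u) \<le> norm u"
  using norm_proj_square[of u] power2_le_imp_le[of "norm (orth_proj K u)" "norm u"] by simp

lemma bounded_clinear_proj: "bounded_clinear (orth_proj K)"
proof (rule bounded_clinearI[where C = 1])
  show "orth_proj K (x + y) = orth_proj K x + orth_proj K y" for x y
    using complex_vector.subspace_add[OF orthocomp_subspace proj_orth[of x] proj_orth[of y]]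
    by (intro proj_eqI complex_vector.subspace_add[OF subspace] proj_in) (simp add: algebra_simps)
  show "orth_proj K (a *\<^sub>C x) = a *\<^sub>C orth_proj K x" for a x
    using complex_vector.subspace_scale[OF orthocomp_subspace proj_orth[of x], of a]
    by (intro proj_eqI complex_vector.subspace_scale[OF subspace] proj_in)
      (simp add: complex_vector.scale_right_diff_distrib)
qed (simp add: norm_proj_le)

lemma cinner_proj_left: "cinner (orth_proj K x) y = cinner (orth_proj K x) (orth_proj K y)"
  using orthocompD[OF proj_orth[of y] proj_in[of x]] by (simp add: cinner.diff_right)

lemma cinner_proj_right: "cinner x (orth_proj K y) = cinner (orth_proj K x) (orth_proj K y)"
  by (metis cinner_commute cinner_proj_left)

lemma cinner_proj_commute: "cinner (orth_proj K x) y = cinner x (orth_proj K y)"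
  using cinner_proj_left cinner_proj_right by metis

text \<open>The residual of the projection is orthogonal to \<open>x\<close> and to
  \<open>orth_proj K x\<close>, hence to itself. So membership in \<open>K\<close> can be tested
  against \<open>orthocomp K\<close>, as in \<open>unitary_in\<close>.\<close>

lemma in_if_orth: "(\<And>y. y \<in> orthocomp K \<Longrightarrow> cinner y x = 0) \<Longrightarrow> x \<in> K"
proof -
  assume a: "\<And>y. y \<in> orthocomp K \<Longrightarrow> cinner y x = 0"
  have "cinner (x - orth_proj K x) (orth_proj K x) = 0"
    by (rule orthocompD'[OF proj_orth proj_in])
  then have "cinner (x - orth_proj K x) (x - orth_proj K x) = 0"
    using a[OF proj_orth, of x] by (simp add: cinner.diff_right)
  then show ?thesis using proj_in[of x] by (simp add: cinner_self)
qed

end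

lemma closed_complex_subspace_closure_span: "closed_complex_subspace (closure (complex_vector.span S))"
  by (simp add: closed_complex_subspace_def subspace_closure_span)

lemma closed_orthocomp: "closed (orthocomp K)"
proof -
  have "orthocomp K = (\<Inter>y\<in>K. cinner y -` {0})" by (auto simp: orthocomp_def)
  moreover have "closed (cinner y -` {0})" for y :: 'a
    by (intro continuous_closed_vimage closed_singleton)
      (simp add: linear_continuous_at cinner.bounded_linear_right)
  ultimately show ?thesis by auto
qed

text \<open>The adjoint inherits the same constant \<open>C\<close>, so that adjoints of
  contractions are contractions; \<open>fock_op_exists\<close> relies on this.\<close>

lemma ex_adjoint:
  fixes T :: "'a::complex_hilbert \<Rightarrow> 'b::complex_hilbert"
  assumes T: "bounded_clinear T" and C: "\<And>x. norm (T x) \<le> C * norm x" and C0: "0 \<le> C"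
  shows "\<exists>S. bounded_clinear S \<and> (\<forall>x y. cinner (S x) y = cinner x (T y)) \<and> (\<forall>x. norm (S x) \<le> C * norm x)"
proof -
  have "\<exists>\<xi>. \<forall>y. cinner \<xi> y = cinner x (T y)" for x
    using riesz_on_subspace[of UNIV "\<lambda>y. cinner x (T y)" "norm x * C"]
      order_trans[OF cinner_Cauchy_Schwarz mult_left_mono[OF C]]
    by (auto simp: complex_vector.subspace_UNIV bounded_clinear_add[OF T] bounded_clinear_scaleC[OF T]
        cinner_add_right cinner_scaleC_right mult.assoc)
  then obtain S where S: "\<And>x y. cinner (S x) y = cinner x (T y)" by metis
  have n: "norm (S x) \<le> C * norm x" for x
  proof (cases "S x = 0")
    case True
    show ?thesis using True C0 by simp
  next
    case False
    have "norm (S x) * norm (S x) = cmod (cinner (S x) (S x))" by (simp add: cinner_self norm_power) (simp add: power2_eq_square)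
    also have "\<dots> \<le> norm x * norm (T (S x))" unfolding S by (rule cinner_Cauchy_Schwarz)
    also have "\<dots> \<le> norm x * (C * norm (S x))" by (intro mult_left_mono C) simp
    finally have "norm (S x) * norm (S x) \<le> (C * norm x) * norm (S x)" by (simp add: mult_ac)
    then show ?thesis using False by simp
  qed
  have "bounded_clinear S"
    by (rule bounded_clinearI[OF _ _ n])
      (rule cinner_eqI, simp add: S cinner_add_left cinner_scaleC_left)+
  then show ?thesis using S n by blast
qed

section \<open>Orthonormal bases\<close>

lemma is_onb_exists: "\<exists>B::'a::complex_hilbert set. is_onb B"
proof -
  define P where "P = {B::'a set. \<forall>b\<in>B. \<forall>b'\<in>B. cinner b b' = (if b = b' then 1 else 0)}"
  have "\<exists>M\<in>P. \<forall>X\<in>P. M \<subseteq> X \<longrightarrow> X = M"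
  proof (rule subset_Zorn')
    fix C assume C: "subset.chain P C"
    show "\<Union>C \<in> P"
      unfolding P_def
    proof (intro CollectI ballI)
      fix b b' assume "b \<in> \<Union>C" "b' \<in> \<Union>C"
      then obtain X Y where "X \<in> C" "Y \<in> C" "b \<in> X" "b' \<in> Y" by blast
      moreover from this have "X \<subseteq> Y \<or> Y \<subseteq> X" "X \<in> P" "Y \<in> P"
        using C by (auto simp: subset.chain_def)
      ultimately show "cinner b b' = (if b = b' then 1 else 0)" unfolding P_def by blast
    qed
  qed
  then obtain B where B: "B \<in> P" and max: "\<And>X. X \<in> P \<Longrightarrow> B \<subseteq> X \<Longrightarrow> X = B" by blast
  interpret closed_complex_subspace "closure (complex_vector.span B)"
    by (rule closed_complex_subspace_closure_span)
  have "closure (complex_vector.span B) = UNIV"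
  proof (rule ccontr)
    assume "closure (complex_vector.span B) \<noteq> UNIV"
    then obtain u where u: "u \<notin> closure (complex_vector.span B)" by blast
    define w where "w = u - orth_proj (closure (complex_vector.span B)) u"
    have w0: "w \<noteq> 0" using u proj_in[of u] by (auto simp: w_def)
    have wo: "w \<in> orthocomp B" using proj_orth[of u] unfolding w_def by simp
    define e where "e = complex_of_real (inverse (norm w)) *\<^sub>C w"
    have e1: "cinner e e = 1" using w0 by (simp add: e_def cinner_self norm_scaleC norm_inverse)
    have eo: "e \<in> orthocomp B" unfolding e_def by (rule complex_vector.subspace_scale[OF orthocomp_subspace wo])
    have "insert e B \<in> P"
      unfolding P_def
    proof (intro CollectI ballI)
      fix b b' assume "b \<in> insert e B" "b' \<in> insert e B"
      moreover have "e \<notin> B" using orthocompD[OF eo] e1 by fastforce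
      ultimately show "cinner b b' = (if b = b' then 1 else 0)"
        using B e1 orthocompD[OF eo] orthocompD'[OF eo] unfolding P_def by auto
    qed
    then have "e \<in> B" using max by blast
    then show False using orthocompD[OF eo] e1 by fastforce
  qed
  then show ?thesis using B unfolding is_onb_def P_def by blast
qed

lemma is_onb_hbasis: "is_onb hbasis"
  unfolding hbasis_def by (rule someI_ex) (rule is_onb_exists)

lemma is_onb_has_sum:
  assumes B: "is_onb B"
  shows "((\<lambda>b. cinner b v *\<^sub>C b) has_sum v) B"
  unfolding has_sum_def tendsto_iff eventually_finite_subsets_at_top
proof (intro allI impI)
  fix e :: real assume e: "e > 0"
  have on: "\<And>b b'. b \<in> B \<Longrightarrow> b' \<in> B \<Longrightarrow> cinner b b' = (if b = b' then 1 else 0)"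
    and "closure (complex_vector.span B) = UNIV"
    using B by (auto simp: is_onb_def)
  then obtain w where w: "w \<in> complex_vector.span B" "dist w v < e"
    using e closure_approachable[of v "complex_vector.span B"] by auto
  then obtain t r where t: "finite t" "t \<subseteq> B" "w = (\<Sum>b\<in>t. r b *\<^sub>C b)"
    unfolding complex_vector.span_explicit by blast
  have "dist (\<Sum>b\<in>S. cinner b v *\<^sub>C b) v < e" if S: "finite S" "S \<subseteq> B" "t \<subseteq> S" for S
  proof -
    define r' where "r' b = (if b \<in> t then r b else 0)" for b
    have w': "w = (\<Sum>b\<in>S. r' b *\<^sub>C b)"
      unfolding t(3) using S t by (intro sum.mono_neutral_cong_left) (auto simp: r'_def)
    \<comment> \<open>\<open>p\<close> is the point of the span of \<open>S\<close> closest to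
      \<open>v\<close>. The approximant \<open>w\<close> lies in that span because \<open>S\<close>
      contains \<open>t\<close>, so \<open>p\<close> is at least as close.\<close>
    define p where "p = (\<Sum>b\<in>S. cinner b v *\<^sub>C b)"
    have pb: "cinner b (v - p) = 0" if "b \<in> S" for b
    proof -
      have "cinner b p = (\<Sum>b'\<in>S. if b = b' then cinner b' v else 0)"
        unfolding p_def cinner.sum_right cinner_scaleC_right
      proof (intro sum.cong refl)
        fix b' assume "b' \<in> S"
        then show "cinner b' v * cinner b b' = (if b = b' then cinner b' v else 0)"
          using on[of b b'] subsetD[OF S(2)] that by auto
      qed
      then show ?thesis using that S by (simp add: cinner.diff_right)
    qed
    have "cinner (p - w) (v - p) = 0"
      unfolding p_def[abs_def] w' sum_subtractf[symmetric] complex_vector.scale_left_diff_distrib[symmetric] cinner.sum_left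
      by (intro sum.neutral ballI) (simp add: cinner_scaleC_left pb[unfolded p_def])
    then have "cinner (v - p) (p - w) = 0" using cinner_commute[of "v - p" "p - w"] by simp
    then have "(norm (v - w))\<^sup>2 = (norm (v - p))\<^sup>2 + (norm (p - w))\<^sup>2"
      using norm_add_square[of "v - p" "p - w"] by simp
    then have "norm (v - p) \<le> norm (v - w)" 
      using power2_le_imp_le[of "norm (v - p)" "norm (v - w)"] by simp
    then show ?thesis using w(2) by (simp add: dist_norm norm_minus_commute p_def)
  qed
  then show "\<exists>X. finite X \<and> X \<subseteq> B \<and> (\<forall>Y. finite Y \<and> X \<subseteq> Y \<and> Y \<subseteq> B \<longrightarrow> dist (\<Sum>b\<in>Y. cinner b v *\<^sub>C b) v < e)"
    using t by blast
qed

lemma parseval: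
  assumes "is_onb B"
  shows "((\<lambda>b. cnj (cinner b v) * cinner b w) has_sum cinner v w) B"
  using has_sum_bounded_linear[OF cinner.bounded_linear_right is_onb_has_sum[OF assms, of w], of v]
  by (simp add: o_def cinner_scaleC_right mult.commute cinner_commute[of v])

lemma parseval_norm:
  assumes "is_onb B"
  shows "((\<lambda>b. (cmod (cinner b v))\<^sup>2) has_sum (norm v)\<^sup>2) B"
proof -
  have "((\<lambda>b. Re (cnj (cinner b v) * cinner b v)) has_sum Re (cinner v v)) B"
    using has_sum_Re[OF parseval[OF assms]] .
  moreover have "Re (cnj z * z) = (cmod z)\<^sup>2" for z
    unfolding cmod_power2 by (simp add: power2_eq_square)
  ultimately show ?thesis by (simp add: Re_cinner_self)
qed

section \<open>Fock space and second quantization\<close>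

text \<open>Turns a sum over tensor indices into one over the first basis vector and the remaining
  list, so that Fubini and induction on the factors apply.\<close>

lemma has_sum_Cons:
  fixes h :: "'a list \<Rightarrow> 'b::{topological_comm_monoid_add,t2_space}"
  assumes "h [] = 0" "\<And>b bs. b \<notin> B \<Longrightarrow> h (b # bs) = 0"
  shows "(h has_sum s) UNIV \<longleftrightarrow> ((\<lambda>(b, bs). h (b # bs)) has_sum s) (B \<times> UNIV)"
proof -
  let ?c = "\<lambda>(b, bs). b # bs"
  have "(h has_sum s) UNIV \<longleftrightarrow> (h has_sum s) (?c ` (B \<times> UNIV))"
  proof (rule has_sum_cong_neutral)
    show "h x = 0" if x: "x \<in> UNIV - ?c ` (B \<times> UNIV)" for x
    proof (cases x)
      case (Cons b bs)
      then have "b \<notin> B" using x by force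
      then show ?thesis using assms Cons by simp
    qed (simp add: assms)
  qed auto
  also have "\<dots> \<longleftrightarrow> ((h \<circ> ?c) has_sum s) (B \<times> UNIV)"
    by (rule has_sum_reindex) (auto simp: inj_on_def)
  finally show ?thesis by (simp add: o_def case_prod_unfold)
qed

section \<open>Coordinates of simple tensors\<close>

lemma coord_add: "coord (x + y) i = coord x i + coord y i"
  by transfer simp

lemma coord_scaleC: "coord (a *\<^sub>C x) i = a * coord x i"
  by transfer simp

lemma coord_zero: "coord 0 i = 0"
  by transfer simp

lemma coord_sum: "coord (\<Sum>k\<in>S. g k) i = (\<Sum>k\<in>S. coord (g k) i)"
  by (induction S rule: infinite_finite_induct) (simp_all add: coord_add coord_zero)

lemma ell2_eqI: "(\<And>i. coord x i = coord y i) \<Longrightarrow> x = y"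
  by (intro coord_inject[THEN iffD1] ext)

lemma norm_ell2_has_sum: "((\<lambda>i. (cmod (coord x i))\<^sup>2) has_sum (norm x)\<^sup>2) UNIV"
  using has_sum_infsum[of "\<lambda>i. (cmod (coord x i))\<^sup>2" UNIV] coord[of x]
  by (simp add: norm_ell2.rep_eq infsum_nonneg)

lemma cinner_ell2_has_sum: "((\<lambda>i. cnj (coord x i) * coord y i) has_sum cinner x y) UNIV"
  unfolding cinner_ell2.rep_eq
  by (rule has_sum_infsum, rule ell2_inner_summable) (use coord in auto)

lemma cinner_ket: "cinner (ket i) x = coord x i"
proof -
  have "((\<lambda>j. cnj (coord (ket i) j) * coord x j) has_sum coord x i) {i}"
    by (rule has_sum_finiteI) (auto simp: ket.rep_eq)
  then have "((\<lambda>j. cnj (coord (ket i) j) * coord x j) has_sum coord x i) UNIV"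
    by (rule has_sum_cong_neutral[THEN iffD1, rotated -1]) (auto simp: ket.rep_eq)
  then show ?thesis using cinner_ell2_has_sum has_sum_unique by blast
qed

lemma ell2_ex:
  assumes "\<And>F. finite F \<Longrightarrow> (\<Sum>i\<in>F. (cmod (g i))\<^sup>2) \<le> C\<^sup>2" "0 \<le> C"
  shows "\<exists>x. coord x = g \<and> norm x \<le> C"
proof -
  have L: "L2_set (\<lambda>i. cmod (g i)) F \<le> C" if "finite F" for F
    unfolding L2_set_def using assms(1)[OF that] assms(2) by (simp add: real_le_lsqrt)
  then have "g \<in> {x. (\<lambda>i. (cmod (x i))\<^sup>2) summable_on UNIV}"
    using ell2_summable_iff by blast
  then have "coord (Abs_ell2 g) = g" by (rule Abs_ell2_inverse)
  then show ?thesis using ell2_sqrt_le[OF L] by (metis norm_ell2.rep_eq)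
qed

text \<open>The coordinates in \<open>simple_tensor_def\<close> in recursive form, suited to
  induction over the factors.\<close>

fun tensor_coord :: "'h::complex_hilbert list \<Rightarrow> 'h list \<Rightarrow> complex" where
  "tensor_coord [] bs = (if bs = [] then 1 else 0)"
| "tensor_coord (v # vs) [] = 0"
| "tensor_coord (v # vs) (b # bs) = (if b \<in> hbasis then cinner b v else 0) * tensor_coord vs bs"

lemma tensor_coord_eq: "tensor_coord vs bs = (if length bs = length vs \<and> set bs \<subseteq> hbasis
    then \<Prod>k<length vs. cinner (bs ! k) (vs ! k) else 0)"
  by (induction vs bs rule: tensor_coord.induct) (auto simp: prod.lessThan_Suc_shift simp del: prod.lessThan_Suc)

text \<open>Parseval in one leg at a time. The summability is what makes \<open>Abs_ell2\<close> in
  \<open>simple_tensor\<close> meaningful.\<close>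

lemma tensor_coord_has_sum:
  "((\<lambda>bs. (cmod (tensor_coord vs bs))\<^sup>2) has_sum (\<Prod>v\<leftarrow>vs. (norm v)\<^sup>2)) UNIV"
proof (induction vs)
  case Nil
  have "((\<lambda>bs. (cmod (tensor_coord [] bs))\<^sup>2) has_sum 1) {[]::'a list}"
    by (rule has_sum_finiteI) auto
  then have "((\<lambda>bs. (cmod (tensor_coord [] bs))\<^sup>2) has_sum 1) (UNIV :: 'a list set)"
    by (rule has_sum_cong_neutral[THEN iffD1, rotated -1]) auto
  then show ?case by simp
next
  case (Cons v vs)
  let ?f = "\<lambda>(b, bs). (cmod (cinner b v))\<^sup>2 * (cmod (tensor_coord vs bs))\<^sup>2"
  let ?P = "\<Prod>v\<leftarrow>vs. (norm v)\<^sup>2"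
  have 1: "((\<lambda>bs. ?f (b, bs)) has_sum (cmod (cinner b v))\<^sup>2 * ?P) UNIV" for b
    using has_sum_cmult_right[OF Cons.IH] by simp
  have 2: "((\<lambda>b. (cmod (cinner b v))\<^sup>2 * ?P) has_sum (norm v)\<^sup>2 * ?P) hbasis"
    by (rule has_sum_cmult_left) (rule parseval_norm[OF is_onb_hbasis])
  have "?f summable_on hbasis \<times> UNIV"
    by (rule summable_on_SigmaI[OF 1 has_sum_imp_summable[OF 2]]) auto
  then have "(?f has_sum (norm v)\<^sup>2 * ?P) (hbasis \<times> UNIV)"
    by (rule has_sum_SigmaI[OF 1 2])
  then have "((\<lambda>(b, bs). (cmod (tensor_coord (v # vs) (b # bs)))\<^sup>2) has_sum (norm v)\<^sup>2 * ?P) (hbasis \<times> UNIV)"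
    by (rule has_sum_cong[THEN iffD1, rotated]) (auto simp: norm_mult power_mult_distrib)
  then show ?case by (subst has_sum_Cons[where B = hbasis]) auto
qed

lemma coord_simple_tensor: "coord (simple_tensor vs) = tensor_coord vs"
proof -
  have "tensor_coord vs \<in> {x. (\<lambda>i. (cmod (x i))\<^sup>2) summable_on UNIV}"
    using tensor_coord_has_sum has_sum_imp_summable by blast
  then show ?thesis
    unfolding simple_tensor_def tensor_coord_eq[symmetric] by (rule Abs_ell2_inverse)
qed

lemma cinner_simple_tensor_Nil [simp]:
  fixes v :: "'a::complex_hilbert"
  shows "cinner (simple_tensor []) (simple_tensor [] :: 'a list ell2) = 1"
  "cinner (simple_tensor []) (simple_tensor (v # vs)) = (0::complex)"
  "cinner (simple_tensor (v # vs)) (simple_tensor []) = (0::complex)"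
proof -
  have k: "simple_tensor [] = ket ([]::'a list)"
    by (rule ell2_eqI) (auto simp: coord_simple_tensor ket.rep_eq)
  show "cinner (simple_tensor []) (simple_tensor [] :: 'a list ell2) = 1"
    unfolding k cinner_ket by (simp add: ket.rep_eq)
  show "cinner (simple_tensor []) (simple_tensor (v # vs)) = 0"
    unfolding k cinner_ket by (simp add: coord_simple_tensor)
  then show "cinner (simple_tensor (v # vs)) (simple_tensor []) = (0::complex)"
    using cinner_commute[of "simple_tensor (v # vs)"] by simp
qed

text \<open>Group the sum over basis lists by the head \<open>b\<close>: each group is a Parseval
  summand of \<open>v\<close> and \<open>w\<close> times the inner product of the tails.\<close>

lemma cinner_simple_tensor_Cons [simp]:
  "cinner (simple_tensor (v # vs)) (simple_tensor (w # ws)) =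
    cinner v w * cinner (simple_tensor vs) (simple_tensor ws)"
proof -
  let ?h = "\<lambda>bs. cnj (coord (simple_tensor (v # vs)) bs) * coord (simple_tensor (w # ws)) bs"
  have "(?h has_sum cinner (simple_tensor (v # vs)) (simple_tensor (w # ws))) UNIV"
    by (rule cinner_ell2_has_sum)
  then have "((\<lambda>(b, bs). ?h (b # bs)) has_sum cinner (simple_tensor (v # vs)) (simple_tensor (w # ws)))
      (hbasis \<times> UNIV)"
    by (subst (asm) has_sum_Cons[where B = hbasis]) (auto simp: coord_simple_tensor)
  then have "((\<lambda>b. cnj (cinner b v) * cinner b w * cinner (simple_tensor vs) (simple_tensor ws))
      has_sum cinner (simple_tensor (v # vs)) (simple_tensor (w # ws))) hbasis"
  proof (rule has_sum_SigmaD)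
    fix b :: 'a assume b: "b \<in> hbasis"
    show "((\<lambda>bs. case (b, bs) of (b, bs) \<Rightarrow> ?h (b # bs)) has_sum
        cnj (cinner b v) * cinner b w * cinner (simple_tensor vs) (simple_tensor ws)) UNIV"
      using has_sum_cmult_right[OF cinner_ell2_has_sum[of "simple_tensor vs" "simple_tensor ws"],
          of "cnj (cinner b v) * cinner b w"] b
      by (simp add: coord_simple_tensor mult_ac)
  qed
  moreover have "((\<lambda>b. cnj (cinner b v) * cinner b w * cinner (simple_tensor vs) (simple_tensor ws))
      has_sum cinner v w * cinner (simple_tensor vs) (simple_tensor ws)) hbasis"
    by (rule has_sum_cmult_left) (rule parseval[OF is_onb_hbasis])
  ultimately show ?thesis by (rule has_sum_unique)
qed

lemma cinner_simple_tensor_length: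
  "length vs \<noteq> length ws \<Longrightarrow> cinner (simple_tensor vs) (simple_tensor ws) = 0"
proof (induction vs arbitrary: ws)
  case Nil then show ?case by (cases ws) auto
next
  case (Cons v vs) then show ?case by (cases ws) auto
qed

lemma cinner_simple_tensor_map:
  assumes "length vs = length ws" "\<And>v w. v \<in> set vs \<Longrightarrow> w \<in> set ws \<Longrightarrow> cinner (x v) (y w) = cinner (x' v) (y' w)"
  shows "cinner (simple_tensor (map x vs)) (simple_tensor (map y ws)) =
    cinner (simple_tensor (map x' vs)) (simple_tensor (map y' ws))"
  using assms by (induction rule: list_induct2) auto

lemma cinner_simple_tensor_map_cong:
  assumes "\<And>v w. v \<in> set vs \<Longrightarrow> w \<in> set ws \<Longrightarrow> cinner (x v) (y w) = cinner (x' v) (y' w)"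
  shows "cinner (simple_tensor (map x vs)) (simple_tensor (map y ws)) =
    cinner (simple_tensor (map x' vs)) (simple_tensor (map y' ws))"
  using cinner_simple_tensor_map[of vs ws x y x' y'] assms
  by (cases "length vs = length ws") (auto simp: cinner_simple_tensor_length)

lemma simple_tensor_add:
  "simple_tensor (us @ (v + w) # vs) = simple_tensor (us @ v # vs) + simple_tensor (us @ w # vs)"
proof (rule ell2_eqI)
  have "tensor_coord (us @ (v + w) # vs) bs = tensor_coord (us @ v # vs) bs + tensor_coord (us @ w # vs) bs" for bs
  proof (induction us arbitrary: bs)
    case Nil then show ?case by (cases bs) (auto simp: cinner_add_right algebra_simps)
  next
    case (Cons u us) then show ?case by (cases bs) (auto simp: algebra_simps)
  qed
  then show "coord (simple_tensor (us @ (v + w) # vs)) bs =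
      coord (simple_tensor (us @ v # vs) + simple_tensor (us @ w # vs)) bs" for bs
    by (simp add: coord_add coord_simple_tensor)
qed

text \<open>The scalar may vary with the factor: \<open>fixed_in_fock\<close> scales the factors
  outside one subspace by \<open>z\<close> and the others by 1.\<close>

lemma simple_tensor_scale:
  "simple_tensor (map (\<lambda>v. c v *\<^sub>C v) vs) = (\<Prod>v\<leftarrow>vs. c v) *\<^sub>C simple_tensor vs"
proof (rule ell2_eqI)
  have "tensor_coord (map (\<lambda>v. c v *\<^sub>C v) vs) bs = (\<Prod>v\<leftarrow>vs. c v) * tensor_coord vs bs" for bs
    by (induction vs bs rule: tensor_coord.induct) (auto simp: cinner_scaleC_right)
  then show "coord (simple_tensor (map (\<lambda>v. c v *\<^sub>C v) vs)) bs =
      coord ((\<Prod>v\<leftarrow>vs. c v) *\<^sub>C simple_tensor vs) bs" for bs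
    by (simp add: coord_scaleC coord_simple_tensor)
qed

context
  fixes I :: "'i set" and c :: "'i \<Rightarrow> complex" and v :: "'i \<Rightarrow> 'h::complex_hilbert" and vs :: "'i \<Rightarrow> 'h list"
begin

text \<open>A common double sum for the next two lemmas, which differ in the order of
  summation.\<close>

lemma norm_leg_has_sum_aux:
  "((\<lambda>(b, bs). (cmod (\<Sum>i\<in>I. c i * cinner b (v i) * tensor_coord (vs i) bs))\<^sup>2)
    has_sum (norm (\<Sum>i\<in>I. c i *\<^sub>C simple_tensor (v i # vs i)))\<^sup>2) (hbasis \<times> UNIV)"
proof -
  let ?z = "\<Sum>i\<in>I. c i *\<^sub>C simple_tensor (v i # vs i)"
  have "((\<lambda>(b, bs). (cmod (coord ?z (b # bs)))\<^sup>2) has_sum (norm ?z)\<^sup>2) (hbasis \<times> UNIV)"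
    using norm_ell2_has_sum[of ?z]
    by (subst (asm) has_sum_Cons[where B = hbasis]) (auto simp: coord_sum coord_scaleC coord_simple_tensor)
  then show ?thesis
    by (rule has_sum_cong[THEN iffD1, rotated])
      (auto simp: coord_sum coord_scaleC coord_simple_tensor mult.assoc)
qed

text \<open>For fixed \<open>bs\<close> the summand is the squared norm of one vector of
  \<open>'h\<close>, to which a contraction of the first leg can be applied.\<close>

lemma norm_first_leg_has_sum:
  "((\<lambda>bs. (norm (\<Sum>i\<in>I. (c i * tensor_coord (vs i) bs) *\<^sub>C v i))\<^sup>2)
    has_sum (norm (\<Sum>i\<in>I. c i *\<^sub>C simple_tensor (v i # vs i)))\<^sup>2) UNIV"
proof (rule has_sum_SigmaD)
  show "((\<lambda>(bs, b). (cmod (\<Sum>i\<in>I. c i * cinner b (v i) * tensor_coord (vs i) bs))\<^sup>2)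
    has_sum (norm (\<Sum>i\<in>I. c i *\<^sub>C simple_tensor (v i # vs i)))\<^sup>2) (UNIV \<times> hbasis)"
    using norm_leg_has_sum_aux by (subst has_sum_swap) (simp add: case_prod_unfold)
  fix bs
  show "((\<lambda>b. case (bs, b) of (bs, b) \<Rightarrow> (cmod (\<Sum>i\<in>I. c i * cinner b (v i) * tensor_coord (vs i) bs))\<^sup>2)
      has_sum (norm (\<Sum>i\<in>I. (c i * tensor_coord (vs i) bs) *\<^sub>C v i))\<^sup>2) hbasis"
    using parseval_norm[OF is_onb_hbasis, of "\<Sum>i\<in>I. (c i * tensor_coord (vs i) bs) *\<^sub>C v i"]
    by (simp add: cinner.sum_right cinner_scaleC_right mult_ac)
qed

text \<open>For fixed \<open>b\<close> the summand involves shorter tensors only, which is the form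
  in which an induction hypothesis on the length can be used.\<close>

lemma norm_other_legs_has_sum:
  "((\<lambda>b. (norm (\<Sum>i\<in>I. (c i * cinner b (v i)) *\<^sub>C simple_tensor (vs i)))\<^sup>2)
    has_sum (norm (\<Sum>i\<in>I. c i *\<^sub>C simple_tensor (v i # vs i)))\<^sup>2) hbasis"
proof (rule has_sum_SigmaD[OF norm_leg_has_sum_aux])
  fix b
  show "((\<lambda>bs. case (b, bs) of (b, bs) \<Rightarrow> (cmod (\<Sum>i\<in>I. c i * cinner b (v i) * tensor_coord (vs i) bs))\<^sup>2)
      has_sum (norm (\<Sum>i\<in>I. (c i * cinner b (v i)) *\<^sub>C simple_tensor (vs i)))\<^sup>2) UNIV"
    using norm_ell2_has_sum[of "\<Sum>i\<in>I. (c i * cinner b (v i)) *\<^sub>C simple_tensor (vs i)"]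
    by (simp add: coord_sum coord_scaleC coord_simple_tensor)
qed

end

definition contractive :: "('h::complex_hilbert \<Rightarrow> 'h) \<Rightarrow> bool"
  where "contractive x \<longleftrightarrow> bounded_clinear x \<and> (\<forall>v. norm (x v) \<le> norm v)"

text \<open>Remove \<open>x\<close> from the first leg and then, by induction, from the others;
  neither step decreases the norm. A family is used instead of a set of lists because distinct lists
  may have equal tails.\<close>

lemma norm_tensor_contraction_aux:
  fixes vs :: "'i \<Rightarrow> 'h::complex_hilbert list"
  assumes x: "contractive x" and "finite I" "\<And>i. i \<in> I \<Longrightarrow> length (vs i) \<le> n"
  shows "norm (\<Sum>i\<in>I. c i *\<^sub>C simple_tensor (map x (vs i))) \<le> norm (\<Sum>i\<in>I. c i *\<^sub>C simple_tensor (vs i))"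
  using assms(2,3)
proof (induction n arbitrary: I c vs)
  case 0
  then have "vs i = []" if "i \<in> I" for i using that by auto
  then have "(\<Sum>i\<in>I. c i *\<^sub>C simple_tensor (map x (vs i))) = (\<Sum>i\<in>I. c i *\<^sub>C simple_tensor (vs i))"
    by (intro sum.cong) auto
  then show ?case by simp
next
  case (Suc n)
  define I0 I1 where "I0 = {i\<in>I. vs i = []}" and "I1 = {i\<in>I. vs i \<noteq> []}"
  define v us where "v i = hd (vs i)" and "us i = tl (vs i)" for i
  have I: "I = I0 \<union> I1" "I0 \<inter> I1 = {}" "finite I0" "finite I1"
    using Suc.prems(1) by (auto simp: I0_def I1_def)
  have vs: "vs i = v i # us i" if "i \<in> I1" for i using that by (simp add: I1_def v_def us_def)
  have len: "length (us i) \<le> n" if "i \<in> I1" for i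
    using Suc.prems(2)[of i] that by (auto simp: I1_def us_def)
  \<comment> \<open>The empty tensor is orthogonal to all tensors with a leg and is unaffected by
    \<open>y\<close>, so the vacuum part splits off with a fixed norm.\<close>
  have split: "(norm (\<Sum>i\<in>I. c i *\<^sub>C simple_tensor (map y (vs i))))\<^sup>2 =
      (norm (\<Sum>i\<in>I0. c i *\<^sub>C (simple_tensor [] :: 'h list ell2)))\<^sup>2
      + (norm (\<Sum>i\<in>I1. c i *\<^sub>C simple_tensor (y (v i) # map y (us i))))\<^sup>2" for y :: "'h \<Rightarrow> 'h"
  proof -
    have "(\<Sum>i\<in>I. c i *\<^sub>C simple_tensor (map y (vs i))) = (\<Sum>i\<in>I0. c i *\<^sub>C simple_tensor [])
        + (\<Sum>i\<in>I1. c i *\<^sub>C simple_tensor (y (v i) # map y (us i)))"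
      unfolding I(1) sum.union_disjoint[OF I(3,4,2)]
      by (intro arg_cong2[of _ _ _ _ "(+)"] sum.cong refl) (auto simp: I0_def vs)
    then show ?thesis
      by (simp add: norm_add_square cinner.sum_left cinner_scaleC_left)
        (simp add: cinner.sum_right cinner_scaleC_right)
  qed
  have "(norm (\<Sum>i\<in>I1. c i *\<^sub>C simple_tensor (x (v i) # map x (us i))))\<^sup>2
      \<le> (norm (\<Sum>i\<in>I1. c i *\<^sub>C simple_tensor (v i # map x (us i))))\<^sup>2"
  proof (rule has_sum_mono[OF norm_first_leg_has_sum norm_first_leg_has_sum])
    fix bs
    have "(\<Sum>i\<in>I1. (c i * tensor_coord (map x (us i)) bs) *\<^sub>C x (v i)) =
        x (\<Sum>i\<in>I1. (c i * tensor_coord (map x (us i)) bs) *\<^sub>C v i)"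
      using x by (simp add: contractive_def bounded_clinear_sum bounded_clinear_scaleC)
    then show "(norm (\<Sum>i\<in>I1. (c i * tensor_coord (map x (us i)) bs) *\<^sub>C x (v i)))\<^sup>2
        \<le> (norm (\<Sum>i\<in>I1. (c i * tensor_coord (map x (us i)) bs) *\<^sub>C v i))\<^sup>2"
      using x by (simp add: contractive_def)
  qed
  also have "\<dots> \<le> (norm (\<Sum>i\<in>I1. c i *\<^sub>C simple_tensor (v i # us i)))\<^sup>2"
    by (rule has_sum_mono[OF norm_other_legs_has_sum norm_other_legs_has_sum])
      (intro power_mono Suc.IH I len norm_ge_zero)
  finally have "(norm (\<Sum>i\<in>I. c i *\<^sub>C simple_tensor (map x (vs i))))\<^sup>2 \<le>
      (norm (\<Sum>i\<in>I. c i *\<^sub>C simple_tensor (map (\<lambda>v. v) (vs i))))\<^sup>2"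
    unfolding split by simp
  then show ?case by (simp add: abs_le_square_iff[symmetric])
qed

lemma norm_tensor_contraction:
  assumes "contractive x"
  shows "norm (\<Sum>vs\<in>F. c vs *\<^sub>C simple_tensor (map x vs)) \<le> norm (\<Sum>vs\<in>F. c vs *\<^sub>C simple_tensor vs)"
proof (cases "finite F")
  case True
  then show ?thesis
    by (intro norm_tensor_contraction_aux[OF assms, where vs = "\<lambda>vs. vs" and n = "Max (length ` F)"]) auto
qed simp

lemma simple_tensor_hbasis: "set bs \<subseteq> hbasis \<Longrightarrow> simple_tensor bs = ket bs"
proof (rule ell2_eqI)
  have on: "\<And>b b'. b \<in> hbasis \<Longrightarrow> b' \<in> hbasis \<Longrightarrow> cinner b b' = (if b = b' then 1 else 0)"
    using is_onb_hbasis by (auto simp: is_onb_def)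
  assume "set bs \<subseteq> hbasis"
  then have "tensor_coord bs cs = (if cs = bs then 1 else 0)" for cs
  proof (induction bs arbitrary: cs)
    case (Cons b bs) then show ?case by (cases cs) (auto simp: on)
  qed auto
  then show "coord (simple_tensor bs) cs = coord (ket bs) cs" for cs
    by (simp add: coord_simple_tensor ket.rep_eq)
qed

lemma cinner_ket_ket: "cinner (ket i) (ket j) = (if i = j then 1 else 0)"
  by (simp add: cinner_ket ket.rep_eq)

lemma norm_sum_ket_square:
  "finite F \<Longrightarrow> (norm (\<Sum>i\<in>F. c i *\<^sub>C ket i))\<^sup>2 = (\<Sum>i\<in>F. (cmod (c i))\<^sup>2)"
proof -
  assume F: "finite F"
  have "complex_of_real ((norm (\<Sum>i\<in>F. c i *\<^sub>C ket i))\<^sup>2) = (\<Sum>i\<in>F. \<Sum>j\<in>F. if i = j then c j * cnj (c i) else 0)"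
    unfolding cinner_self[symmetric] cinner.sum_left unfolding cinner.sum_right
    by (intro sum.cong refl) (simp add: cinner_scaleC_left cinner_scaleC_right cinner_ket_ket)
  also have "\<dots> = complex_of_real (\<Sum>i\<in>F. (cmod (c i))\<^sup>2)"
    using F by (simp add: complex_norm_square del: of_real_power)
  finally show ?thesis using of_real_eq_iff by blast
qed

section \<open>Fock spaces of subspaces and second quantization\<close>

definition fock :: "'h::complex_hilbert set \<Rightarrow> 'h list ell2 set"
  where "fock K = closure (complex_vector.span (simple_tensor ` {vs. set vs \<subseteq> K}))"

interpretation fock: closed_complex_subspace "fock K"
  unfolding fock_def by (rule closed_complex_subspace_closure_span)

interpretation tensor_power: closed_complex_subspace "tensor_power K n"
  unfolding tensor_power_def by (rule closed_complex_subspace_closure_span)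

lemma subset_closure_span: "S \<subseteq> closure (complex_vector.span S)"
  using complex_vector.span_superset closure_subset by blast

lemma simple_tensor_in_fock: "set vs \<subseteq> K \<Longrightarrow> simple_tensor vs \<in> fock K"
  unfolding fock_def by (rule subsetD[OF subset_closure_span]) auto

lemma simple_tensor_in_tensor_power: "length vs = n \<Longrightarrow> set vs \<subseteq> K \<Longrightarrow> simple_tensor vs \<in> tensor_power K n"
  unfolding tensor_power_def by (rule subsetD[OF subset_closure_span]) auto

lemma tensor_power_subset_fock: "tensor_power K n \<subseteq> fock K"
  unfolding fock_def tensor_power_def by (intro closure_mono complex_vector.span_mono) auto

lemma fock_mono: "K \<subseteq> L \<Longrightarrow> fock K \<subseteq> fock L"
  unfolding fock_def by (intro closure_mono complex_vector.span_mono) auto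

lemma tensor_power_mono: "K \<subseteq> L \<Longrightarrow> tensor_power K n \<subseteq> tensor_power L n"
  unfolding tensor_power_def by (intro closure_mono complex_vector.span_mono) auto

lemma bounded_clinear_closure_span_in:
  assumes T: "bounded_clinear T" and S: "complex_vector.subspace S" "closed S"
    and X: "\<And>x. x \<in> X \<Longrightarrow> T x \<in> S" and w: "w \<in> closure (complex_vector.span X)"
  shows "T w \<in> S"
proof -
  have 1: "T v \<in> S" if "v \<in> complex_vector.span X" for v
    using that
  proof (induction rule: complex_vector.span_induct_alt)
    case base then show ?case using complex_vector.subspace_0[OF S(1)] by (simp add: bounded_clinear_zero[OF T])
  next
    case (step c x y)
    then show ?case
      by (simp add: bounded_clinear_add[OF T] bounded_clinear_scaleC[OF T] X
          complex_vector.subspace_add[OF S(1)] complex_vector.subspace_scale[OF S(1)])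
  qed
  have "T ` closure (complex_vector.span X) \<subseteq> S"
    by (rule image_closure_subset[OF bounded_clinear_continuous_on[OF T] S(2)]) (use 1 in blast)
  then show ?thesis using w by blast
qed

lemma bounded_clinear_eq_closure_span:
  assumes "bounded_clinear T" "bounded_clinear T'" "\<And>x. x \<in> X \<Longrightarrow> T x = T' x"
    and "w \<in> closure (complex_vector.span X)"
  shows "T w = T' w"
  using bounded_clinear_closure_span_in[OF bounded_clinear_minus[OF assms(1,2)], of "{0}" X w] assms(3,4)
  by (simp add: complex_vector.subspace_single_0)

text \<open>The second quantization of a contraction, with coordinates
  \<open>\<langle>b\<^sub>1 \<otimes> \<dots> \<otimes> b\<^sub>n, \<Gamma>(x) w\<rangle> = \<langle>x\<^sup>* b\<^sub>1 \<otimes> \<dots> \<otimes> x\<^sup>* b\<^sub>n, w\<rangle>\<close>.\<close>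

lemma fock_op_exists:
  fixes x :: "'h::complex_hilbert \<Rightarrow> 'h"
  assumes x: "contractive x"
  shows "\<exists>T. bounded_clinear T \<and> (\<forall>w. norm (T w) \<le> norm w) \<and>
    (\<forall>vs. T (simple_tensor vs) = simple_tensor (map x vs)) \<and> (\<forall>w\<in>orthocomp (fock UNIV). T w = 0)"
proof -
  obtain x' where x': "bounded_clinear x'" "\<And>v w. cinner (x' v) w = cinner v (x w)" "\<And>v. norm (x' v) \<le> norm v"
    using ex_adjoint[of x 1] x by (auto simp: contractive_def)
  then have x'c: "contractive x'" by (simp add: contractive_def)
  define g where "g w bs = (if set bs \<subseteq> hbasis then cinner (simple_tensor (map x' bs)) w else 0)"
    for w and bs :: "'h list"
  have bound: "(\<Sum>bs\<in>F. (cmod (g w bs))\<^sup>2) \<le> (norm w)\<^sup>2" if F: "finite F" for w F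
  proof -
    define F' where "F' = {bs\<in>F. set bs \<subseteq> hbasis}"
    have F': "finite F'" using F by (simp add: F'_def)
    define q where "q = (\<Sum>bs\<in>F'. (cmod (g w bs))\<^sup>2)"
    have q: "(\<Sum>bs\<in>F. (cmod (g w bs))\<^sup>2) = q"
      unfolding q_def using F by (intro sum.mono_neutral_right) (auto simp: F'_def g_def)
    have q0: "0 \<le> q" by (simp add: q_def sum_nonneg)
    \<comment> \<open>Pairing \<open>z\<close> with \<open>w\<close> reproduces the partial sum
      \<open>q\<close>. Since \<open>x'\<close> is a contraction, \<open>norm z\<close> is at most
      \<open>sqrt q\<close>, so \<open>q \<le> sqrt q * norm w\<close>.\<close>
    define z where "z = (\<Sum>bs\<in>F'. g w bs *\<^sub>C simple_tensor (map x' bs))"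
    have "cinner z w = (\<Sum>bs\<in>F'. cnj (g w bs) * g w bs)"
      unfolding z_def cinner.sum_left by (intro sum.cong refl) (auto simp: cinner_scaleC_left g_def F'_def)
    also have "\<dots> = complex_of_real q"
      by (simp add: q_def complex_norm_square mult.commute del: of_real_power)
    finally have "q \<le> norm z * norm w"
      using cinner_Cauchy_Schwarz[of z w] q0 by simp
    also have "norm z \<le> norm (\<Sum>bs\<in>F'. g w bs *\<^sub>C simple_tensor bs)"
      unfolding z_def by (rule norm_tensor_contraction[OF x'c])
    also have "(\<Sum>bs\<in>F'. g w bs *\<^sub>C simple_tensor bs) = (\<Sum>bs\<in>F'. g w bs *\<^sub>C ket bs)"
      by (intro sum.cong refl) (auto simp: F'_def simple_tensor_hbasis)
    finally have "q \<le> norm (\<Sum>bs\<in>F'. g w bs *\<^sub>C ket bs) * norm w" by (simp add: mult_right_mono)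
    moreover have "norm (\<Sum>bs\<in>F'. g w bs *\<^sub>C ket bs) = sqrt q"
      using norm_sum_ket_square[OF F', of "g w"] by (metis q_def norm_ge_zero real_sqrt_unique)
    ultimately have "sqrt q * sqrt q \<le> sqrt q * norm w" using q0 by simp
    then have "sqrt q \<le> norm w"
      using q0 mult_le_cancel_left_pos[of "sqrt q" "sqrt q" "norm w"] by (cases "q = 0") (auto simp del: real_sqrt_mult_self)
    then show ?thesis unfolding q using q0 by (simp add: real_sqrt_le_iff sqrt_le_D)
  qed
  have "\<exists>y. coord y = g w \<and> norm y \<le> norm w" for w
    by (rule ell2_ex) (use bound in auto)
  then obtain T where T: "\<And>w. coord (T w) = g w" "\<And>w. norm (T w) \<le> norm w" by metis
  have "bounded_clinear T"
  proof (rule bounded_clinearI[where C = 1])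
    show "T (v + w) = T v + T w" for v w
      by (rule ell2_eqI) (simp add: T(1) coord_add g_def cinner_add_right)
    show "T (a *\<^sub>C w) = a *\<^sub>C T w" for a w
      by (rule ell2_eqI) (simp add: T(1) coord_scaleC g_def cinner_scaleC_right)
  qed (simp add: T(2))
  moreover have "T (simple_tensor vs) = simple_tensor (map x vs)" for vs
  proof (rule ell2_eqI)
    fix bs
    show "coord (T (simple_tensor vs)) bs = coord (simple_tensor (map x vs)) bs"
    proof (cases "set bs \<subseteq> hbasis")
      case True
      have "cinner (simple_tensor (map x' bs)) (simple_tensor (map id vs)) =
          cinner (simple_tensor (map id bs)) (simple_tensor (map x vs))"
        by (rule cinner_simple_tensor_map_cong) (simp add: x'(2))
      then show ?thesis using True
        by (simp add: T g_def cinner_ket[symmetric] simple_tensor_hbasis)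
    next
      case False
      then show ?thesis by (simp add: T g_def coord_simple_tensor tensor_coord_eq)
    qed
  qed
  moreover have "T w = 0" if "w \<in> orthocomp (fock UNIV)" for w
  proof (rule ell2_eqI)
    show "coord (T w) bs = coord 0 bs" for bs
      using orthocompD[OF that simple_tensor_in_fock] by (simp add: T g_def coord_zero)
  qed
  ultimately show ?thesis using T(2) by blast
qed

text \<open>The type \<open>'h list ell2\<close> also has coordinates at lists with entries outside
  \<open>hbasis\<close>, so Fock space is a proper subspace of it. The operator is 0 on the
  complement, in accordance with \<open>tensor_op\<close>.\<close>

definition fock_op :: "('h::complex_hilbert \<Rightarrow> 'h) \<Rightarrow> 'h list ell2 \<Rightarrow> 'h list ell2"
  where "fock_op x = (SOME T. bounded_clinear T \<and> (\<forall>w. norm (T w) \<le> norm w) \<and>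
    (\<forall>vs. T (simple_tensor vs) = simple_tensor (map x vs)) \<and> (\<forall>w\<in>orthocomp (fock UNIV). T w = 0))"

lemma fock_op:
  assumes "contractive x"
  shows bounded_clinear_fock_op: "bounded_clinear (fock_op x)"
    and norm_fock_op: "norm (fock_op x w) \<le> norm w"
    and fock_op_simple_tensor: "fock_op x (simple_tensor vs) = simple_tensor (map x vs)"
    and fock_op_orthocomp: "w \<in> orthocomp (fock UNIV) \<Longrightarrow> fock_op x w = 0"
  using someI_ex[OF fock_op_exists[OF assms]] unfolding fock_op_def[symmetric] by blast+

lemma fock_op_in_fock:
  assumes x: "contractive x" and K: "\<And>v. v \<in> K \<Longrightarrow> x v \<in> L" and w: "w \<in> fock K"
  shows "fock_op x w \<in> fock L"
proof (rule bounded_clinear_closure_span_in[OF bounded_clinear_fock_op[OF x]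
        fock.subspace fock.closed _ w[unfolded fock_def]])
  fix s assume "s \<in> simple_tensor ` {vs. set vs \<subseteq> K}"
  then obtain vs where vs: "s = simple_tensor vs" "set vs \<subseteq> K" by blast
  then have "set (map x vs) \<subseteq> L" using K by auto
  then show "fock_op x s \<in> fock L"
    unfolding vs(1) fock_op_simple_tensor[OF x] by (rule simple_tensor_in_fock)
qed

lemma fock_op_proj: "contractive x \<Longrightarrow> fock_op x w = fock_op x (orth_proj (fock UNIV) w)"
  using fock_op_orthocomp[OF _ fock.proj_orth, of x w]
  by (simp add: bounded_clinear_diff[OF bounded_clinear_fock_op])

lemma fock_op_in_fock_UNIV: "contractive x \<Longrightarrow> fock_op x w \<in> fock UNIV"
  by (subst fock_op_proj, assumption, rule fock_op_in_fock[where K = UNIV]) (auto intro: fock.proj_in)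

lemma fock_op_eq:
  assumes "contractive x" "bounded_clinear T" "w \<in> fock K"
    "\<And>vs. set vs \<subseteq> K \<Longrightarrow> T (simple_tensor vs) = simple_tensor (map x vs)"
  shows "T w = fock_op x w"
  by (rule bounded_clinear_eq_closure_span[OF assms(2) bounded_clinear_fock_op[OF assms(1)] _
        assms(3)[unfolded fock_def]])
    (use assms in \<open>auto simp: fock_op_simple_tensor\<close>)

lemma contractive_comp: "contractive x \<Longrightarrow> contractive y \<Longrightarrow> contractive (x \<circ> y)"
  by (auto simp: contractive_def bounded_clinear_comp intro: order_trans)

lemma contractive_id: "contractive id"
  by (simp add: contractive_def bounded_clinear_id)

lemma fock_op_comp:
  assumes "contractive x" "contractive y"
  shows "fock_op (x \<circ> y) w = fock_op x (fock_op y w)"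
proof -
  have "(fock_op x \<circ> fock_op y) (orth_proj (fock UNIV) w) = fock_op (x \<circ> y) (orth_proj (fock UNIV) w)"
    using assms
    by (intro fock_op_eq[where K = UNIV] contractive_comp bounded_clinear_comp bounded_clinear_fock_op fock.proj_in)
      (simp_all add: fock_op_simple_tensor comp_def)
  then show ?thesis using fock_op_proj[OF contractive_comp[OF assms], of w] fock_op_proj[OF assms(2), of w] by simp
qed

lemma fock_op_id: "w \<in> fock UNIV \<Longrightarrow> fock_op id w = w"
  using fock_op_eq[OF contractive_id bounded_clinear_id, of w UNIV] by simp

text \<open>On simple tensors the coefficients are products of the given ones. They are extended to
  the closed spans one argument at a time: the adjoints \<open>X\<close>, \<open>Y\<close> turn each
  extension into the orthogonality of a fixed vector to a Fock space.\<close>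

lemma cinner_fock_op_cong:
  assumes x: "contractive x" "contractive y" "contractive x'" "contractive y'"
    and eq: "\<And>v w. v \<in> K \<Longrightarrow> w \<in> L \<Longrightarrow> cinner (x v) (y w) = cinner (x' v) (y' w)"
    and a: "a \<in> fock K" and b: "b \<in> fock L"
  shows "cinner (fock_op x a) (fock_op y b) = cinner (fock_op x' a) (fock_op y' b)"
proof -
  obtain X X' where X: "bounded_clinear X" "\<And>v w. cinner (X v) w = cinner v (fock_op x w)"
    and X': "bounded_clinear X'" "\<And>v w. cinner (X' v) w = cinner v (fock_op x' w)"
    using ex_adjoint[OF bounded_clinear_fock_op, of _ 1] norm_fock_op x by (metis mult_1 zero_le_one)
  obtain Y Y' where Y: "bounded_clinear Y" "\<And>v w. cinner (Y v) w = cinner v (fock_op y w)"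
    and Y': "bounded_clinear Y'" "\<And>v w. cinner (Y' v) w = cinner v (fock_op y' w)"
    using ex_adjoint[OF bounded_clinear_fock_op, of _ 1] norm_fock_op x by (metis mult_1 zero_le_one)
  have 1: "cinner (X (fock_op y b)) u = cinner (X' (fock_op y' b)) u" if "u = simple_tensor vs" "set vs \<subseteq> K" for u vs
  proof -
    have "cinner s (Y (fock_op x u)) = cinner s (Y' (fock_op x' u))" if "s \<in> simple_tensor ` {ws. set ws \<subseteq> L}" for s
    proof -
      obtain ws where ws: "s = simple_tensor ws" "set ws \<subseteq> L" using \<open>s \<in> _\<close> by blast
      have "cinner (simple_tensor (map x vs)) (simple_tensor (map y ws)) =
          cinner (simple_tensor (map x' vs)) (simple_tensor (map y' ws))"
        by (rule cinner_simple_tensor_map_cong) (use eq \<open>set vs \<subseteq> K\<close> ws in blast)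
      then have "cinner (Y (fock_op x u)) s = cinner (Y' (fock_op x' u)) s"
        by (simp add: Y Y' \<open>u = _\<close> ws x fock_op_simple_tensor)
      then show ?thesis by (metis cinner_commute)
    qed
    then have "Y (fock_op x u) - Y' (fock_op x' u) \<in> orthocomp (fock L)"
      unfolding fock_def orthocomp_closure_span by (simp add: orthocomp_def cinner.diff_right)
    then have "cinner b (Y (fock_op x u)) = cinner b (Y' (fock_op x' u))"
      using orthocompD[OF _ b, of "Y (fock_op x u) - Y' (fock_op x' u)"] by (simp add: cinner.diff_right)
    then have "cinner (fock_op x u) (fock_op y b) = cinner (fock_op x' u) (fock_op y' b)"
      by (metis Y(2) Y'(2) cinner_commute)
    then show ?thesis by (metis X(2) X'(2) cinner_commute)
  qed
  then have "X (fock_op y b) - X' (fock_op y' b) \<in> orthocomp (fock K)"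
    unfolding fock_def orthocomp_closure_span by (auto simp: orthocomp_def cinner.diff_right) (metis cinner_commute)
  then have "cinner a (X (fock_op y b)) = cinner a (X' (fock_op y' b))"
    using orthocompD[OF _ a, of "X (fock_op y b) - X' (fock_op y' b)"] by (simp add: cinner.diff_right)
  then show ?thesis by (metis X(2) X'(2) cinner_commute)
qed

text \<open>The degree \<open>n\<close> part of second quantization meets the definite description,
  and totality of the simple tensors gives uniqueness.\<close>

lemma tensor_op_eq:
  fixes x :: "'a::complex_hilbert \<Rightarrow> 'a"
  assumes x: "contractive x"
  shows "tensor_op n x = fock_op x \<circ> orth_proj (tensor_power UNIV n)"
  unfolding tensor_op_def
proof (rule the_equality)
  let ?T = "fock_op x \<circ> orth_proj (tensor_power UNIV n)"
  have "?T (simple_tensor vs) = simple_tensor (map x vs)" if "length vs = n" for vs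
    using that by (simp add: tensor_power.proj_fix simple_tensor_in_tensor_power fock_op_simple_tensor[OF x])
  moreover have "?T w = 0" if "w \<in> orthocomp (tensor_power UNIV n)" for w
    using that by (simp add: tensor_power.proj_zero bounded_clinear_zero[OF bounded_clinear_fock_op[OF x]])
  ultimately show *: "bounded_clinear ?T \<and> (\<forall>vs. length vs = n \<longrightarrow> ?T (simple_tensor vs) = simple_tensor (map x vs)) \<and>
      (\<forall>w\<in>orthocomp (tensor_power UNIV n). ?T w = 0)"
    using bounded_clinear_comp[OF bounded_clinear_fock_op[OF x] tensor_power.bounded_clinear_proj] by blast
  fix T :: "'a list ell2 \<Rightarrow> 'a list ell2" assume T: "bounded_clinear T \<and> (\<forall>vs. length vs = n \<longrightarrow> T (simple_tensor vs) = simple_tensor (map x vs)) \<and>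
      (\<forall>w\<in>orthocomp (tensor_power UNIV n). T w = 0)"
  have agree: "T v = ?T v" if v: "v \<in> tensor_power UNIV n" for v
  proof (rule bounded_clinear_eq_closure_span[OF _ _ _ v[unfolded tensor_power_def]])
    show "bounded_clinear T" "bounded_clinear ?T" using T * by blast+
    fix s assume "s \<in> simple_tensor ` {vs. length vs = n \<and> set vs \<subseteq> (UNIV :: 'a set)}"
    then obtain vs where "s = simple_tensor vs" "length vs = n" by blast
    then show "T s = ?T s" using T * by simp
  qed
  show "T = ?T"
  proof
    fix w :: "'a list ell2"
    let ?p = "orth_proj (tensor_power UNIV n) w"
    have "T ?p = ?T ?p" by (rule agree) (rule tensor_power.proj_in)
    moreover have "T (w - ?p) = 0" "?T (w - ?p) = 0"
      using T * tensor_power.proj_orth by blast+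
    ultimately show "T w = ?T w"
      using T * bounded_clinear_diff[of T w ?p] bounded_clinear_diff[of ?T w ?p] by simp
  qed
qed

lemma tensor_op_tensor_power:
  "contractive x \<Longrightarrow> w \<in> tensor_power K n \<Longrightarrow> tensor_op n x w = fock_op x w"
  using tensor_power.proj_fix[OF subsetD[OF tensor_power_mono[of K UNIV n]], of w] by (simp add: tensor_op_eq)

lemma bounded_clinear_tensor_op: "contractive x \<Longrightarrow> bounded_clinear (tensor_op n x)"
  by (simp add: tensor_op_eq bounded_clinear_comp bounded_clinear_fock_op tensor_power.bounded_clinear_proj)

section \<open>Density operators\<close>

text \<open>Positivity of a 2 by 2 form, stated for bare coefficients so as to serve both for
  positive operators and for positive definite functions. Hermiticity comes from
  \<open>z = 1\<close> and \<open>z = \<i>\<close>, the inequality from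
  \<open>z = - t * cnj \<beta>\<close>.\<close>

lemma psd_quadratic:
  fixes \<alpha> \<beta> \<gamma> \<delta> :: complex
  assumes q: "\<And>z. \<alpha> + z * \<beta> + cnj z * \<gamma> + z * cnj z * \<delta> \<in> \<real>\<^sub>\<ge>\<^sub>0" and d: "\<delta> \<in> \<real>\<^sub>\<ge>\<^sub>0"
  shows "\<gamma> = cnj \<beta>" "(cmod \<beta>)\<^sup>2 \<le> Re \<alpha> * Re \<delta>"
proof -
  have a: "Re \<alpha> \<ge> 0" "Im \<alpha> = 0" using q[of 0] by (auto simp: complex_nonneg_Reals_iff)
  have d': "Re \<delta> \<ge> 0" "Im \<delta> = 0" using d by (auto simp: complex_nonneg_Reals_iff)
  show g: "\<gamma> = cnj \<beta>"
    using q[of 1] q[of \<i>] a d' by (simp add: complex_nonneg_Reals_iff complex_eq_iff)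
  have pos: "0 \<le> Re \<alpha> - 2 * t * (cmod \<beta>)\<^sup>2 + t\<^sup>2 * (cmod \<beta>)\<^sup>2 * Re \<delta>" for t
    using q[of "- complex_of_real t * cnj \<beta>"] d' unfolding g cmod_power2
    by (simp add: complex_nonneg_Reals_iff power2_eq_square algebra_simps)
  show "(cmod \<beta>)\<^sup>2 \<le> Re \<alpha> * Re \<delta>"
  proof (cases "Re \<delta> = 0")
    case False
    then have "0 \<le> Re \<alpha> - (cmod \<beta>)\<^sup>2 / Re \<delta>"
      using pos[of "1 / Re \<delta>"] by (simp add: power2_eq_square)
    then show ?thesis using False d' by (simp add: field_simps)
  next
    case True
    have "cmod \<beta> = 0"
    proof (rule ccontr)
      assume b: "cmod \<beta> \<noteq> 0"
      \<comment> \<open>Without the quadratic term the bound is affine in \<open>t\<close>; this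
        \<open>t\<close> makes it \<open>- Re \<alpha> - 2\<close>, which is negative.\<close>
      have "0 \<le> Re \<alpha> - 2 * ((Re \<alpha> + 1) / (cmod \<beta>)\<^sup>2) * (cmod \<beta>)\<^sup>2"
        using pos[of "(Re \<alpha> + 1) / (cmod \<beta>)\<^sup>2"] True by simp
      then show False using a b by simp
    qed
    then show ?thesis using True by simp
  qed
qed

section \<open>Positive operators and Cholesky elimination\<close>

definition positive_op :: "('a::complex_hilbert \<Rightarrow> 'a) \<Rightarrow> bool"
  where "positive_op A \<longleftrightarrow> bounded_clinear A \<and> (\<forall>w. cinner w (A w) \<in> \<real>\<^sub>\<ge>\<^sub>0)"

lemma positive_op_Re: "positive_op A \<Longrightarrow> 0 \<le> Re (cinner w (A w))"
  by (simp add: positive_op_def complex_nonneg_Reals_iff)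

lemma positive_op_real: "positive_op A \<Longrightarrow> cinner w (A w) = complex_of_real (Re (cinner w (A w)))"
  by (simp add: positive_op_def complex_nonneg_Reals_iff complex_eq_iff)

lemma positive_op_form:
  assumes A: "positive_op A"
  shows positive_op_hermitian: "cinner (A v) w = cinner v (A w)"
    and positive_op_Cauchy_Schwarz: "(cmod (cinner v (A w)))\<^sup>2 \<le> Re (cinner v (A v)) * Re (cinner w (A w))"
proof -
  have lin: "bounded_clinear A" using A by (simp add: positive_op_def)
  have q: "cinner v (A v) + z * cinner v (A w) + cnj z * cinner w (A v) + z * cnj z * cinner w (A w) \<in> \<real>\<^sub>\<ge>\<^sub>0" for z
  proof -
    have "cinner (v + z *\<^sub>C w) (A (v + z *\<^sub>C w)) \<in> \<real>\<^sub>\<ge>\<^sub>0" using A by (simp add: positive_op_def)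
    then show ?thesis
      by (simp add: bounded_clinear_add[OF lin] bounded_clinear_scaleC[OF lin] cinner_add_left
          cinner_add_right cinner_scaleC_left cinner_scaleC_right algebra_simps)
  qed
  have d: "cinner w (A w) \<in> \<real>\<^sub>\<ge>\<^sub>0" using A by (simp add: positive_op_def)
  show "(cmod (cinner v (A w)))\<^sup>2 \<le> Re (cinner v (A v)) * Re (cinner w (A w))"
    by (rule psd_quadratic(2)[OF q d])
  show "cinner (A v) w = cinner v (A w)"
    using psd_quadratic(1)[OF q d] cinner_commute[of "A v" w] by simp
qed

lemma positive_op_eq_0:
  assumes "positive_op A" "Re (cinner w (A w)) = 0"
  shows "A w = 0"
  using positive_op_Cauchy_Schwarz[OF assms(1), of "A w" w] assms(2) by (simp add: cinner_self norm_power)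

text \<open>Cauchy-Schwarz for the form of \<open>A\<close> at the pair \<open>A w\<close>,
  \<open>w\<close> lets a bound on the quadratic form control the operator norm.\<close>

lemma norm_positive_op_le:
  assumes "positive_op A" "\<And>v. Re (cinner v (A v)) \<le> C * (norm v)\<^sup>2" "0 \<le> C"
  shows "norm (A w) \<le> C * norm w"
proof (cases "A w = 0")
  case False
  let ?n = "norm (A w)"
  have "(?n\<^sup>2)\<^sup>2 = (cmod (cinner (A w) (A w)))\<^sup>2" by (simp add: cinner_self norm_power)
  also have "\<dots> \<le> Re (cinner (A w) (A (A w))) * Re (cinner w (A w))"
    by (rule positive_op_Cauchy_Schwarz[OF assms(1)])
  also have "\<dots> \<le> (C * ?n\<^sup>2) * (C * (norm w)\<^sup>2)"
    by (intro mult_mono assms positive_op_Re) (simp_all add: assms)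
  finally have "?n\<^sup>2 * ?n\<^sup>2 \<le> ?n\<^sup>2 * (C * norm w)\<^sup>2"
    by (simp only: power2_eq_square mult_ac)
  then have "?n\<^sup>2 \<le> (C * norm w)\<^sup>2" 
    by (rule mult_left_le_imp_le) (simp add: False)
  then show ?thesis by (rule power2_le_imp_le) (simp add: assms)
qed (simp add: assms)

lemma bounded_clinear_rank_one: "bounded_clinear (\<lambda>w. (c * cinner a w) *\<^sub>C b)"
proof (rule bounded_clinearI)
  show "norm ((c * cinner a w) *\<^sub>C b) \<le> (cmod c * norm a * norm b) * norm w" for w
    using mult_left_mono[OF cinner_Cauchy_Schwarz[of a w], of "cmod c * norm b"]
    by (simp add: norm_scaleC norm_mult mult_ac)
qed (simp_all add: cinner_add_right cinner_scaleC_right scaleC_add_left scaleC_scaleC algebra_simps)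

text \<open>One step of Cholesky elimination.  If \<open>\<langle>e, A e\<rangle> = 0\<close> then \<open>A e = 0\<close>, so the value \<open>inverse 0 = 0\<close> does
  no harm.\<close>

definition peel :: "('a::complex_hilbert \<Rightarrow> 'a) \<Rightarrow> 'a \<Rightarrow> 'a \<Rightarrow> 'a"
  where "peel A e = (\<lambda>w. A w - (inverse (cinner e (A e)) * cinner (A e) w) *\<^sub>C A e)"

lemma cinner_peel:
  "cinner v (peel A e w) = cinner v (A w) - inverse (cinner e (A e)) * cinner (A e) w * cinner v (A e)"
  by (simp add: peel_def cinner.diff_right cinner_scaleC_right)

lemma cinner_peel_self:
  assumes A: "positive_op A"
  shows "cinner w (peel A e w) =
    complex_of_real (Re (cinner w (A w)) - (cmod (cinner w (A e)))\<^sup>2 / Re (cinner e (A e)))"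
proof -
  have "cinner (A e) w * cinner w (A e) = complex_of_real ((cmod (cinner w (A e)))\<^sup>2)"
    using cinner_commute[of "A e" w] by (simp add: complex_norm_square mult.commute del: of_real_power)
  moreover have "inverse (cinner e (A e)) = complex_of_real (inverse (Re (cinner e (A e))))"
    unfolding of_real_inverse by (rule arg_cong[OF positive_op_real[OF A]])
  ultimately have "inverse (cinner e (A e)) * cinner (A e) w * cinner w (A e) =
      complex_of_real ((cmod (cinner w (A e)))\<^sup>2 / Re (cinner e (A e)))"
    by (simp add: mult.assoc divide_inverse mult.commute)
  moreover note positive_op_real[OF A, of w]
  ultimately show ?thesis unfolding cinner_peel of_real_diff by argo
qed

text \<open>Positivity of the remainder at \<open>w\<close> is Cauchy-Schwarz for the form of
  \<open>A\<close> at \<open>w\<close> and \<open>e\<close>.\<close>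

lemma positive_op_peel:
  assumes A: "positive_op A"
  shows "positive_op (peel A e)"
  unfolding positive_op_def
proof (intro conjI allI)
  show "bounded_clinear (peel A e)"
    unfolding peel_def using A by (intro bounded_clinear_minus bounded_clinear_rank_one) (simp add: positive_op_def)
  show "cinner w (peel A e w) \<in> \<real>\<^sub>\<ge>\<^sub>0" for w
    unfolding cinner_peel_self[OF A]
    using positive_op_Cauchy_Schwarz[OF A, of w e] positive_op_Re[OF A, of e] positive_op_Re[OF A, of w]
    by (cases "Re (cinner e (A e)) = 0")
      (auto simp: complex_nonneg_Reals_iff divide_le_eq simp del: of_real_diff)
qed

lemma Re_cinner_peel_le: "positive_op A \<Longrightarrow> Re (cinner w (peel A e w)) \<le> Re (cinner w (A w))"
  using positive_op_Re[of A e] by (simp add: cinner_peel_self)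

lemma peel_self:
  assumes A: "positive_op A"
  shows "peel A e e = 0"
proof (cases "cinner e (A e) = 0")
  case True then show ?thesis using positive_op_eq_0[OF A, of e] by (simp add: peel_def)
next
  case False then show ?thesis by (simp add: peel_def positive_op_hermitian[OF A])
qed

lemma peel_zero:
  assumes A: "positive_op A" and f: "A f = 0"
  shows "peel A e f = 0"
  using f by (simp add: peel_def positive_op_hermitian[OF A])

primrec peel_seq :: "('a::complex_hilbert \<Rightarrow> 'a) \<Rightarrow> (nat \<Rightarrow> 'a) \<Rightarrow> nat \<Rightarrow> 'a \<Rightarrow> 'a" where
  "peel_seq A e 0 = A"
| "peel_seq A e (Suc k) = peel (peel_seq A e k) (e k)"

text \<open>Scaled so that step \<open>k\<close> subtracts exactly the rank one operator of this
  vector. If the pivot is 0, the vector is 0.\<close>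

definition peel_vec :: "('a::complex_hilbert \<Rightarrow> 'a) \<Rightarrow> (nat \<Rightarrow> 'a) \<Rightarrow> nat \<Rightarrow> 'a"
  where "peel_vec A e k = complex_of_real (inverse (sqrt (Re (cinner (e k) (peel_seq A e k (e k)))))) *\<^sub>C peel_seq A e k (e k)"

context
  fixes A :: "'a::complex_hilbert \<Rightarrow> 'a" and e :: "nat \<Rightarrow> 'a"
  assumes A: "positive_op A"
begin

lemma positive_op_peel_seq: "positive_op (peel_seq A e k)"
  by (induction k) (simp_all add: A positive_op_peel)

lemma Re_cinner_peel_seq_le: "Re (cinner w (peel_seq A e k w)) \<le> Re (cinner w (A w))"
  by (induction k) (auto intro: order_trans[OF Re_cinner_peel_le[OF positive_op_peel_seq]])

lemma peel_seq_zero: "A f = 0 \<Longrightarrow> peel_seq A e k f = 0"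
  by (induction k) (simp_all add: peel_zero positive_op_peel_seq)

lemma peel_seq_self: "k < n \<Longrightarrow> peel_seq A e n (e k) = 0"
proof (induction n)
  case (Suc n)
  then show ?case
    by (cases "k = n") (simp_all add: peel_self peel_zero positive_op_peel_seq)
qed simp

lemma peel_seq_diff: "peel_seq A e k w - peel_seq A e (Suc k) w = cinner (peel_vec A e k) w *\<^sub>C peel_vec A e k"
proof -
  let ?c = "Re (cinner (e k) (peel_seq A e k (e k)))"
  have "complex_of_real (inverse (sqrt ?c)) * complex_of_real (inverse (sqrt ?c)) = inverse (complex_of_real ?c)"
    using positive_op_Re[OF positive_op_peel_seq, of "e k" k]
    by (simp flip: of_real_mult of_real_inverse inverse_mult_distrib)
  also have "complex_of_real ?c = cinner (e k) (peel_seq A e k (e k))"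
    by (rule positive_op_real[OF positive_op_peel_seq, symmetric])
  finally show ?thesis
    by (simp add: peel_def peel_vec_def cinner_scaleC_left scaleC_scaleC mult_ac)
qed

lemma peel_sum: "(\<Sum>k<n. cinner (peel_vec A e k) w *\<^sub>C peel_vec A e k) = A w - peel_seq A e n w"
  unfolding peel_seq_diff[symmetric] by (induction n) (simp_all add: algebra_simps)

lemma peel_vec_in:
  assumes S: "complex_vector.subspace S" and AS: "\<And>w. A w \<in> S"
  shows "peel_vec A e k \<in> S"
proof -
  have "peel_seq A e k w \<in> S" for w
  proof (induction k arbitrary: w)
    case (Suc k)
    then show ?case
      unfolding peel_seq.simps peel_def
      by (intro complex_vector.subspace_diff[OF S] complex_vector.subspace_scale[OF S])
  qed (simp add: AS)
  then show ?thesis unfolding peel_vec_def by (intro complex_vector.subspace_scale[OF S])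
qed

end

lemma bounded_clinear_bound:
  assumes "bounded_clinear T"
  obtains C where "0 \<le> C" "\<And>w. norm (T w) \<le> C * norm w"
  using bounded_linear.nonneg_bounded[OF bounded_clinear_bounded_linear[OF assms]]
  by (metis mult.commute)

lemma closure_span_ket: "closure (complex_vector.span (range (ket :: 'i \<Rightarrow> 'i ell2))) = UNIV"
proof -
  interpret closed_complex_subspace "closure (complex_vector.span (range (ket :: 'i \<Rightarrow> _)))"
    by (rule closed_complex_subspace_closure_span)
  have "y = 0" if "y \<in> orthocomp (range ket)" for y :: "'i ell2"
    by (rule ell2_eqI) (use that in \<open>simp add: orthocomp_def cinner_ket coord_zero\<close>)
  then have "x \<in> closure (complex_vector.span (range ket))" for x :: "'i ell2"
    by (intro in_if_orth) (metis cinner_zero_left orthocomp_closure_span)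
  then show ?thesis by blast
qed

lemma tendsto_zero_closure_span:
  assumes T: "\<And>n. bounded_clinear (T n)" and C: "\<And>n w. norm (T n w) \<le> C * norm w"
    and X: "\<And>x. x \<in> X \<Longrightarrow> (\<lambda>n. T n x) \<longlonglongrightarrow> 0" and w: "w \<in> closure (complex_vector.span X)"
  shows "(\<lambda>n. T n w) \<longlonglongrightarrow> 0"
proof (rule LIMSEQ_I)
  have sp: "(\<lambda>n. T n v) \<longlonglongrightarrow> 0" if "v \<in> complex_vector.span X" for v
    using that
  proof (induction rule: complex_vector.span_induct_alt)
    case base show ?case by (simp add: bounded_clinear_zero[OF T])
  next
    case (step c x y)
    then show ?case
      using tendsto_add[OF bounded_linear.tendsto[OF bounded_linear_scaleC X[OF step(1)], of c] step(2)]
      by (simp add: bounded_clinear_add[OF T] bounded_clinear_scaleC[OF T])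
  qed
  fix r :: real assume r: "r > 0"
  obtain v where v: "v \<in> complex_vector.span X" "dist v w < r / (2 * (\<bar>C\<bar> + 1))"
  proof -
    have "r / (2 * (\<bar>C\<bar> + 1)) > 0" using r by (simp add: add_nonneg_pos)
    then show ?thesis using w that unfolding closure_approachable by blast
  qed
  obtain N where N: "\<And>n. n \<ge> N \<Longrightarrow> norm (T n v) < r / 2"
    using LIMSEQ_D[OF sp[OF v(1)], of "r / 2"] r by auto
  have "norm (T n w) < r" if "n \<ge> N" for n
  proof -
    have "norm (T n w) \<le> norm (T n v) + norm (T n (w - v))"
      using norm_triangle_ineq[of "T n v" "T n (w - v)"] by (simp add: bounded_clinear_diff[OF T])
    also have "norm (T n (w - v)) \<le> (\<bar>C\<bar> + 1) * dist v w"
      using order_trans[OF C mult_right_mono[of C "\<bar>C\<bar> + 1" "norm (w - v)"], of n]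
      by (simp add: dist_norm norm_minus_commute)
    also have "\<dots> < r / 2" using v(2) by (simp add: field_simps)
    finally show ?thesis using N[OF that] by linarith
  qed
  then show "\<exists>N. \<forall>n\<ge>N. norm (T n w - 0) < r" by auto
qed

lemma rank_one_summable:
  assumes "((\<lambda>k. (norm (a k))\<^sup>2) summable_on UNIV)"
  shows "(\<lambda>k. cinner v (a k) * cinner (a k) w) summable_on UNIV"
proof (rule abs_summable_summable, rule summable_on_comparison_test)
  show "(\<lambda>k. (norm v * norm w) * (norm (a k))\<^sup>2) summable_on UNIV"
    using assms by (rule summable_on_cmult_right)
  show "norm (cinner v (a k) * cinner (a k) w) \<le> norm v * norm w * (norm (a k))\<^sup>2" for k
    using mult_mono[OF cinner_Cauchy_Schwarz[of v "a k"] cinner_Cauchy_Schwarz[of "a k" w]]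
    by (simp add: norm_mult power2_eq_square mult_ac)
qed simp

text \<open>Elimination along the kets: the remainders decrease as quadratic forms and annihilate
  every ket already treated, so they tend to 0 strongly and the subtracted rank one pieces add up to
  \<open>A\<close>.\<close>

lemma density_operator_decomposition:
  fixes A :: "'i ell2 \<Rightarrow> 'i ell2"
  assumes dens: "density_operator S A" and S: "complex_vector.subspace S"
  shows "\<exists>a :: nat \<Rightarrow> 'i ell2. (\<forall>k. a k \<in> S) \<and> ((\<lambda>k. (norm (a k))\<^sup>2) has_sum 1) UNIV \<and>
    (\<forall>v w. ((\<lambda>k. cinner v (a k) * cinner (a k) w) has_sum cinner v (A w)) UNIV)"
proof -
  have A: "positive_op A" and AS: "\<And>w. A w \<in> S" and tr: "trace A = 1"
    using dens by (auto simp: density_operator_def positive_op_def)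
  have lin: "bounded_clinear A" using A by (simp add: positive_op_def)
  \<comment> \<open>A divergent \<open>infsum\<close> has value 0, so trace 1 forces the diagonal to
    be summable.\<close>
  have sA: "(\<lambda>i. cinner (ket i) (A (ket i))) summable_on UNIV"
    using tr infsum_not_exists unfolding trace_def by fastforce
  have tr': "((\<lambda>i. Re (cinner (ket i) (A (ket i)))) has_sum 1) UNIV"
    using has_sum_Re[OF has_sum_infsum[OF sA]] tr by (simp add: trace_def)
  define I where "I = {i. A (ket i) \<noteq> 0}"
  \<comment> \<open>The index type may be uncountable, but a summable diagonal has countable
    support, and a ket with diagonal entry 0 is annihilated by \<open>A\<close>.\<close>
  have "I \<subseteq> {i\<in>UNIV. Re (cinner (ket i) (A (ket i))) \<noteq> 0}"
    using positive_op_eq_0[OF A] by (auto simp: I_def)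
  then have cI: "countable I"
    using summable_countable_real[OF has_sum_imp_summable[OF tr']] countable_subset by blast
  have "I \<noteq> {}"
  proof
    assume "I = {}"
    then have "((\<lambda>i. Re (cinner (ket i) (A (ket i)))) has_sum 0) UNIV"
      by (auto simp: I_def)
    then show False using tr' has_sum_unique by fastforce
  qed
  \<comment> \<open>If \<open>I\<close> is finite, the enumeration repeats elements; eliminating a
    vector a second time subtracts 0.\<close>
  define e where "e k = ket (from_nat_into I k)" for k
  let ?A = "peel_seq A e" and ?a = "peel_vec A e"
  obtain C where C: "0 \<le> C" "\<And>w. norm (A w) \<le> C * norm w" using bounded_clinear_bound[OF lin] by blast
  have "Re (cinner w (A w)) \<le> C * (norm w)\<^sup>2" for w
  proof -
    have "Re (cinner w (A w)) \<le> norm w * norm (A w)"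
      using cinner_Cauchy_Schwarz complex_Re_le_cmod order_trans by blast
    also have "\<dots> \<le> norm w * (C * norm w)" by (intro mult_left_mono C) simp
    finally show ?thesis by (simp add: power2_eq_square mult_ac)
  qed
  then have bd: "norm (?A n w) \<le> C * norm w" for n w
    by (intro norm_positive_op_le positive_op_peel_seq[OF A] C order_trans[OF Re_cinner_peel_seq_le[OF A]])
  \<comment> \<open>On each ket the remainder is eventually 0, and the bound \<open>C\<close> is
    uniform in \<open>n\<close>, so convergence passes to the closed span.\<close>
  have lim: "(\<lambda>n. ?A n w) \<longlonglongrightarrow> 0" for w
  proof (rule tendsto_zero_closure_span[where X = "range ket" and C = C])
    show "bounded_clinear (?A n)" for n using positive_op_peel_seq[OF A] by (simp add: positive_op_def)
    show "norm (?A n w) \<le> C * norm w" for n w by (rule bd)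
    show "w \<in> closure (complex_vector.span (range ket))" by (simp add: closure_span_ket)
    fix x :: "'i ell2" assume "x \<in> range ket"
    then obtain i where i: "x = ket i" by blast
    have "\<exists>N. \<forall>n\<ge>N. ?A n x = 0"
    proof (cases "i \<in> I")
      case True
      then obtain k where "from_nat_into I k = i" using from_nat_into_surj[OF cI] by blast
      then have "x = e k" by (simp add: i e_def)
      then have "\<forall>n\<ge>Suc k. ?A n x = 0" using peel_seq_self[OF A, of k _ e] by (simp add: Suc_le_eq)
      then show ?thesis by blast
    next
      case False
      then show ?thesis using peel_seq_zero[OF A, of x] by (simp add: I_def i)
    qed
    then show "(\<lambda>n. ?A n x) \<longlonglongrightarrow> 0"
      by (metis (mono_tags, lifting) eventually_sequentiallyI tendsto_eventually)
  qed
  have sums: "(\<lambda>k. cinner v (?a k) * cinner (?a k) w) sums cinner v (A w)" for v w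
  proof -
    have "(\<Sum>k<n. cinner v (?a k) * cinner (?a k) w) = cinner v (A w) - cinner v (?A n w)" for n
      using arg_cong[OF peel_sum[OF A, of e w n], of "cinner v"]
      by (simp add: cinner.sum_right cinner_scaleC_right cinner.diff_right mult.commute)
    moreover have "(\<lambda>n. cinner v (A w) - cinner v (?A n w)) \<longlonglongrightarrow> cinner v (A w) - cinner v 0"
      by (intro tendsto_diff tendsto_const cinner.tendsto lim)
    ultimately show ?thesis by (simp add: sums_def)
  qed
  have hs: "((\<lambda>k. (cmod (coord (?a k) i))\<^sup>2) has_sum Re (cinner (ket i) (A (ket i)))) UNIV" for i
  proof (rule sums_nonneg_imp_has_sum)
    have "Re (cinner (ket i) (?a k) * cinner (?a k) (ket i)) = (cmod (coord (?a k) i))\<^sup>2" for k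
      using cinner_commute[of "?a k" "ket i"]
      by (simp add: cinner_ket cmod_power2 power2_eq_square[symmetric])
    then show "(\<lambda>k. (cmod (coord (?a k) i))\<^sup>2) sums Re (cinner (ket i) (A (ket i)))"
      using sums_Re[OF sums[of "ket i" "ket i"]] by simp
  qed simp
  \<comment> \<open>Tonelli: summing over \<open>k\<close> first gives the diagonal of
    \<open>A\<close>, with total 1; summing over \<open>i\<close> first gives the squared
    norms.\<close>
  have "(\<lambda>(i, k). (cmod (coord (?a k) i))\<^sup>2) summable_on UNIV \<times> UNIV"
    by (rule summable_on_SigmaI[OF _ has_sum_imp_summable[OF tr']]) (use hs in auto)
  then have "((\<lambda>(i, k). (cmod (coord (?a k) i))\<^sup>2) has_sum 1) (UNIV \<times> UNIV)"
    by (rule has_sum_SigmaI[OF _ tr', rotated]) (use hs in auto)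
  then have "((\<lambda>(k, i). (cmod (coord (?a k) i))\<^sup>2) has_sum 1) (UNIV \<times> UNIV)"
    by (subst has_sum_swap) (simp add: case_prod_unfold)
  then have n1: "((\<lambda>k. (norm (?a k))\<^sup>2) has_sum 1) UNIV"
    by (rule has_sum_SigmaD) (use norm_ell2_has_sum in auto)
  \<comment> \<open>Elimination only yields ordered sums; square summability of the vectors turns
    them into unordered ones.\<close>
  have "((\<lambda>k. cinner v (?a k) * cinner (?a k) w) has_sum cinner v (A w)) UNIV" for v w
  proof -
    have h: "((\<lambda>k. cinner v (?a k) * cinner (?a k) w) has_sum (\<Sum>\<^sub>\<infinity>k. cinner v (?a k) * cinner (?a k) w)) UNIV"
      by (rule has_sum_infsum[OF rank_one_summable[OF has_sum_imp_summable[OF n1]]])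
    then show ?thesis using sums_unique2[OF has_sum_imp_sums[OF h] sums] by simp
  qed
  then show ?thesis using n1 peel_vec_in[OF A S AS] by blast
qed

text \<open>Both sides are iterated sums of one double family, built from the coordinates of
  \<open>a k\<close> and of the adjoint of \<open>T\<close> at \<open>a k\<close>. It is absolutely
  summable because both sequences of vectors are square summable.\<close>

lemma trace_rank_one_sum:
  fixes A T :: "'i ell2 \<Rightarrow> 'i ell2" and a :: "'k \<Rightarrow> 'i ell2"
  assumes a: "(\<lambda>k. (norm (a k))\<^sup>2) summable_on UNIV"
    and A: "\<And>v w. ((\<lambda>k. cinner v (a k) * cinner (a k) w) has_sum cinner v (A w)) UNIV"
    and T: "bounded_clinear T"
  shows "((\<lambda>k. cinner (a k) (T (a k))) has_sum trace (A \<circ> T)) UNIV"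
proof -
  obtain C where C: "0 \<le> C" "\<And>w. norm (T w) \<le> C * norm w" using bounded_clinear_bound[OF T] by blast
  obtain S where S: "\<And>x y. cinner (S x) y = cinner x (T y)" "\<And>x. norm (S x) \<le> C * norm x"
    using ex_adjoint[OF T C(2,1)] by blast
  define h where "h k i = cnj (coord (S (a k)) i) * coord (a k) i" for k i
  have s1: "(\<lambda>(k, i). (cmod (coord (a k) i))\<^sup>2) summable_on UNIV \<times> UNIV"
    by (rule summable_on_SigmaI[OF _ a]) (use norm_ell2_has_sum in auto)
  have "(\<lambda>k. (norm (S (a k)))\<^sup>2) summable_on UNIV"
  proof (rule summable_on_comparison_test[OF summable_on_cmult_right[OF a, of "C\<^sup>2"]])
    show "(norm (S (a k)))\<^sup>2 \<le> C\<^sup>2 * (norm (a k))\<^sup>2" for k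
      using power_mono[OF S(2), of "a k" 2] by (simp add: power_mult_distrib)
  qed simp
  then have s2: "(\<lambda>(k, i). (cmod (coord (S (a k)) i))\<^sup>2) summable_on UNIV \<times> UNIV"
    by (rule summable_on_SigmaI[rotated]) (use norm_ell2_has_sum in auto)
  have "(\<lambda>(k, i). h k i) summable_on UNIV \<times> UNIV"
  proof (rule abs_summable_summable, rule Infinite_Sum.abs_summable_on_comparison_test')
    show "(\<lambda>(k, i). (cmod (coord (S (a k)) i))\<^sup>2 + (cmod (coord (a k) i))\<^sup>2) summable_on UNIV \<times> UNIV"
      using summable_on_add[OF s2 s1] by (simp add: case_prod_unfold)
    show "norm (case z of (k, i) \<Rightarrow> h k i) \<le>
        (case z of (k, i) \<Rightarrow> (cmod (coord (S (a k)) i))\<^sup>2 + (cmod (coord (a k) i))\<^sup>2)" for z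
    proof -
      obtain k i where z: "z = (k, i)" by (cases z)
      let ?p = "cmod (coord (S (a k)) i)" and ?q = "cmod (coord (a k) i)"
      have "2 * (?p * ?q) \<le> ?p\<^sup>2 + ?q\<^sup>2" using sum_squares_bound[of ?p ?q] by simp
      moreover have "0 \<le> ?p * ?q" by simp
      ultimately have "?p * ?q \<le> ?p\<^sup>2 + ?q\<^sup>2" by linarith
      then show ?thesis unfolding z h_def by (simp add: norm_mult)
    qed
  qed
  then obtain s where s: "((\<lambda>(k, i). h k i) has_sum s) (UNIV \<times> UNIV)" by (auto simp: summable_on_def)
  have 1: "((\<lambda>k. cinner (a k) (T (a k))) has_sum s) UNIV"
    by (rule has_sum_SigmaD[OF s]) (simp add: h_def S(1)[symmetric] cinner_ell2_has_sum)
  have "((\<lambda>(i, k). h k i) has_sum s) (UNIV \<times> UNIV)"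
    using s by (subst has_sum_swap) (simp add: case_prod_unfold)
  then have "((\<lambda>i. cinner (ket i) ((A \<circ> T) (ket i))) has_sum s) UNIV"
  proof (rule has_sum_SigmaD)
    fix i
    have "cinner (ket i) (a k) * cinner (a k) (T (ket i)) = h k i" for k
      unfolding h_def S(1)[symmetric] cinner_ket[symmetric] using cinner_commute[of "S (a k)" "ket i"] by simp
    then show "((\<lambda>k. case (i, k) of (i, k) \<Rightarrow> h k i) has_sum cinner (ket i) ((A \<circ> T) (ket i))) UNIV"
      using A[of "ket i" "T (ket i)"] by simp
  qed
  then have "trace (A \<circ> T) = s" unfolding trace_def by (rule infsumI)
  then show ?thesis using 1 by simp
qed

text \<open>The converse of \<open>density_operator_decomposition\<close>; the trace is found from
  \<open>trace_rank_one_sum\<close> at \<open>id\<close>.\<close>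

lemma density_operator_from_vectors:
  fixes a :: "nat \<Rightarrow> 'i ell2"
  assumes S: "closed_complex_subspace S" and aS: "\<And>k. a k \<in> S"
    and a: "((\<lambda>k. (norm (a k))\<^sup>2) has_sum 1) UNIV"
  shows "\<exists>A. density_operator S A \<and> (\<forall>v w. ((\<lambda>k. cinner v (a k) * cinner (a k) w) has_sum cinner v (A w)) UNIV)"
proof -
  interpret closed_complex_subspace S by (rule S)
  have nb: "norm (cinner (a k) w *\<^sub>C a k) \<le> norm w * (norm (a k))\<^sup>2" for k w
    using mult_right_mono[OF cinner_Cauchy_Schwarz[of "a k" w], of "norm (a k)"]
    by (simp add: norm_scaleC power2_eq_square mult_ac)
  have bsum: "((\<lambda>k. norm w * (norm (a k))\<^sup>2) has_sum norm w) UNIV" for w :: "'i ell2"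
    using has_sum_cmult_right[OF a, of "norm w"] by simp
  define A where "A w = (\<Sum>\<^sub>\<infinity>k. cinner (a k) w *\<^sub>C a k)" for w
  have abs: "(\<lambda>k. norm (cinner (a k) w *\<^sub>C a k)) summable_on UNIV" for w
    using Infinite_Sum.abs_summable_on_comparison_test'[OF has_sum_imp_summable[OF bsum] nb] .
  have A: "((\<lambda>k. cinner (a k) w *\<^sub>C a k) has_sum A w) UNIV" for w
    unfolding A_def by (rule has_sum_infsum[OF abs_summable_summable[OF abs]])
  have form: "((\<lambda>k. cinner v (a k) * cinner (a k) w) has_sum cinner v (A w)) UNIV" for v w
    using has_sum_bounded_linear[OF cinner.bounded_linear_right A, of v w]
    by (simp add: o_def cinner_scaleC_right mult.commute)
  have lin: "bounded_clinear A"
  proof (rule bounded_clinearI[where C = 1])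
    show "A (v + w) = A v + A w" for v w
      using has_sum_unique[OF A has_sum_add[OF A A, of v w, folded scaleC_add_left cinner_add_right]] .
    show "A (c *\<^sub>C w) = c *\<^sub>C A w" for c w
      using has_sum_unique[OF A[of "c *\<^sub>C w"]] has_sum_bounded_linear[OF bounded_linear_scaleC A, of c w]
      by (simp add: o_def cinner_scaleC_right scaleC_scaleC)
    show "norm (A w) \<le> 1 * norm w" for w
    proof -
      have "norm (A w) \<le> (\<Sum>\<^sub>\<infinity>k. norm (cinner (a k) w *\<^sub>C a k))"
        unfolding A_def by (rule norm_infsum_bound[OF abs])
      also have "\<dots> \<le> norm w"
        by (rule has_sum_mono[OF has_sum_infsum[OF abs] bsum nb])
      finally show ?thesis by simp
    qed
  qed
  have "A w \<in> S" for w
  proof (rule Lim_in_closed_set[OF closed])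
    show "((\<lambda>F. \<Sum>k\<in>F. cinner (a k) w *\<^sub>C a k) \<longlongrightarrow> A w) (finite_subsets_at_top UNIV)"
      using A[of w] by (simp add: has_sum_def)
    show "\<forall>\<^sub>F F in finite_subsets_at_top UNIV. (\<Sum>k\<in>F. cinner (a k) w *\<^sub>C a k) \<in> S"
      by (intro always_eventually allI complex_vector.subspace_sum[OF subspace]
          complex_vector.subspace_scale[OF subspace] aS)
  qed simp
  moreover have "A w = 0" if "w \<in> orthocomp S" for w
    using orthocompD[OF that aS] by (simp add: A_def)
  moreover have "cinner w (A w) \<in> \<real>\<^sub>\<ge>\<^sub>0" for w
  proof -
    have e: "cinner w (a k) * cinner (a k) w = complex_of_real ((cmod (cinner w (a k)))\<^sup>2)" for k
      using cinner_commute[of "a k" w] by (simp add: complex_norm_square del: of_real_power)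
    have "Re (cinner w (A w)) \<ge> 0"
      using has_sum_Re[OF form[of w w]] by (rule has_sum_nonneg) (simp add: e del: of_real_power)
    moreover have "Im (cinner w (A w)) = 0"
      using has_sum_Im[OF form[of w w]] has_sum_unique[OF _ has_sum_0_simp] by (simp add: e del: of_real_power)
    ultimately show ?thesis by (simp add: complex_nonneg_Reals_iff)
  qed
  moreover have "trace A = 1"
  proof -
    have "((\<lambda>k. cinner (a k) (id (a k))) has_sum trace (A \<circ> id)) UNIV"
      by (rule trace_rank_one_sum[OF has_sum_imp_summable[OF a] form bounded_clinear_id])
    moreover have "((\<lambda>k. cinner (a k) (id (a k))) has_sum 1) UNIV"
      using has_sum_of_real[OF a, where 'a = complex] by (simp add: cinner_self)
    ultimately show ?thesis using has_sum_unique by fastforce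
  qed
  ultimately show ?thesis using lin form unfolding density_operator_def by blast
qed

section \<open>Holomorphic expansions and states of the Fock space\<close>

text \<open>On Fock space this is the projection onto the summand of degree
  \<open>n\<close>.\<close>

lift_definition length_part :: "nat \<Rightarrow> 'a list ell2 \<Rightarrow> 'a list ell2"
  is "\<lambda>n x bs. if length bs = n then x bs else 0"
  by (rule summable_on_comparison_test) auto

lemma coord_length_part: "coord (length_part n x) bs = (if length bs = n then coord x bs else 0)"
  by transfer simp

lemma cinner_length_part_has_sum:
  "((\<lambda>n. cinner (length_part n v) (length_part n w)) has_sum cinner v w) UNIV"
proof -
  let ?h = "\<lambda>bs. cnj (coord v bs) * coord w bs"
  have bij: "bij_betw snd (Sigma UNIV (\<lambda>n. {bs::'a list. length bs = n})) UNIV"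
    by (rule bij_betwI[of _ _ _ "\<lambda>bs. (length bs, bs)"]) auto
  have "((\<lambda>z. ?h (snd z)) has_sum cinner v w) (Sigma UNIV (\<lambda>n. {bs. length bs = n}))"
    unfolding has_sum_reindex_bij_betw[OF bij, of ?h] by (rule cinner_ell2_has_sum)
  then show ?thesis
  proof (rule has_sum_SigmaD)
    fix n
    have "((\<lambda>bs. cnj (coord (length_part n v) bs) * coord (length_part n w) bs) has_sum
        cinner (length_part n v) (length_part n w)) UNIV"
      by (rule cinner_ell2_has_sum)
    then show "((\<lambda>bs. ?h (snd (n, bs))) has_sum cinner (length_part n v) (length_part n w)) {bs. length bs = n}"
      by (rule has_sum_cong_neutral[THEN iffD1, rotated -1]) (auto simp: coord_length_part)
  qed
qed

lemma norm_length_part_has_sum: "((\<lambda>n. (norm (length_part n v))\<^sup>2) has_sum (norm v)\<^sup>2) UNIV"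
  using has_sum_Re[OF cinner_length_part_has_sum[of v v]] by (simp add: Re_cinner_self)

lemma bounded_clinear_length_part: "bounded_clinear (length_part n)"
proof (rule bounded_clinearI[where C = 1])
  show "norm (length_part n x) \<le> 1 * norm x" for x :: "'a list ell2"
  proof -
    have "(norm (length_part n x))\<^sup>2 \<le> (norm x)\<^sup>2"
      using finite_sum_le_has_sum[OF norm_length_part_has_sum[of x], of "{n}"] by simp
    then show ?thesis using power2_le_imp_le[of "norm (length_part n x)" "norm x"] by simp
  qed
qed (auto intro!: ell2_eqI simp: coord_length_part coord_add coord_scaleC)

lemma length_part_simple_tensor:
  "length_part n (simple_tensor vs) = (if length vs = n then simple_tensor vs else 0)"
  by (rule ell2_eqI) (auto simp: coord_length_part coord_simple_tensor tensor_coord_eq coord_zero)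

lemma length_part_in_tensor_power:
  assumes w: "w \<in> fock K"
  shows "length_part n w \<in> tensor_power K n"
proof (rule bounded_clinear_closure_span_in[OF bounded_clinear_length_part
      tensor_power.subspace tensor_power.closed _ w[unfolded fock_def]])
  fix x assume "x \<in> simple_tensor ` {vs. set vs \<subseteq> K}"
  then obtain vs where vs: "x = simple_tensor vs" "set vs \<subseteq> K" by blast
  then show "length_part n x \<in> tensor_power K n"
    by (simp add: length_part_simple_tensor simple_tensor_in_tensor_power
        complex_vector.subspace_0[OF tensor_power.subspace])
qed

lemma length_part_fock_op:
  assumes x: "contractive x" and w: "w \<in> fock UNIV"
  shows "length_part n (fock_op x w) = fock_op x (length_part n w)"
proof -
  have "(length_part n \<circ> fock_op x) w = (fock_op x \<circ> length_part n) w"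
  proof (rule bounded_clinear_eq_closure_span[OF _ _ _ w[unfolded fock_def]])
    show "bounded_clinear (length_part n \<circ> fock_op x)" "bounded_clinear (fock_op x \<circ> length_part n)"
      by (intro bounded_clinear_comp bounded_clinear_length_part bounded_clinear_fock_op x)+
    fix s :: "'a list ell2" assume "s \<in> simple_tensor ` {vs. set vs \<subseteq> UNIV}"
    then obtain vs where "s = simple_tensor vs" by blast
    then show "(length_part n \<circ> fock_op x) s = (fock_op x \<circ> length_part n) s"
      by (simp add: length_part_simple_tensor fock_op_simple_tensor[OF x]
          bounded_clinear_zero[OF bounded_clinear_fock_op[OF x]])
  qed
  then show ?thesis by simp
qed

lemma unitary_contractive:
  assumes "u \<in> unitaries K"
  shows "contractive u"
proof -
  have "bounded_clinear u" and "\<And>x y. cinner (u x) (u y) = cinner x y"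
    using assms by (auto simp: unitaries_def)
  then have "(norm (u v))\<^sup>2 = (norm v)\<^sup>2" for v by (metis Re_cinner_self)
  then have "norm (u v) = norm v" for v by (simp add: power2_eq_iff_nonneg)
  then show ?thesis using \<open>bounded_clinear u\<close> by (simp add: contractive_def)
qed

text \<open>The sequence \<open>w\<close> stands for the density operator \<open>\<Sum>\<^sub>k |w k\<rangle>\<langle>w k|\<close> on the Fock space.\<close>

definition fock_state :: "'h::complex_hilbert set \<Rightarrow> (nat \<Rightarrow> 'h list ell2) \<Rightarrow> bool"
  where "fock_state K w \<longleftrightarrow> (\<forall>k. w k \<in> fock K) \<and> ((\<lambda>k. (norm (w k))\<^sup>2) has_sum 1) UNIV"

text \<open>The trace of the density operator given by \<open>w\<close> against the second
  quantization of \<open>x\<close>.\<close>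

definition fock_value :: "(nat \<Rightarrow> 'h::complex_hilbert list ell2) \<Rightarrow> ('h \<Rightarrow> 'h) \<Rightarrow> complex"
  where "fock_value w x = (\<Sum>\<^sub>\<infinity>k. cinner (w k) (fock_op x (w k)))"

lemma cinner_fock_op_le: "contractive x \<Longrightarrow> cmod (cinner v (fock_op x v)) \<le> (norm v)\<^sup>2"
  using cinner_Cauchy_Schwarz[of v "fock_op x v"] mult_left_mono[OF norm_fock_op[of x v], of "norm v"]
  by (simp add: power2_eq_square)

lemma fock_value_has_sum:
  assumes "fock_state K w" "contractive x"
  shows "((\<lambda>k. cinner (w k) (fock_op x (w k))) has_sum fock_value w x) UNIV"
  unfolding fock_value_def
proof (rule has_sum_infsum, rule abs_summable_summable, rule Infinite_Sum.abs_summable_on_comparison_test')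
  show "(\<lambda>k. (norm (w k))\<^sup>2) summable_on UNIV"
    using assms(1) by (auto simp: fock_state_def intro: has_sum_imp_summable)
qed (rule cinner_fock_op_le[OF assms(2)])

text \<open>Each \<open>A n\<close> is cut into rank one pieces, weighted by
  \<open>sqrt (c n)\<close>, and the double family is enumerated as one sequence. The last clause
  covers all contractions so that \<open>holomorphic_extension\<close> can be evaluated with the
  same sequence.\<close>

lemma fock_state_of_expansion:
  fixes K :: "'h::complex_hilbert set"
  assumes h: "holomorphic_expansion K c A \<phi>"
  shows "\<exists>w. fock_state K w \<and> (\<forall>u\<in>unitaries K. \<phi> u = fock_value w u) \<and>
    (\<forall>x. contractive x \<longrightarrow> (\<lambda>n. complex_of_real (c n) * trace (A n \<circ> tensor_op n x)) sums fock_value w x)"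
proof -
  have c: "\<And>n. 0 \<le> c n" "c sums 1" and dens: "\<And>n. density_operator (tensor_power K n) (A n)"
    and val: "\<And>u. u \<in> unitaries K \<Longrightarrow> (\<lambda>n. complex_of_real (c n) * trace (A n \<circ> tensor_op n u)) sums \<phi> u"
    using h by (auto simp: holomorphic_expansion_def)
  have "\<exists>a :: nat \<Rightarrow> 'h list ell2. (\<forall>k. a k \<in> tensor_power K n) \<and> ((\<lambda>k. (norm (a k))\<^sup>2) has_sum 1) UNIV \<and>
    (\<forall>v w. ((\<lambda>k. cinner v (a k) * cinner (a k) w) has_sum cinner v (A n w)) UNIV)" for n
    by (rule density_operator_decomposition[OF dens tensor_power.subspace])
  then have "\<forall>n. \<exists>a :: nat \<Rightarrow> 'h list ell2. (\<forall>k. a k \<in> tensor_power K n) \<and> ((\<lambda>k. (norm (a k))\<^sup>2) has_sum 1) UNIV \<and>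
    (\<forall>v w. ((\<lambda>k. cinner v (a k) * cinner (a k) w) has_sum cinner v (A n w)) UNIV)" ..
  from choice[OF this] obtain a :: "nat \<Rightarrow> nat \<Rightarrow> 'h list ell2" where "\<forall>n. (\<forall>k. a n k \<in> tensor_power K n) \<and>
    ((\<lambda>k. (norm (a n k))\<^sup>2) has_sum 1) UNIV \<and>
    (\<forall>v w. ((\<lambda>k. cinner v (a n k) * cinner (a n k) w) has_sum cinner v (A n w)) UNIV)" by blast
  then have a: "\<And>n k. a n k \<in> tensor_power K n" "\<And>n. ((\<lambda>k. (norm (a n k))\<^sup>2) has_sum 1) UNIV"
    "\<And>n v w. ((\<lambda>k. cinner v (a n k) * cinner (a n k) w) has_sum cinner v (A n w)) UNIV"
    by simp_all
  define b where "b = (\<lambda>(n, k). complex_of_real (sqrt (c n)) *\<^sub>C a n k)"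
  define w where "w m = b (prod_decode m)" for m
  have bij: "bij_betw prod_decode UNIV (UNIV \<times> UNIV)" 
    by (simp only: UNIV_Times_UNIV bij_prod_decode)
  have c': "(c has_sum 1) UNIV" by (rule sums_nonneg_imp_has_sum[OF c(2,1)])
  have n1: "((\<lambda>k. (norm (b (n, k)))\<^sup>2) has_sum c n) UNIV" for n
    using has_sum_cmult_right[OF a(2), of "c n" n] c(1)[of n] by (simp add: b_def norm_scaleC power_mult_distrib)
  have "(\<lambda>z. (norm (b z))\<^sup>2) summable_on UNIV \<times> UNIV"
    by (rule summable_on_SigmaI[OF n1 has_sum_imp_summable[OF c']]) simp
  then have nb: "((\<lambda>z. (norm (b z))\<^sup>2) has_sum 1) (UNIV \<times> UNIV)"
    by (rule has_sum_SigmaI[OF n1 c'])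
  have st: "fock_state K w"
    unfolding fock_state_def
  proof (intro conjI allI)
    show "((\<lambda>k. (norm (w k))\<^sup>2) has_sum 1) UNIV"
      unfolding w_def using has_sum_reindex_bij_betw[OF bij, of "\<lambda>z. (norm (b z))\<^sup>2" 1] nb by simp
    show "w k \<in> fock K" for k
      unfolding w_def b_def case_prod_unfold
      by (rule complex_vector.subspace_scale[OF fock.subspace subsetD[OF tensor_power_subset_fock a(1)]])
  qed
  have s: "(\<lambda>n. complex_of_real (c n) * trace (A n \<circ> tensor_op n x)) sums fock_value w x" if x: "contractive x" for x
  proof (rule has_sum_imp_sums)
    have "((\<lambda>z. cinner (b z) (fock_op x (b z))) has_sum fock_value w x) (UNIV \<times> UNIV)"
      using fock_value_has_sum[OF st x] unfolding w_def
      by (subst (asm) has_sum_reindex_bij_betw[OF bij, of "\<lambda>z. cinner (b z) (fock_op x (b z))"])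
    then show "((\<lambda>n. complex_of_real (c n) * trace (A n \<circ> tensor_op n x)) has_sum fock_value w x) UNIV"
    proof (rule has_sum_SigmaD)
      fix n
      have "((\<lambda>k. cinner (a n k) (tensor_op n x (a n k))) has_sum trace (A n \<circ> tensor_op n x)) UNIV"
        by (rule trace_rank_one_sum[OF has_sum_imp_summable[OF a(2)] a(3) bounded_clinear_tensor_op[OF x]])
      from has_sum_cmult_right[OF this, of "complex_of_real (c n)"]
      show "((\<lambda>k. cinner (b (n, k)) (fock_op x (b (n, k)))) has_sum complex_of_real (c n) * trace (A n \<circ> tensor_op n x)) UNIV"
        using c(1)[of n]
        by (simp add: b_def bounded_clinear_scaleC[OF bounded_clinear_fock_op[OF x]] cinner_scaleC_left
            cinner_scaleC_right tensor_op_tensor_power[OF x a(1)] mult.assoc[symmetric] flip: of_real_mult)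
    qed
  qed
  then show ?thesis using st val sums_unique2 unitary_contractive by blast
qed

text \<open>The weight \<open>c n\<close> is the total squared norm of the degree \<open>n\<close>
  parts. Second quantization preserves degrees, so no cross terms occur. The unit vector
  \<open>e\<close> supplies a density operator of trace 1 in degrees where
  \<open>c n = 0\<close>.\<close>

lemma expansion_of_fock_state:
  fixes K :: "'h::complex_hilbert set"
  assumes st: "fock_state K w" and val: "\<And>u. u \<in> unitaries K \<Longrightarrow> \<phi> u = fock_value w u"
    and e: "e \<in> K" "norm e = 1"
  shows "\<exists>c A. holomorphic_expansion K c A \<phi>"
proof -
  define a where "a n k = length_part n (w k)" for n k
  have wK: "w k \<in> fock K" and wU: "w k \<in> fock UNIV" for k
    using st fock_mono[of K UNIV] by (auto simp: fock_state_def)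
  have aK: "a n k \<in> tensor_power K n" for n k
    unfolding a_def by (rule length_part_in_tensor_power[OF wK])
  have w1: "((\<lambda>k. (norm (w k))\<^sup>2) has_sum 1) UNIV" using st by (simp add: fock_state_def)
  have "(\<lambda>(k, n). (norm (a n k))\<^sup>2) summable_on UNIV \<times> UNIV"
    by (rule summable_on_SigmaI[OF _ has_sum_imp_summable[OF w1]])
      (use norm_length_part_has_sum in \<open>auto simp: a_def\<close>)
  then have "((\<lambda>(k, n). (norm (a n k))\<^sup>2) has_sum 1) (UNIV \<times> UNIV)"
    by (rule has_sum_SigmaI[OF _ w1, rotated]) (use norm_length_part_has_sum in \<open>auto simp: a_def\<close>)
  then have nk: "((\<lambda>(n, k). (norm (a n k))\<^sup>2) has_sum 1) (UNIV \<times> UNIV)"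
    by (subst has_sum_swap) (simp add: case_prod_unfold)
  have sk: "(\<lambda>k. (norm (a n k))\<^sup>2) summable_on UNIV" for n
    using summable_on_SigmaD1[OF has_sum_imp_summable[OF nk], of n] by simp
  define c where "c n = (\<Sum>\<^sub>\<infinity>k. (norm (a n k))\<^sup>2)" for n
  have c: "((\<lambda>k. (norm (a n k))\<^sup>2) has_sum c n) UNIV" for n
    unfolding c_def by (rule has_sum_infsum[OF sk])
  have c0: "0 \<le> c n" for n unfolding c_def by (rule infsum_nonneg) simp
  have c1: "c sums 1"
    by (rule has_sum_imp_sums, rule has_sum_SigmaD[OF nk]) (simp add: c)
  have "\<exists>A. density_operator (tensor_power K n) A \<and> (\<forall>x. contractive x \<longrightarrow>
      ((\<lambda>k. cinner (a n k) (fock_op x (a n k))) has_sum complex_of_real (c n) * trace (A \<circ> tensor_op n x)) UNIV)" for n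
  proof (cases "c n = 0")
    case True
    have "a n k = 0" for k
      using finite_sum_le_has_sum[OF c, of "{k}" n] True by simp
    moreover have "\<exists>A. density_operator (tensor_power K n) A"
    proof -
      \<comment> \<open>The unit vector given by the \<open>n\<close>-th tensor power of
        \<open>e\<close>. It heads a sequence that is 0 elsewhere, so the resulting density operator
        is the projection onto its line.\<close>
      define t where "t = simple_tensor (replicate n e)"
      have "cinner t t = 1" 
      proof -
        have "cinner e e = 1" using e by (simp add: cinner_self)
        then show ?thesis unfolding t_def by (induction n) simp_all
      qed
      then have "(norm t)\<^sup>2 = 1" by (metis Re_cinner_self one_complex.sel(1))
      then have "((\<lambda>k. (norm (if k = 0 then t else 0))\<^sup>2) has_sum 1) {0::nat}"
        by (intro has_sum_finiteI) auto
      then have "((\<lambda>k. (norm (if k = 0 then t else 0))\<^sup>2) has_sum 1) (UNIV :: nat set)"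
        by (rule has_sum_cong_neutral[THEN iffD1, rotated -1]) auto
      moreover have "t \<in> tensor_power K n"
        unfolding t_def by (rule simple_tensor_in_tensor_power) (use e in auto)
      then have "(if k = 0 then t else 0) \<in> tensor_power K n" for k :: nat
        by (simp add: complex_vector.subspace_0[OF tensor_power.subspace])
      ultimately show ?thesis
        using density_operator_from_vectors[OF tensor_power.closed_complex_subspace_axioms, of "\<lambda>k. if k = 0 then t else 0" K n]
        by blast
    qed
    ultimately show ?thesis
      using True by (auto simp: bounded_clinear_zero[OF bounded_clinear_fock_op])
  next
    case False
    then have cn: "c n > 0" using c0[of n] by simp
    define a' where "a' k = complex_of_real (inverse (sqrt (c n))) *\<^sub>C a n k" for k
    have n1: "((\<lambda>k. (norm (a' k))\<^sup>2) has_sum 1) UNIV"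
      using has_sum_cmult_right[OF c[of n], of "inverse (c n)"] cn
      by (simp add: a'_def norm_scaleC power_mult_distrib power_inverse norm_inverse)
    have a'K: "a' k \<in> tensor_power K n" for k
      unfolding a'_def by (intro complex_vector.subspace_scale[OF tensor_power.subspace] aK)
    obtain A where A: "density_operator (tensor_power K n) A"
      "\<And>v w. ((\<lambda>k. cinner v (a' k) * cinner (a' k) w) has_sum cinner v (A w)) UNIV"
      using density_operator_from_vectors[OF tensor_power.closed_complex_subspace_axioms a'K n1] by blast
    have "((\<lambda>k. cinner (a n k) (fock_op x (a n k))) has_sum complex_of_real (c n) * trace (A \<circ> tensor_op n x)) UNIV"
      if x: "contractive x" for x
    proof -
      have "((\<lambda>k. cinner (a' k) (tensor_op n x (a' k))) has_sum trace (A \<circ> tensor_op n x)) UNIV"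
        by (rule trace_rank_one_sum[OF has_sum_imp_summable[OF n1] A(2) bounded_clinear_tensor_op[OF x]])
      note has_sum_cmult_right[OF this, of "complex_of_real (c n)"]
      moreover have "c n * inverse (sqrt (c n)) * inverse (sqrt (c n)) = 1"
        using cn by (simp add: field_simps)
      ultimately show ?thesis
        by (simp add: tensor_op_tensor_power[OF x a'K] del: of_real_inverse)
          (simp add: a'_def bounded_clinear_scaleC[OF bounded_clinear_fock_op[OF x]] cinner_scaleC_left
            cinner_scaleC_right mult.assoc[symmetric] flip: of_real_mult of_real_inverse)
    qed
    then show ?thesis using A(1) by blast
  qed
  then have "\<forall>n. \<exists>A. density_operator (tensor_power K n) A \<and> (\<forall>x. contractive x \<longrightarrow>
      ((\<lambda>k. cinner (a n k) (fock_op x (a n k))) has_sum complex_of_real (c n) * trace (A \<circ> tensor_op n x)) UNIV)" ..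
  from choice[OF this] obtain A where "\<forall>n. density_operator (tensor_power K n) (A n) \<and> (\<forall>x. contractive x \<longrightarrow>
      ((\<lambda>k. cinner (a n k) (fock_op x (a n k))) has_sum complex_of_real (c n) * trace (A n \<circ> tensor_op n x)) UNIV)"
    by blast
  then have A: "\<And>n. density_operator (tensor_power K n) (A n)"
    "\<And>n x. contractive x \<Longrightarrow> ((\<lambda>k. cinner (a n k) (fock_op x (a n k))) has_sum
      complex_of_real (c n) * trace (A n \<circ> tensor_op n x)) UNIV"
    by simp_all
  have "(\<lambda>n. complex_of_real (c n) * trace (A n \<circ> tensor_op n u)) sums \<phi> u" if u: "u \<in> unitaries K" for u
  proof (rule has_sum_imp_sums)
    have uc: "contractive u" by (rule unitary_contractive[OF u])
    have "(\<lambda>z. case z of (n, k) \<Rightarrow> cinner (a n k) (fock_op u (a n k))) summable_on UNIV \<times> UNIV"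
      by (rule abs_summable_summable, rule Infinite_Sum.abs_summable_on_comparison_test'[OF has_sum_imp_summable[OF nk]])
        (auto intro: cinner_fock_op_le[OF uc])
    then obtain s where s: "((\<lambda>(n, k). cinner (a n k) (fock_op u (a n k))) has_sum s) (UNIV \<times> UNIV)"
      by (auto simp: summable_on_def)
    have 1: "((\<lambda>n. complex_of_real (c n) * trace (A n \<circ> tensor_op n u)) has_sum s) UNIV"
      by (rule has_sum_SigmaD[OF s]) (simp add: A(2)[OF uc])
    have "((\<lambda>(k, n). cinner (a n k) (fock_op u (a n k))) has_sum s) (UNIV \<times> UNIV)"
      using s by (subst has_sum_swap) (simp add: case_prod_unfold)
    \<comment> \<open>Summing over the degrees first reassembles each \<open>w k\<close>, since
      \<open>length_part n\<close> commutes with second quantization.\<close>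
    then have "((\<lambda>k. cinner (w k) (fock_op u (w k))) has_sum s) UNIV"
      by (rule has_sum_SigmaD)
        (use cinner_length_part_has_sum in \<open>simp add: a_def length_part_fock_op[OF uc wU, symmetric]\<close>)
    then have "s = \<phi> u" using fock_value_has_sum[OF st uc] has_sum_unique val[OF u] by metis
    then show "((\<lambda>n. complex_of_real (c n) * trace (A n \<circ> tensor_op n u)) has_sum \<phi> u) UNIV"
      using 1 by simp
  qed
  then show ?thesis unfolding holomorphic_expansion_def using c0 c1 A(1) by blast
qed

section \<open>Unitaries and contractions\<close>

lemma unitary:
  assumes "u \<in> unitaries K"
  shows unitary_clinear: "bounded_clinear u"
    and cinner_unitary: "cinner (u x) (u y) = cinner x y"
    and norm_unitary: "norm (u x) = norm x"
    and bij_unitary: "bij u"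
    and unitary_orthocomp: "x \<in> orthocomp K \<Longrightarrow> u x = x"
proof -
  show 1: "bounded_clinear u" and c: "cinner (u x) (u y) = cinner x y" and "x \<in> orthocomp K \<Longrightarrow> u x = x" for x y
    using assms by (auto simp: unitaries_def)
  have n: "norm (u x) = norm x" for x
    using c[of x x] by (simp add: cinner_self power2_eq_iff_nonneg flip: of_real_power)
  then show "norm (u x) = norm x" .
  have "x = y" if "u x = u y" for x y
    using n[of "x - y"] that by (simp add: bounded_clinear_diff[OF 1])
  then have "inj u" by (rule injI)
  moreover have "surj u" using assms by (simp add: unitaries_def)
  ultimately show "bij u" by (simp add: bij_def)
qed

lemma norm_eq_1I: "cinner b b = 1 \<Longrightarrow> norm b = 1"
  using Re_cinner_self[of b] abs_square_eq_1[of "norm b"] by simp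

lemma unitaries_mono: "K \<subseteq> L \<Longrightarrow> unitaries K \<subseteq> unitaries L"
  using orthocomp_anti_mono[of K L] unfolding unitaries_def by blast

lemma id_in_unitaries: "id \<in> unitaries K"
  by (simp add: unitaries_def bounded_clinear_id)

lemma unitaries_comp: "u \<in> unitaries K \<Longrightarrow> v \<in> unitaries K \<Longrightarrow> u \<circ> v \<in> unitaries K"
  unfolding unitaries_def mem_Collect_eq
  by (intro conjI bounded_clinear_comp comp_surj) simp_all

lemma unitary_inv_cancel:
  assumes "u \<in> unitaries K"
  shows "u (inv u x) = x" "inv u (u x) = x" "u \<circ> inv u = id" "inv u \<circ> u = id"
  using bij_unitary[OF assms] by (auto simp: bij_def surj_f_inv_f fun_eq_iff)

lemma cinner_unitary_inv: "u \<in> unitaries K \<Longrightarrow> cinner (inv u x) y = cinner x (u y)"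
  by (metis cinner_unitary unitary_inv_cancel(1))

lemma unitaries_inv:
  assumes u: "u \<in> unitaries K"
  shows "inv u \<in> unitaries K"
  unfolding unitaries_def
proof (intro CollectI conjI allI ballI)
  note [simp] = unitary_inv_cancel[OF u]
  have inj: "u x = u y \<Longrightarrow> x = y" for x y using bij_unitary[OF u] by (auto simp: bij_def inj_def)
  show "bounded_clinear (inv u)"
  proof (rule bounded_clinearI[where C = 1])
    show "inv u (x + y) = inv u x + inv u y" for x y
      by (rule inj) (simp add: bounded_clinear_add[OF unitary_clinear[OF u]])
    show "inv u (a *\<^sub>C x) = a *\<^sub>C inv u x" for a x
      by (rule inj) (simp add: bounded_clinear_scaleC[OF unitary_clinear[OF u]])
    show "norm (inv u x) \<le> 1 * norm x" for x
      using norm_unitary[OF u, of "inv u x"] by simp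
  qed
  show "surj (inv u)" using bij_unitary[OF u] by (simp add: bij_betw_inv_into bij_is_surj)
  show "cinner (inv u x) (inv u y) = cinner x y" for x y
    by (simp add: cinner_unitary_inv[OF u])
  show "inv u x = x" if "x \<in> orthocomp K" for x
    by (rule inj) (simp add: unitary_orthocomp[OF u that])
qed

section \<open>Contractions, dilations and reflections\<close>

lemma contraction_contractive: "x \<in> contractions K \<Longrightarrow> contractive x"
  by (simp add: contractions_def contractive_def)

lemma contractions_comp: "x \<in> contractions K \<Longrightarrow> y \<in> contractions K \<Longrightarrow> x \<circ> y \<in> contractions K"
  using contractive_comp[of x y] unfolding contractions_def contractive_def
  by (simp add: image_comp[symmetric]) blast

context closed_complex_subspace
begin

lemma unitary_in: "u \<in> unitaries K \<Longrightarrow> x \<in> K \<Longrightarrow> u x \<in> K"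
proof (rule in_if_orth)
  fix y assume *: "u \<in> unitaries K" "x \<in> K" "y \<in> orthocomp K"
  have "cinner y (u x) = cinner (u y) (u x)" by (simp add: unitary_orthocomp[OF *(1,3)])
  also have "\<dots> = 0" by (simp add: cinner_unitary[OF *(1)] orthocompD'[OF *(3,2)])
  finally show "cinner y (u x) = 0" .
qed

lemma unitaries_subset_contractions: "unitaries K \<subseteq> contractions K"
proof
  fix u assume u: "u \<in> unitaries K"
  have "u ` K \<subseteq> K" using unitary_in[OF u] by blast
  then show "u \<in> contractions K"
    by (simp add: contractions_def unitary_clinear[OF u] norm_unitary[OF u] unitary_orthocomp[OF u])
qed

end

text \<open>The scalar \<open>z\<close> on \<open>G\<close> and the identity on its complement, in a
  form that shows the affine dependence on \<open>z\<close>; this is the source of holomorphy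
  below.\<close>

definition dilate :: "'h::complex_hilbert set \<Rightarrow> complex \<Rightarrow> 'h \<Rightarrow> 'h"
  where "dilate G z = (\<lambda>v. v + (z - 1) *\<^sub>C orth_proj G v)"

context
  fixes G :: "'h::complex_hilbert set"
  assumes G: "closed_complex_subspace G"
begin

interpretation G: closed_complex_subspace G by (rule G)

lemma bounded_clinear_dilate: "bounded_clinear (dilate G z)"
  unfolding dilate_def
  using bounded_clinear_plus[OF bounded_clinear_id
      bounded_clinear_comp[OF bounded_clinear_scaleC_const G.bounded_clinear_proj, of "z - 1"]]
  by (simp add: o_def)

lemma dilate_dilate: "dilate G z (dilate G w v) = dilate G (z * w) v"
proof -
  have "orth_proj G (dilate G w v) = w *\<^sub>C orth_proj G v"
    by (simp add: dilate_def bounded_clinear_add[OF G.bounded_clinear_proj] bounded_clinear_diff[OF G.bounded_clinear_proj] G.proj_fix G.proj_in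
        bounded_clinear_scaleC[OF G.bounded_clinear_proj] complex_vector.scale_left_diff_distrib)
  then show ?thesis
    by (simp add: dilate_def[of G z] scaleC_scaleC) (simp add: dilate_def algebra_simps complex_vector.scale_left_diff_distrib scaleC_scaleC)
qed

lemma dilate_1: "dilate G 1 = id"
  by (simp add: dilate_def fun_eq_iff)

lemma cinner_dilate: "cinner (dilate G z v) (dilate G z w) =
    cinner (v - orth_proj G v) (w - orth_proj G w) + cnj z * z * cinner (orth_proj G v) (orth_proj G w)"
proof -
  have e: "dilate G z v = (v - orth_proj G v) + z *\<^sub>C orth_proj G v" for v
    by (simp add: dilate_def complex_vector.scale_left_diff_distrib)
  show ?thesis unfolding e
    using orthocompD'[OF G.proj_orth[of v] G.proj_in[of w]] orthocompD[OF G.proj_orth[of w] G.proj_in[of v]]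
    by (simp add: cinner_add_left cinner_add_right cinner_scaleC_left cinner_scaleC_right)
qed

lemma dilate_fix: "v \<in> orthocomp G \<Longrightarrow> dilate G z v = v"
  by (simp add: dilate_def G.proj_zero)

lemma dilate_in_G: "v \<in> G \<Longrightarrow> dilate G z v = z *\<^sub>C v"
  by (simp add: dilate_def G.proj_fix complex_vector.scale_left_diff_distrib)

lemma dilate_unitary:
  assumes z: "cmod z = 1" and K: "G \<subseteq> K"
  shows "dilate G z \<in> unitaries K"
  unfolding unitaries_def
proof (intro CollectI conjI allI ballI)
  have z': "cnj z * z = 1" using z complex_norm_square[of z] by (simp add: mult.commute)
  show "surj (dilate G z)"
    by (rule surjI[of _ "dilate G (cnj z)"]) (simp add: dilate_dilate dilate_1 mult.commute[of z] z')
  show "cinner (dilate G z x) (dilate G z y) = cinner x y" for x y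
    using cinner_dilate[of z x y] cinner_dilate[of 1 x y] z' by (simp add: dilate_1)
qed (use K orthocomp_anti_mono dilate_fix bounded_clinear_dilate in blast)+

lemma dilate_contraction:
  assumes z: "cmod z \<le> 1" and K: "G \<subseteq> K" "complex_vector.subspace K"
  shows "dilate G z \<in> contractions K"
  unfolding contractions_def
proof (intro CollectI conjI allI ballI)
  show "norm (dilate G z v) \<le> norm v" for v
  proof -
    let ?p = "orth_proj G v"
    have "complex_of_real ((norm (dilate G z v))\<^sup>2) =
        complex_of_real ((norm (v - ?p))\<^sup>2 + (cmod z)\<^sup>2 * (norm ?p)\<^sup>2)"
      using cinner_dilate[of z v v]
      by (simp add: cinner_self complex_norm_square[unfolded of_real_power] mult.commute[of "cnj z"])
    then have "(norm (dilate G z v))\<^sup>2 = (norm (v - ?p))\<^sup>2 + (cmod z)\<^sup>2 * (norm ?p)\<^sup>2"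
      using of_real_eq_iff by blast
    also have "\<dots> \<le> (norm (v - ?p))\<^sup>2 + 1 * (norm ?p)\<^sup>2"
      using z by (intro add_mono mult_right_mono) (auto simp: power_le_one_iff)
    also have "\<dots> = (norm v)\<^sup>2" using G.norm_proj_square[of v] by simp
    finally show ?thesis by (simp add: abs_le_square_iff[symmetric])
  qed
  show "dilate G z ` K \<subseteq> K"
    unfolding dilate_def using K G.proj_in
    by (auto intro!: complex_vector.subspace_add complex_vector.subspace_scale)
  show "dilate G z v = v" if "v \<in> orthocomp K" for v
    using that K orthocomp_anti_mono dilate_fix by blast
qed (rule bounded_clinear_dilate)

end

text \<open>For a unit vector \<open>e\<close> this is its complex span, and \<open>{0}\<close> if
  \<open>norm e\<close> is not 1. Written as the solution set of an equation, it is visibly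
  closed.\<close>

definition line :: "'h::complex_hilbert \<Rightarrow> 'h set"
  where "line e = {v. v = cinner e v *\<^sub>C e}"

lemma closed_line: "closed (line e)"
  unfolding line_def
  by (intro closed_Collect_eq continuous_intros
      bounded_linear.continuous_on[OF bounded_clinear_bounded_linear[OF bounded_clinear_rank_one[of 1 e e, simplified]]])

lemma closed_complex_subspace_line: "closed_complex_subspace (line e)"
proof
  show "complex_vector.subspace (line e)"
    by (rule complex_vector.subspaceI)
      (auto simp: line_def cinner_add_right cinner_scaleC_right scaleC_add_left simp flip: scaleC_scaleC)
qed (rule closed_line)

lemma orth_proj_line: "norm e = 1 \<Longrightarrow> orth_proj (line e) v = cinner e v *\<^sub>C e"
proof (rule closed_complex_subspace.proj_eqI[OF closed_complex_subspace_line])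
  assume e: "norm e = 1"
  show "cinner e v *\<^sub>C e \<in> line e"
    using e by (simp add: line_def cinner_scaleC_right cinner_self)
  show "v - cinner e v *\<^sub>C e \<in> orthocomp (line e)"
  proof -
    have "cinner y (v - cinner e v *\<^sub>C e) = 0" if y: "y = cinner e y *\<^sub>C e" for y
      by (subst y) (use e in \<open>simp add: cinner_scaleC_left cinner.diff_right cinner_scaleC_right cinner_self\<close>)
    then show ?thesis by (auto simp: orthocomp_def line_def)
  qed
qed

lemma dilate_line: "norm e = 1 \<Longrightarrow> dilate (line e) z v = v + ((z - 1) * cinner e v) *\<^sub>C e"
  by (simp add: dilate_def orth_proj_line scaleC_scaleC)

lemma line_subset:
  assumes "complex_vector.subspace K" "e \<in> K"
  shows "line e \<subseteq> K"
proof
  fix v assume "v \<in> line e"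
  then have "v = cinner e v *\<^sub>C e" by (simp add: line_def)
  then show "v \<in> K" using complex_vector.subspace_scale[OF assms] by metis
qed

text \<open>A phase followed by a Householder reflection.\<close>

lemma unitary_transitive:
  assumes K: "complex_vector.subspace K" and e: "e \<in> K" "norm e = 1" and g: "g \<in> K" "norm g = 1"
  shows "\<exists>u\<in>unitaries K. u e = g"
proof -
  \<comment> \<open>The phase that makes the inner product of \<open>e\<close> with
    \<open>c *\<^sub>C g\<close> real and nonnegative. Two unit vectors are exchanged by a
    reflection only if their inner product is real.\<close>
  define c where "c = (if cinner e g = 0 then 1 else cnj (cinner e g) / complex_of_real (cmod (cinner e g)))"
  have c1: "cmod c = 1" by (simp add: c_def norm_divide)
  have cc: "c * cnj c = 1" using c1 complex_norm_square[of c] by simp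
  define h where "h = c *\<^sub>C g"
  have hn: "norm h = 1" and hK: "h \<in> K" using g c1 by (auto simp: h_def norm_scaleC complex_vector.subspace_scale[OF K])
  have real: "cinner e h = complex_of_real (cmod (cinner e g))"
    using complex_norm_square[of "cinner e g"]
    by (auto simp: h_def c_def cinner_scaleC_right mult.commute power2_eq_square divide_eq_eq)
  have hg: "dilate (line h) (cnj c) h = g"
    by (subst dilate_in_G[OF closed_complex_subspace_line])
      (use hn cc in \<open>simp_all add: line_def cinner_self h_def scaleC_scaleC mult.commute\<close>)
  have u2: "dilate (line h) (cnj c) \<in> unitaries K"
    by (rule dilate_unitary[OF closed_complex_subspace_line]) (use c1 line_subset[OF K hK] in auto)
  show ?thesis
  proof (cases "e = h")
    case True then show ?thesis using hg u2 by blast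
  next
    case False
    define n where "n = norm (e - h)"
    have n0: "n > 0" using False by (simp add: n_def)
    define w where "w = complex_of_real (inverse n) *\<^sub>C (e - h)"
    have wn: "norm w = 1" using n0 by (simp add: w_def norm_scaleC norm_inverse n_def)
    have wK: "w \<in> K" unfolding w_def by (intro complex_vector.subspace_scale[OF K] complex_vector.subspace_diff[OF K] e hK)
    have u1: "dilate (line w) (-1) \<in> unitaries K"
      by (rule dilate_unitary[OF closed_complex_subspace_line]) (use line_subset[OF K wK] in auto)
    have n2: "n\<^sup>2 = 2 - 2 * cmod (cinner e g)"
      unfolding n_def norm_diff_square using real e hn by simp
    have "cinner h e = complex_of_real (cmod (cinner e g))" using real cinner_commute[of h e] by simp
    \<comment> \<open>The component of \<open>e\<close> along \<open>e - h\<close> is half of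
      \<open>e - h\<close>, so the reflection subtracts exactly \<open>e - h\<close> and reaches
      \<open>h\<close>.\<close>
    then have "cinner (e - h) e = complex_of_real (n\<^sup>2 / 2)"
      using e by (simp add: n2 cinner.diff_left cinner_self)
    then have "cinner w e = complex_of_real (inverse n) * complex_of_real (n\<^sup>2 / 2)"
      unfolding w_def cinner_scaleC_left by simp
    then have "(-1 - 1) * cinner w e = complex_of_real (- n)"
      using n0 by (simp add: power2_eq_square field_simps)
    then have "((-1 - 1) * cinner w e) *\<^sub>C w = - (e - h)"
      using n0 by (simp add: w_def scaleC_scaleC del: minus_diff_eq)
    then have "dilate (line w) (-1) e = h"
      unfolding dilate_line[OF wn] by simp
    then have "(dilate (line h) (cnj c) \<circ> dilate (line w) (-1)) e = g" using hg by simp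
    then show ?thesis using unitaries_comp[OF u2 u1] by blast
  qed
qed

section \<open>Finite-dimensional contractions as products\<close>

locale orthonormal_set =
  fixes E :: "'h::complex_hilbert set"
  assumes finite: "finite E"
    and orthonormal: "\<And>b b'. b \<in> E \<Longrightarrow> b' \<in> E \<Longrightarrow> cinner b b' = (if b = b' then 1 else 0)"
begin

lemma span_expansion:
  assumes "v \<in> complex_vector.span E"
  shows "v = (\<Sum>b\<in>E. cinner b v *\<^sub>C b)"
  using assms
proof (induction rule: complex_vector.span_induct_alt)
  case (step c x y)
  have "(\<Sum>b\<in>E. cinner b x *\<^sub>C b) = (\<Sum>b\<in>E. if b = x then b else 0)"
    by (intro sum.cong refl) (simp add: orthonormal step)
  also have "\<dots> = x" using step finite by simp
  finally show ?case
    using step by (simp add: cinner_add_right cinner_scaleC_right scaleC_add_left sum.distrib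
        complex_vector.scale_sum_right[symmetric] flip: scaleC_scaleC)
qed simp

lemma span_eq: "complex_vector.span E = {v. v = (\<Sum>b\<in>E. cinner b v *\<^sub>C b)}"
proof -
  have "(\<Sum>b\<in>E. cinner b v *\<^sub>C b) \<in> complex_vector.span E" for v
    by (intro complex_vector.span_sum complex_vector.span_scale complex_vector.span_base)
  then show ?thesis using span_expansion by (metis (mono_tags, lifting) Collect_cong Collect_mem_eq)
qed

lemma closed_complex_subspace_span: "closed_complex_subspace (complex_vector.span E)"
proof
  show "closed (complex_vector.span E)"
    unfolding span_eq
    by (intro closed_Collect_eq continuous_intros
      bounded_linear.continuous_on[OF bounded_clinear_bounded_linear[OF bounded_clinear_rank_one[of 1, simplified]]])
qed simp

text \<open>A compact set containing the unit sphere of the span; closed balls of the ambient space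
  need not be compact. The induction adds one disc of coefficients at a time.\<close>

lemma compact_coefficients: "compact {\<Sum>b\<in>E. c b *\<^sub>C b |c. \<forall>b\<in>E. cmod (c b) \<le> 1}"
proof -
  have "compact {\<Sum>b\<in>S. c b *\<^sub>C b |c. \<forall>b\<in>S. cmod (c b) \<le> 1}" if "finite S" for S :: "'h set"
    using that
  proof (induction S)
    case (insert e S)
    let ?T = "\<lambda>S. {\<Sum>b\<in>S. c b *\<^sub>C b |c. \<forall>b\<in>S. cmod (c b) \<le> 1}"
    have "?T (insert e S) = (\<lambda>(c, v). c *\<^sub>C e + v) ` (cball 0 1 \<times> ?T S)"
    proof (intro equalityI subsetI)
      fix v assume "v \<in> ?T (insert e S)"
      then obtain c where c: "v = (\<Sum>b\<in>insert e S. c b *\<^sub>C b)" "\<forall>b\<in>insert e S. cmod (c b) \<le> 1" by blast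
      then show "v \<in> (\<lambda>(c, v). c *\<^sub>C e + v) ` (cball 0 1 \<times> ?T S)"
        using insert by (intro image_eqI[of _ _ "(c e, \<Sum>b\<in>S. c b *\<^sub>C b)"]) auto
    next
      fix v assume "v \<in> (\<lambda>(c, v). c *\<^sub>C e + v) ` (cball 0 1 \<times> ?T S)"
      then obtain a c where c: "v = a *\<^sub>C e + (\<Sum>b\<in>S. c b *\<^sub>C b)" "cmod a \<le> 1" "\<forall>b\<in>S. cmod (c b) \<le> 1" by auto
      have "(\<Sum>b\<in>S. (c(e := a)) b *\<^sub>C b) = (\<Sum>b\<in>S. c b *\<^sub>C b)"
        using insert by (intro sum.cong) auto
      then show "v \<in> ?T (insert e S)"
        using insert c by (intro CollectI exI[of _ "c(e := a)"]) auto
    qed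
    moreover have "continuous_on (cball 0 1 \<times> ?T S) (\<lambda>(c, v). c *\<^sub>C e + v)"
      unfolding case_prod_unfold
      by (intro continuous_intros bounded_bilinear.continuous_on[OF bounded_bilinear_scaleC])
    ultimately show ?case
      using insert.IH by (auto intro!: compact_continuous_image compact_Times)
  qed simp
  then show ?thesis using finite by blast
qed

text \<open>The norm of \<open>x\<close> attains its maximum on the unit sphere of the span, which
  is a closed part of \<open>compact_coefficients\<close>. This gives the first singular
  vector.\<close>

lemma maximal_vector:
  assumes x: "bounded_clinear x" and ne: "E \<noteq> {}"
  shows "\<exists>e\<in>complex_vector.span E. norm e = 1 \<and> (\<forall>v\<in>complex_vector.span E. norm (x v) \<le> norm (x e) * norm v)"
proof -
  interpret L: closed_complex_subspace "complex_vector.span E" by (rule closed_complex_subspace_span)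
  let ?S = "complex_vector.span E \<inter> sphere 0 1"
  have "?S \<subseteq> {\<Sum>b\<in>E. c b *\<^sub>C b |c. \<forall>b\<in>E. cmod (c b) \<le> 1}"
  proof
    fix v assume v: "v \<in> ?S"
    have "cmod (cinner b v) \<le> 1" if "b \<in> E" for b
    proof -
      have "norm b = 1" using orthonormal[OF that that] by (intro norm_eq_1I) simp
      then show ?thesis using cinner_Cauchy_Schwarz[of b v] v by simp
    qed
    then show "v \<in> {\<Sum>b\<in>E. c b *\<^sub>C b |c. \<forall>b\<in>E. cmod (c b) \<le> 1}"
      using span_expansion[of v] v by auto
  qed
  moreover have "closed {v::'h. norm v = 1}" by (intro closed_Collect_eq continuous_intros)
  then have "closed (sphere 0 1 :: 'h set)" by (simp add: sphere_def)
  then have "closed ?S" by (intro closed_Int L.closed)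
  ultimately have "compact ?S"
    using compact_Int_closed[OF compact_coefficients, of ?S] by (simp only: Int_absorb1)
  moreover obtain b where "b \<in> E" using ne by blast
  then have "b \<in> ?S" using orthonormal[of b b] by (simp add: norm_eq_1I complex_vector.span_base)
  moreover have "continuous_on ?S (\<lambda>v. norm (x v))"
    by (intro continuous_intros bounded_clinear_continuous_on x)
  ultimately obtain e where e: "e \<in> ?S" "\<And>v. v \<in> ?S \<Longrightarrow> norm (x v) \<le> norm (x e)"
    using continuous_attains_sup[of ?S "\<lambda>v. norm (x v)"] by blast
  have "norm (x v) \<le> norm (x e) * norm v" if v: "v \<in> complex_vector.span E" for v
  proof (cases "v = 0")
    case False
    let ?v = "complex_of_real (inverse (norm v)) *\<^sub>C v"
    have "?v \<in> ?S" using v False by (simp add: complex_vector.span_scale norm_scaleC norm_inverse)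
    from e(2)[OF this] show ?thesis
      using False by (simp add: bounded_clinear_scaleC[OF x] norm_scaleC norm_inverse norm_divide divide_simps mult.commute)
  qed (simp add: bounded_clinear_zero[OF x])
  then show ?thesis using e(1) by auto
qed

end

text \<open>Dilations enter as outermost factors only. The rules for unitaries on both sides undo
  the rotations that bring a singular vector and its image to a prescribed basis vector.\<close>

inductive_set factorizable :: "'h::complex_hilbert set \<Rightarrow> ('h \<Rightarrow> 'h) set" for K where
  unitary: "u \<in> unitaries K \<Longrightarrow> u \<in> factorizable K"
| dilate: "x \<in> factorizable K \<Longrightarrow> e \<in> K \<Longrightarrow> norm e = 1 \<Longrightarrow> cmod z \<le> 1 \<Longrightarrow>
    dilate (line e) z \<circ> x \<in> factorizable K"
| left: "u \<in> unitaries K \<Longrightarrow> x \<in> factorizable K \<Longrightarrow> u \<circ> x \<in> factorizable K"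
| right: "u \<in> unitaries K \<Longrightarrow> x \<in> factorizable K \<Longrightarrow> x \<circ> u \<in> factorizable K"

text \<open>Singular value decomposition, by induction on the dimension.\<close>

lemma contraction_factorizable:
  fixes E :: "'h::complex_hilbert set"
  assumes "finite E" "\<And>b b'. b \<in> E \<Longrightarrow> b' \<in> E \<Longrightarrow> cinner b b' = (if b = b' then 1 else 0)"
    and "complex_vector.span E \<subseteq> K" "x \<in> contractions (complex_vector.span E)"
  shows "x \<in> factorizable K"
  using assms
\<comment> \<open>\<open>K\<close> stays fixed while \<open>E\<close> shrinks: unitaries of the
  smaller spans are unitaries of \<open>K\<close>, so factors from all stages can be
  composed.\<close>
proof (induction E arbitrary: x)
  case empty
  then have "x = id" by (auto simp: contractions_def orthocomp_def)
  then show ?case by (simp only: factorizable.unitary id_in_unitaries)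
next
  case (insert e1 E)
  interpret orthonormal_set "insert e1 E" using insert by unfold_locales auto
  interpret E: orthonormal_set E using insert by unfold_locales auto
  let ?L = "complex_vector.span (insert e1 E)"
  interpret L: closed_complex_subspace ?L by (rule closed_complex_subspace_span)
  note subL = complex_vector.subspace_span[of "insert e1 E"]
  have LK: "?L \<subseteq> K" by (rule insert.prems(2))
  have UK: "unitaries ?L \<subseteq> unitaries K" by (rule unitaries_mono[OF LK])
  have EL: "complex_vector.span E \<subseteq> ?L" by (intro complex_vector.span_mono) auto
  have e1: "e1 \<in> ?L" "cinner e1 e1 = 1" "norm e1 = 1"
    using orthonormal[of e1 e1] by (auto simp: complex_vector.span_base norm_eq_1I)
  have xlin: "bounded_clinear x" and xL: "\<And>v. v \<in> ?L \<Longrightarrow> x v \<in> ?L"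
    using insert.prems(3) by (auto simp: contractions_def)
  obtain e where e: "e \<in> ?L" "norm e = 1" "\<And>v. v \<in> ?L \<Longrightarrow> norm (x v) \<le> norm (x e) * norm v"
    using maximal_vector[OF xlin] by blast
  define s where "s = norm (x e)"
  have s: "0 \<le> s" "s \<le> 1" using insert.prems(3) e(2) by (auto simp: s_def contractions_def)
      (metis)
  \<comment> \<open>The direction of \<open>x e\<close>. If \<open>x e = 0\<close>, any unit vector
    serves.\<close>
  obtain g where g: "g \<in> ?L" "norm g = 1" "x e = complex_of_real s *\<^sub>C g"
  proof (cases "s = 0")
    case True then show ?thesis using that[OF e1(1,3)] by (simp add: s_def)
  next
    case False
    then show ?thesis
      using that[of "complex_of_real (inverse s) *\<^sub>C x e"] xL[OF e(1)]
      by (simp add: complex_vector.span_scale norm_scaleC norm_inverse scaleC_scaleC s_def)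
  qed
  \<comment> \<open>After rotating by \<open>u1\<close> and \<open>u2\<close>, the vector
    \<open>e1\<close> is a maximal vector and at the same time an eigenvector for
    \<open>s\<close>.\<close>
  obtain u1 where u1: "u1 \<in> unitaries ?L" "u1 e1 = e" using unitary_transitive[OF subL e1(1,3) e(1,2)] by blast
  obtain u2 where u2: "u2 \<in> unitaries ?L" "u2 g = e1" using unitary_transitive[OF subL g(1,2) e1(1,3)] by blast
  define y where "y = u2 \<circ> x \<circ> u1"
  have y: "y \<in> contractions ?L"
    unfolding y_def using L.unitaries_subset_contractions u1 u2 insert.prems(3)
    by (intro contractions_comp) auto
  have ylin: "bounded_clinear y" and yL: "\<And>v. v \<in> ?L \<Longrightarrow> y v \<in> ?L" and yc: "\<And>v. norm (y v) \<le> norm v"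
    and yo: "\<And>v. v \<in> orthocomp ?L \<Longrightarrow> y v = v"
    using y by (auto simp: contractions_def)
  have ye1: "y e1 = complex_of_real s *\<^sub>C e1"
    by (simp add: y_def u1 g bounded_clinear_scaleC[OF unitary_clinear[OF u2(1)]] u2)
  have ymax: "norm (y v) \<le> s * norm v" if "v \<in> ?L" for v
    using e(3)[OF L.unitary_in[OF u1(1) that]]
    by (simp add: y_def norm_unitary[OF u2(1)] norm_unitary[OF u1(1)] s_def)
  \<comment> \<open>If \<open>y v\<close> had a component along \<open>e1\<close>, then
    \<open>e1 + a *\<^sub>C v\<close> with a suitable small \<open>a\<close> would be stretched by
    more than \<open>s\<close>, to first order in \<open>a\<close>.\<close>
  have orthL: "cinner e1 (y v) = 0" if v: "v \<in> ?L" "cinner e1 v = 0" for v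
  proof (cases "s = 0")
    case True then show ?thesis using ymax[OF v(1)] by simp
  next
    case False
    let ?p = "cinner e1 (y v)"
    have ineq: "2 * s * Re (a * ?p) \<le> (cmod a)\<^sup>2 * (s * norm v)\<^sup>2" for a
    proof -
      have "norm (y (e1 + a *\<^sub>C v)) \<le> s * norm (e1 + a *\<^sub>C v)"
        by (intro ymax complex_vector.span_add complex_vector.span_scale e1 v)
      then have "(norm (y (e1 + a *\<^sub>C v)))\<^sup>2 \<le> (s * norm (e1 + a *\<^sub>C v))\<^sup>2"
        by (intro power_mono) auto
      moreover have "(norm (y (e1 + a *\<^sub>C v)))\<^sup>2 = s\<^sup>2 + (cmod a * norm (y v))\<^sup>2 + 2 * (s * Re (a * ?p))"
        using s by (simp add: bounded_clinear_add[OF ylin] bounded_clinear_scaleC[OF ylin] ye1 norm_add_square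
            norm_scaleC e1 cinner_scaleC_left cinner_scaleC_right) (simp add: algebra_simps)
      moreover have "(s * norm (e1 + a *\<^sub>C v))\<^sup>2 = s\<^sup>2 * (1 + (cmod a * norm v)\<^sup>2)"
        using v(2) by (simp add: norm_add_square norm_scaleC e1 cinner_scaleC_right power_mult_distrib)
      moreover have "(cmod a * norm (y v))\<^sup>2 \<ge> 0" by simp
      moreover have "s\<^sup>2 * (1 + (cmod a * norm v)\<^sup>2) = s\<^sup>2 + (cmod a)\<^sup>2 * (s * norm v)\<^sup>2"
        by (simp add: power_mult_distrib algebra_simps)
      ultimately show ?thesis by linarith
    qed
    show ?thesis
    proof (rule ccontr)
      assume p: "?p \<noteq> 0"
      \<comment> \<open>Makes \<open>t * (s * (norm v)\<^sup>2)\<close> less than 1, so the second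
        order term cannot match the first order one.\<close>
      define t where "t = 1 / (s * (norm v)\<^sup>2 + 1)"
      have t: "t > 0" "t * (s * (norm v)\<^sup>2) < 1" using s by (auto simp: t_def add_nonneg_pos divide_less_eq)
      have sp: "s * t * (cmod ?p)\<^sup>2 > 0" using False s t p by simp
      have "Re (complex_of_real t * cnj ?p * ?p) = t * (cmod ?p)\<^sup>2"
        unfolding cmod_power2 by (simp add: power2_eq_square algebra_simps)
      then have "2 * (s * t * (cmod ?p)\<^sup>2) \<le> s * t * (cmod ?p)\<^sup>2 * (t * (s * (norm v)\<^sup>2))"
        using ineq[of "complex_of_real t * cnj ?p"] t
        by (simp add: norm_mult power_mult_distrib) (simp add: power2_eq_square mult_ac)
      also have "\<dots> \<le> s * t * (cmod ?p)\<^sup>2 * 1"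
        using sp t by (intro mult_left_mono) auto
      finally show False using sp by simp
    qed
  qed
  have orth: "cinner e1 (y v) = 0" if v: "cinner e1 v = 0" for v
  proof -
    let ?p = "orth_proj ?L v"
    have o: "v - ?p \<in> orthocomp ?L" by (rule L.proj_orth)
    have 0: "cinner e1 (v - ?p) = 0" by (rule orthocompD[OF o e1(1)])
    then have "cinner e1 ?p = 0" using v by (simp add: cinner.diff_right)
    then have "cinner e1 (y ?p) = 0" by (rule orthL[OF L.proj_in])
    moreover have "cinner e1 (y (v - ?p)) = 0" using 0 by (simp add: yo[OF o])
    ultimately show ?thesis by (simp add: bounded_clinear_diff[OF ylin] cinner.diff_right)
  qed
  \<comment> \<open>\<open>y\<close> with its eigenvalue \<open>s\<close> at \<open>e1\<close>
    replaced by 1. Since \<open>y\<close> preserves the complement of \<open>e1\<close>, this is a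
    contraction of the span of \<open>E\<close>, and dilating the line of \<open>e1\<close> by
    \<open>s\<close> recovers \<open>y\<close>.\<close>
  define x' where "x' v = y (v - cinner e1 v *\<^sub>C e1) + cinner e1 v *\<^sub>C e1" for v
  have q: "cinner e1 (v - cinner e1 v *\<^sub>C e1) = 0" for v
    by (simp add: cinner.diff_right cinner_scaleC_right e1)
  have yx': "y = dilate (line e1) (complex_of_real s) \<circ> x'"
  proof
    fix v
    have "y v = y (v - cinner e1 v *\<^sub>C e1) + cinner e1 v *\<^sub>C y e1"
      by (simp add: bounded_clinear_diff[OF ylin] bounded_clinear_scaleC[OF ylin])
    then show "y v = (dilate (line e1) (complex_of_real s) \<circ> x') v"
      by (simp add: dilate_line[OF e1(3)] x'_def cinner_add_right orth[OF q] cinner_scaleC_right e1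
          ye1 scaleC_scaleC) (simp add: algebra_simps complex_vector.scale_left_diff_distrib)
  qed
  have "x' \<in> contractions (complex_vector.span E)"
    unfolding contractions_def
  proof (intro CollectI conjI allI ballI)
    have "bounded_clinear (\<lambda>v. cinner e1 v *\<^sub>C e1)" using bounded_clinear_rank_one[of 1 e1 e1] by simp
    then show "bounded_clinear x'"
      using bounded_clinear_plus[OF bounded_clinear_comp[OF ylin bounded_clinear_minus[OF bounded_clinear_id]]]
      unfolding x'_def[abs_def] by (simp add: o_def)
    show "norm (x' v) \<le> norm v" for v
    proof -
      let ?q = "v - cinner e1 v *\<^sub>C e1"
      have "cinner (y ?q) (cinner e1 v *\<^sub>C e1) = 0"
        using orth[OF q[of v]] cinner_commute[of "y ?q" e1] by (simp add: cinner_scaleC_right)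
      then have "(norm (x' v))\<^sup>2 = (norm (y ?q))\<^sup>2 + (norm (cinner e1 v *\<^sub>C e1))\<^sup>2"
        by (simp add: x'_def norm_add_square)
      also have "\<dots> \<le> (norm ?q)\<^sup>2 + (norm (cinner e1 v *\<^sub>C e1))\<^sup>2"
        by (intro add_mono power_mono yc) auto
      also have "cinner ?q (cinner e1 v *\<^sub>C e1) = 0"
        using q[of v] cinner_commute[of ?q e1] by (simp add: cinner_scaleC_right)
      then have "(norm ?q)\<^sup>2 + (norm (cinner e1 v *\<^sub>C e1))\<^sup>2 = (norm v)\<^sup>2"
        using norm_add_square[of ?q "cinner e1 v *\<^sub>C e1"] by simp
      finally show ?thesis by (simp add: abs_le_square_iff[symmetric])
    qed
    have E1: "cinner e1 v = 0" if "v \<in> complex_vector.span E" for v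
    proof -
      have "cinner v e1 = 0"
        using that by (rule cinner_span_eq_0) (use orthonormal[of _ e1] insert.hyps in auto)
      then show ?thesis using cinner_commute[of e1 v] by simp
    qed
    show "x' ` complex_vector.span E \<subseteq> complex_vector.span E"
    proof (intro image_subsetI)
      fix v assume v: "v \<in> complex_vector.span E"
      have vL: "v \<in> ?L" using v EL by blast
      have "x' v = y v" by (simp add: x'_def E1[OF v])
      moreover have "cinner e1 (y v) = 0" by (rule orth[OF E1[OF v]])
      then have "y v = (\<Sum>b\<in>E. cinner b (y v) *\<^sub>C b)"
        using span_expansion[OF yL[OF vL]] insert.hyps by simp
      then have "y v \<in> complex_vector.span E" unfolding E.span_eq by blast
      ultimately show "x' v \<in> complex_vector.span E" by simp
    qed
    show "x' v = v" if v: "v \<in> orthocomp (complex_vector.span E)" for v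
    proof -
      let ?q = "v - cinner e1 v *\<^sub>C e1"
      have "cinner b ?q = 0" if "b \<in> insert e1 E" for b
      proof (cases "b = e1")
        case False
        then have "b \<in> E" using that by simp
        then show ?thesis
          using orthocompD[OF v complex_vector.span_base] orthonormal[of b e1] False
          by (simp add: cinner.diff_right cinner_scaleC_right)
      qed (simp add: q)
      then have "?q \<in> orthocomp ?L"
        by (auto simp: orthocomp_def intro: cinner_span_eq_0)
      then show ?thesis by (simp add: x'_def yo)
    qed
  qed
  then have "x' \<in> factorizable K"
    using insert.prems EL by (intro insert.IH) auto
  then have "y \<in> factorizable K"
    unfolding yx' using e1 LK s by (intro factorizable.dilate) auto
  then have "inv u2 \<circ> y \<circ> inv u1 \<in> factorizable K"
    using UK unitaries_inv[OF u1(1)] unitaries_inv[OF u2(1)]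
    by (intro factorizable.left factorizable.right) auto
  moreover have "inv u2 \<circ> y \<circ> inv u1 = x"
    by (simp add: y_def fun_eq_iff unitary_inv_cancel[OF u1(1)] unitary_inv_cancel[OF u2(1)])
  ultimately show ?case by simp
qed

text \<open>A contraction is reached from unitaries by inserting dilations. For
  \<open>cmod z = 1\<close> such a dilation is unitary, and the maximum principle carries the
  vanishing into the disc.\<close>

lemma vanish_on_contractions:
  fixes D :: "('h::complex_hilbert \<Rightarrow> 'h) \<Rightarrow> complex"
  assumes E: "orthonormal_set E"
    and hol: "\<And>a b e. a \<in> contractions (complex_vector.span E) \<Longrightarrow> b \<in> contractions (complex_vector.span E) \<Longrightarrow>
      e \<in> complex_vector.span E \<Longrightarrow> norm e = 1 \<Longrightarrow>
      continuous_on (cball 0 1) (\<lambda>z. D (a \<circ> dilate (line e) z \<circ> b)) \<and>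
      (\<lambda>z. D (a \<circ> dilate (line e) z \<circ> b)) holomorphic_on ball 0 1"
    and zero: "\<And>u. u \<in> unitaries (complex_vector.span E) \<Longrightarrow> D u = 0"
    and x: "x \<in> contractions (complex_vector.span E)"
  shows "D x = 0"
proof -
  interpret orthonormal_set E by (rule E)
  let ?K = "complex_vector.span E"
  interpret K: closed_complex_subspace ?K by (rule closed_complex_subspace_span)
  have idc: "id \<in> contractions ?K" using K.unitaries_subset_contractions id_in_unitaries by blast
  have "x \<in> factorizable ?K"
    by (rule contraction_factorizable[OF finite orthonormal _ x]) auto
  \<comment> \<open>The left factor \<open>a\<close> is quantified because an outermost dilation of
    \<open>x\<close> has to be moved into it before the induction hypothesis applies.\<close>
  then have "\<forall>a\<in>contractions ?K. (\<forall>u\<in>unitaries ?K. D (a \<circ> u) = 0) \<longrightarrow> (\<forall>u\<in>unitaries ?K. D (a \<circ> x \<circ> u) = 0)"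
  proof induction
    case (unitary u)
    then show ?case using unitaries_comp[of u] by (simp only: comp_assoc) blast
  next
    case (dilate x e z)
    show ?case
    proof (intro ballI impI)
      fix a u assume a: "a \<in> contractions ?K" and D0: "\<forall>u\<in>unitaries ?K. D (a \<circ> u) = 0" and u: "u \<in> unitaries ?K"
      have sub: "line e \<subseteq> ?K" by (rule line_subset[OF K.subspace dilate.hyps(2)])
      \<comment> \<open>With a unitary right factor the whole circle is covered by the assumption on
        \<open>a\<close>; this establishes the same assumption for
        \<open>a \<circ> dilate (line e) z\<close>.\<close>
      have "D (a \<circ> dilate (line e) z \<circ> v) = 0" if v: "v \<in> unitaries ?K" for v
      proof -
        let ?h = "\<lambda>z. D (a \<circ> dilate (line e) z \<circ> v)"
        have h: "continuous_on (cball 0 1) ?h \<and> ?h holomorphic_on ball 0 1"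
          using hol[OF a _ dilate.hyps(2,3)] v K.unitaries_subset_contractions by blast
        have "norm (?h z) \<le> 0"
        proof (rule maximum_modulus_frontier[of ?h "cball 0 1"])
          show "?h holomorphic_on interior (cball 0 1)" "continuous_on (closure (cball 0 1)) ?h"
            using h by auto
          show "z \<in> cball 0 1" using dilate.hyps(4) by simp
          fix w :: complex assume "w \<in> frontier (cball 0 1)"
          then have "cmod w = 1" by (simp add: frontier_def)
          then have "dilate (line e) w \<circ> v \<in> unitaries ?K"
            by (intro unitaries_comp dilate_unitary[OF closed_complex_subspace_line] sub v)
          then have "?h w = 0" using D0 by (simp only: comp_assoc)
          then show "norm (?h w) \<le> 0" by simp
        qed simp
        then show ?thesis by simp
      qed
      moreover have "a \<circ> dilate (line e) z \<in> contractions ?K"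
        by (intro contractions_comp a dilate_contraction[OF closed_complex_subspace_line] sub K.subspace dilate.hyps(4))
      ultimately have "D ((a \<circ> dilate (line e) z) \<circ> x \<circ> u) = 0" using dilate.IH u by blast
      then show "D (a \<circ> (dilate (line e) z \<circ> x) \<circ> u) = 0" by (simp only: comp_assoc)
    qed
  next
    case (left v x)
    show ?case
    proof (intro ballI impI)
      fix a u assume a: "a \<in> contractions ?K" and D0: "\<forall>u\<in>unitaries ?K. D (a \<circ> u) = 0" and u: "u \<in> unitaries ?K"
      have "a \<circ> v \<in> contractions ?K" using contractions_comp[OF a] left.hyps(1) K.unitaries_subset_contractions by blast
      moreover have "\<forall>u\<in>unitaries ?K. D (a \<circ> v \<circ> u) = 0"
        using D0 unitaries_comp[OF left.hyps(1)] by (simp only: comp_assoc) blast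
      ultimately have "D ((a \<circ> v) \<circ> x \<circ> u) = 0" using left.IH u by blast
      then show "D (a \<circ> (v \<circ> x) \<circ> u) = 0" by (simp only: comp_assoc)
    qed
  next
    case (right v x)
    show ?case
    proof (intro ballI impI)
      fix a u assume "a \<in> contractions ?K" "\<forall>u\<in>unitaries ?K. D (a \<circ> u) = 0" "u \<in> unitaries ?K"
      then have "D (a \<circ> x \<circ> (v \<circ> u)) = 0"
        using right.IH unitaries_comp[OF right.hyps(1)] by blast
      then show "D (a \<circ> (x \<circ> v) \<circ> u) = 0" by (simp only: comp_assoc)
    qed
  qed
  then have "(\<forall>u\<in>unitaries ?K. D (id \<circ> u) = 0) \<longrightarrow> (\<forall>u\<in>unitaries ?K. D (id \<circ> x \<circ> u) = 0)"
    using idc by blast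
  then have "\<forall>u\<in>unitaries ?K. D (x \<circ> u) = 0" using zero by (simp add: id_comp del: comp_apply)
  then have "D (x \<circ> id) = 0" using id_in_unitaries by blast
  then show ?thesis by (simp only: comp_id)
qed

section \<open>Dependence on the operator\<close>

text \<open>One approximation argument for two kinds of regularity: \<open>P\<close> will be
  continuity on the closed disc with holomorphy inside, and strong continuity on a unitary group. In
  both cases matrix coefficients of \<open>xp p\<close> belong to the class.\<close>

context
  fixes P :: "('p \<Rightarrow> complex) \<Rightarrow> bool" and X :: "'p set" and xp :: "'p \<Rightarrow> 'h::complex_hilbert \<Rightarrow> 'h"
  assumes contr: "\<And>p. p \<in> X \<Longrightarrow> contractive (xp p)"
    and const: "\<And>c. P (\<lambda>p. c)"
    and add: "\<And>f g. P f \<Longrightarrow> P g \<Longrightarrow> P (\<lambda>p. f p + g p)"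
    and mult: "\<And>f g. P f \<Longrightarrow> P g \<Longrightarrow> P (\<lambda>p. f p * g p)"
    and lim: "\<And>f g. (\<And>n. P (f n)) \<Longrightarrow> uniform_limit X f g sequentially \<Longrightarrow> P g"
    and coef: "\<And>v w. P (\<lambda>p. cinner v (xp p w))"
begin

text \<open>\<open>P\<close> only sees values on \<open>X\<close>: there \<open>g\<close> is the
  uniform limit of the constant sequence \<open>f\<close>.\<close>

lemma closed_class_cong: "P f \<Longrightarrow> (\<And>p. p \<in> X \<Longrightarrow> f p = g p) \<Longrightarrow> P g"
  by (rule lim[of "\<lambda>_. f"]) (auto simp: uniform_limit_iff)

lemma closed_class_lim:
  assumes "\<And>n. P (f n)" "\<And>n p. p \<in> X \<Longrightarrow> cmod (f n p - g p) \<le> b n" "b \<longlonglongrightarrow> 0"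
  shows "P g"
proof (rule lim[OF assms(1)])
  show "uniform_limit X f g sequentially"
    unfolding uniform_limit_iff
  proof (intro allI impI)
    fix e :: real assume "e > 0"
    then have "\<forall>\<^sub>F n in sequentially. b n < e" using assms(3) by (simp add: order_tendsto_iff)
    then show "\<forall>\<^sub>F n in sequentially. \<forall>p\<in>X. dist (f n p) (g p) < e"
      by eventually_elim (use assms(2) in \<open>auto simp: dist_norm intro: le_less_trans\<close>)
  qed
qed

lemma closed_class_simple_tensor: "P (\<lambda>p. cinner (simple_tensor vs) (simple_tensor (map (xp p) ws)))"
proof (induction vs arbitrary: ws)
  case Nil
  then show ?case by (cases ws) (simp_all add: const)
next
  case (Cons v vs)
  then show ?case by (cases ws) (simp_all add: const mult coef)
qed

lemma closed_class_span:
  assumes v: "v \<in> complex_vector.span (simple_tensor ` {vs. set vs \<subseteq> UNIV})"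
    and w: "w \<in> complex_vector.span (simple_tensor ` {vs. set vs \<subseteq> UNIV})"
  shows "P (\<lambda>p. cinner v (fock_op (xp p) w))"
  using w
proof (induction rule: complex_vector.span_induct_alt)
  case base
  show ?case
    by (rule closed_class_cong[OF const[of 0]])
      (simp add: bounded_clinear_zero[OF bounded_clinear_fock_op[OF contr]])
next
  case (step c x y)
  then obtain ws where ws: "x = simple_tensor ws" by blast
  have "P (\<lambda>p. cinner v (fock_op (xp p) x))"
    using v
  proof (induction rule: complex_vector.span_induct_alt)
    case base show ?case by (simp add: const)
  next
    case (step a s t)
    then obtain vs where s: "s = simple_tensor vs" by blast
    have "P (\<lambda>p. cnj a * cinner (simple_tensor vs) (simple_tensor (map (xp p) ws)) + cinner t (fock_op (xp p) x))"
      by (intro add mult const closed_class_simple_tensor step.IH)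
    then show ?case
      by (rule closed_class_cong)
        (simp add: s ws cinner_add_left cinner_scaleC_left fock_op_simple_tensor[OF contr])
  qed
  then have "P (\<lambda>p. c * cinner v (fock_op (xp p) x) + cinner v (fock_op (xp p) y))"
    by (intro add mult const step.IH)
  then show ?case
    by (rule closed_class_cong)
      (simp add: bounded_clinear_add[OF bounded_clinear_fock_op[OF contr]]
        bounded_clinear_scaleC[OF bounded_clinear_fock_op[OF contr]] cinner_add_right cinner_scaleC_right)
qed

text \<open>Algebraic tensors approximate \<open>w\<close>, and the error is uniform in
  \<open>p\<close> because every \<open>fock_op (xp p)\<close> is a contraction.\<close>

lemma closed_class_fock:
  assumes w: "w \<in> fock UNIV"
  shows "P (\<lambda>p. cinner w (fock_op (xp p) w))"
proof -
  obtain v where v: "\<And>n. v n \<in> complex_vector.span (simple_tensor ` {vs. set vs \<subseteq> (UNIV :: 'h set)})" "v \<longlonglongrightarrow> w"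
    using w unfolding fock_def closure_sequential by blast
  show ?thesis
  proof (rule closed_class_lim[OF closed_class_span[OF v(1) v(1)]])
    have "(\<lambda>n. norm (v n - w) * norm (v n) + norm w * norm (v n - w)) \<longlonglongrightarrow> norm (w - w) * norm w + norm w * norm (w - w)"
      by (intro tendsto_intros v)
    then show "(\<lambda>n. norm (v n - w) * norm (v n) + norm w * norm (v n - w)) \<longlonglongrightarrow> 0" by simp
    fix n p assume p: "p \<in> X"
    let ?T = "fock_op (xp p)"
    have "cinner (v n) (?T (v n)) - cinner w (?T w) = cinner (v n - w) (?T (v n)) + cinner w (?T (v n - w))"
      by (simp add: bounded_clinear_diff[OF bounded_clinear_fock_op[OF contr[OF p]]] cinner.diff_left cinner.diff_right)
    also have "cmod \<dots> \<le> norm (v n - w) * norm (?T (v n)) + norm w * norm (?T (v n - w))"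
      by (rule order_trans[OF norm_triangle_ineq add_mono[OF cinner_Cauchy_Schwarz cinner_Cauchy_Schwarz]])
    also have "\<dots> \<le> norm (v n - w) * norm (v n) + norm w * norm (v n - w)"
      by (intro add_mono mult_left_mono norm_fock_op contr p) auto
    finally show "cmod (cinner (v n) (?T (v n)) - cinner w (?T w)) \<le> norm (v n - w) * norm (v n) + norm w * norm (v n - w)" .
  qed
qed

text \<open>The series converges uniformly by the Weierstrass test, with the squared norms of the
  \<open>w k\<close> as majorants.\<close>

lemma closed_class_fock_value:
  assumes st: "fock_state K w"
  shows "P (\<lambda>p. fock_value w (xp p))"
proof -
  have wU: "w k \<in> fock UNIV" for k using st fock_mono[of K UNIV] by (auto simp: fock_state_def)
  let ?f = "\<lambda>k p. cinner (w k) (fock_op (xp p) (w k))"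
  have "P (\<lambda>p. \<Sum>k<n. ?f k p)" for n
    by (induction n) (simp_all add: const add closed_class_fock[OF wU])
  moreover have "uniform_limit X (\<lambda>n p. \<Sum>k<n. ?f k p) (\<lambda>p. \<Sum>k. ?f k p) sequentially"
  proof (rule Weierstrass_m_test)
    show "norm (?f k p) \<le> (norm (w k))\<^sup>2" if "p \<in> X" for k p
      by (rule cinner_fock_op_le[OF contr[OF that]])
    show "summable (\<lambda>k. (norm (w k))\<^sup>2)"
      using st has_sum_imp_sums sums_summable by (auto simp: fock_state_def)
  qed
  ultimately have "P (\<lambda>p. \<Sum>k. ?f k p)" by (rule lim)
  then show ?thesis
    by (rule closed_class_cong)
      (rule sums_unique[OF has_sum_imp_sums[OF fock_value_has_sum[OF st contr]], symmetric])
qed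

end

lemma fock_value_holomorphic:
  assumes st: "fock_state K w" and L: "complex_vector.subspace L" and e: "e \<in> L" "norm e = 1"
    and a: "a \<in> contractions L" and b: "b \<in> contractions L"
  shows "continuous_on (cball 0 1) (\<lambda>z. fock_value w (a \<circ> dilate (line e) z \<circ> b)) \<and>
    (\<lambda>z. fock_value w (a \<circ> dilate (line e) z \<circ> b)) holomorphic_on ball 0 1"
proof (rule closed_class_fock_value[OF _ _ _ _ _ _ st, of "cball 0 1"])
  fix z :: complex assume "z \<in> cball 0 1"
  then show "contractive (a \<circ> dilate (line e) z \<circ> b)"
    by (intro contractive_comp contraction_contractive[OF a] contraction_contractive[OF b]
        contraction_contractive[OF dilate_contraction[OF closed_complex_subspace_line _ line_subset[OF L e(1)] L]]) simp
next
  fix f g :: "complex \<Rightarrow> complex"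
  assume fg: "continuous_on (cball 0 1) f \<and> f holomorphic_on ball 0 1" "continuous_on (cball 0 1) g \<and> g holomorphic_on ball 0 1"
  show "continuous_on (cball 0 1) (\<lambda>p. f p + g p) \<and> (\<lambda>p. f p + g p) holomorphic_on ball 0 1"
    "continuous_on (cball 0 1) (\<lambda>p. f p * g p) \<and> (\<lambda>p. f p * g p) holomorphic_on ball 0 1"
    using fg by (auto intro!: continuous_intros holomorphic_intros)
next
  fix f :: "nat \<Rightarrow> complex \<Rightarrow> complex" and g
  assume "\<And>n. continuous_on (cball 0 1) (f n) \<and> f n holomorphic_on ball 0 1" "uniform_limit (cball 0 1) f g sequentially"
  then show "continuous_on (cball 0 1) g \<and> g holomorphic_on ball 0 1"
    by (metis (no_types, lifting) always_eventually holomorphic_uniform_limit trivial_limit_sequentially)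
next
  fix v u
  have lin: "bounded_clinear a" using a by (simp add: contractions_def)
  \<comment> \<open>Each matrix coefficient is affine in \<open>z\<close>.\<close>
  have "cinner v ((a \<circ> dilate (line e) z \<circ> b) u) = cinner v (a (b u)) + (z - 1) * (cinner e (b u) * cinner v (a e))" for z
    by (simp add: dilate_line[OF e(2)] bounded_clinear_add[OF lin] bounded_clinear_scaleC[OF lin]
        cinner_add_right cinner_scaleC_right mult.assoc)
  then show "continuous_on (cball 0 1) (\<lambda>z. cinner v ((a \<circ> dilate (line e) z \<circ> b) u)) \<and>
      (\<lambda>z. cinner v ((a \<circ> dilate (line e) z \<circ> b) u)) holomorphic_on ball 0 1"
    by (auto intro!: continuous_intros holomorphic_intros)
qed (auto intro!: continuous_intros)

lemma fock_value_continuous: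
  assumes st: "fock_state K w"
  shows "continuous_on (unitaries L) (fock_value w)"
proof (rule closed_class_fock_value[OF _ _ _ _ _ _ st, of "unitaries L" "\<lambda>u. u" "continuous_on (unitaries L)"])
  show "contractive u" if "u \<in> unitaries L" for u by (rule unitary_contractive[OF that])
  show "continuous_on (unitaries L) g" if "\<And>n. continuous_on (unitaries L) (f n)" "uniform_limit (unitaries L) f g sequentially"
    for f :: "nat \<Rightarrow> ('a \<Rightarrow> 'a) \<Rightarrow> complex" and g
    by (rule uniform_limit_theorem[OF _ that(2)]) (use that(1) in auto)
  have "continuous_on (unitaries L) (\<lambda>u. u w)" for w :: 'a
    by (rule continuous_on_subset[OF continuous_on_product_coordinates]) simp
  then show "continuous_on (unitaries L) (\<lambda>u. cinner v (u w))" for v w :: 'a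
    by (intro continuous_intros cinner.continuous_on)
qed (auto intro!: continuous_intros)

text \<open>With \<open>a = b = id\<close> this says that values at unitaries determine those at
  contractions; with a unitary and its inverse it carries conjugation invariance from unitaries to
  contractions.\<close>

lemma fock_value_unique:
  assumes E: "orthonormal_set E" and st: "fock_state K1 w1" "fock_state K2 w2"
    and a: "a \<in> contractions (complex_vector.span E)" and b: "b \<in> contractions (complex_vector.span E)"
    and eq: "\<And>u. u \<in> unitaries (complex_vector.span E) \<Longrightarrow> fock_value w1 (a \<circ> u \<circ> b) = fock_value w2 u"
    and x: "x \<in> contractions (complex_vector.span E)"
  shows "fock_value w1 (a \<circ> x \<circ> b) = fock_value w2 x"
proof -
  let ?D = "\<lambda>x. fock_value w1 (a \<circ> x \<circ> b) - fock_value w2 x"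
  have "?D x = 0"
  proof (rule vanish_on_contractions[OF E _ _ x])
    fix a' b' e assume *: "a' \<in> contractions (complex_vector.span E)" "b' \<in> contractions (complex_vector.span E)"
      "e \<in> complex_vector.span E" "norm e = 1"
    have "a \<circ> (a' \<circ> dilate (line e) z \<circ> b') \<circ> b = (a \<circ> a') \<circ> dilate (line e) z \<circ> (b' \<circ> b)" for z
      by (simp only: comp_assoc)
    then show "continuous_on (cball 0 1) (\<lambda>z. ?D (a' \<circ> dilate (line e) z \<circ> b')) \<and>
        (\<lambda>z. ?D (a' \<circ> dilate (line e) z \<circ> b')) holomorphic_on ball 0 1"
      using fock_value_holomorphic[OF st(1) complex_vector.subspace_span *(3,4) contractions_comp[OF a *(1)] contractions_comp[OF *(2) b]]
        fock_value_holomorphic[OF st(2) complex_vector.subspace_span *(3,4,1,2)]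
      by (auto intro!: continuous_intros holomorphic_intros)
  qed (simp only: eq diff_self)
  then show ?thesis by (simp only: right_minus_eq)
qed

lemma cinner_fock_op_unitary:
  assumes h: "h \<in> unitaries K" and g: "g \<in> unitaries L" and v: "v \<in> fock UNIV" "w \<in> fock UNIV"
  shows "cinner (fock_op h v) (fock_op g w) = cinner v (fock_op (inv h \<circ> g) w)"
proof -
  have "cinner (fock_op h v) (fock_op g w) = cinner (fock_op id v) (fock_op (inv h \<circ> g) w)"
  proof (rule cinner_fock_op_cong[OF _ _ contractive_id _ _ v])
    show "contractive h" "contractive g" "contractive (inv h \<circ> g)"
      using h g by (auto intro: unitary_contractive unitaries_inv contractive_comp)
    show "cinner (h x) (g y) = cinner (id x) ((inv h \<circ> g) y)" for x y
      using cinner_unitary[OF h, of x "inv h (g y)"] by (simp add: unitary_inv_cancel[OF h])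
  qed
  then show ?thesis by (simp add: fock_op_id[OF v(1)])
qed

lemma has_sum_sum:
  fixes f :: "'i \<Rightarrow> 'k \<Rightarrow> 'a::topological_comm_monoid_add"
  assumes "finite S" "\<And>i. i \<in> S \<Longrightarrow> (f i has_sum s i) A"
  shows "((\<lambda>k. \<Sum>i\<in>S. f i k) has_sum (\<Sum>i\<in>S. s i)) A"
  using assms by (induction S) (auto intro: has_sum_add)

text \<open>For each \<open>k\<close> the double sum is the squared norm of a combination of the
  vectors \<open>fock_op g (w k)\<close>.\<close>

lemma fock_value_positive_definite:
  assumes st: "fock_state K w" and S: "finite S" "S \<subseteq> unitaries L"
  shows "(\<Sum>g\<in>S. \<Sum>h\<in>S. c g * cnj (c h) * fock_value w (inv h \<circ> g)) \<in> \<real>\<^sub>\<ge>\<^sub>0"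
proof -
  have wU: "w k \<in> fock UNIV" for k using st fock_mono[of K UNIV] by (auto simp: fock_state_def)
  have "((\<lambda>k. \<Sum>g\<in>S. \<Sum>h\<in>S. c g * cnj (c h) * cinner (w k) (fock_op (inv h \<circ> g) (w k))) has_sum
      (\<Sum>g\<in>S. \<Sum>h\<in>S. c g * cnj (c h) * fock_value w (inv h \<circ> g))) UNIV"
    using S by (intro has_sum_sum has_sum_cmult_right fock_value_has_sum[OF st] contractive_comp)
      (auto intro: unitary_contractive unitaries_inv)
  moreover have "(\<Sum>g\<in>S. \<Sum>h\<in>S. c g * cnj (c h) * cinner (w k) (fock_op (inv h \<circ> g) (w k))) =
      complex_of_real ((norm (\<Sum>g\<in>S. c g *\<^sub>C fock_op g (w k)))\<^sup>2)" for k
  proof -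
    have "(\<Sum>g\<in>S. \<Sum>h\<in>S. c g * cnj (c h) * cinner (w k) (fock_op (inv h \<circ> g) (w k))) =
        (\<Sum>g\<in>S. \<Sum>h\<in>S. c g * cnj (c h) * cinner (fock_op h (w k)) (fock_op g (w k)))"
      using S by (intro sum.cong refl arg_cong2[of _ _ _ _ "(*)"] cinner_fock_op_unitary[symmetric] wU) auto
    also have "\<dots> = (\<Sum>h\<in>S. \<Sum>g\<in>S. c g * cnj (c h) * cinner (fock_op h (w k)) (fock_op g (w k)))"
      by (rule sum.swap)
    also have "\<dots> = cinner (\<Sum>h\<in>S. c h *\<^sub>C fock_op h (w k)) (\<Sum>g\<in>S. c g *\<^sub>C fock_op g (w k))"
      unfolding cinner.sum_left unfolding cinner.sum_right
      by (simp add: cinner_scaleC_left cinner_scaleC_right mult_ac)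
    finally show ?thesis by (simp only: cinner_self)
  qed
  ultimately have h: "((\<lambda>k. complex_of_real ((norm (\<Sum>g\<in>S. c g *\<^sub>C fock_op g (w k)))\<^sup>2)) has_sum
      (\<Sum>g\<in>S. \<Sum>h\<in>S. c g * cnj (c h) * fock_value w (inv h \<circ> g))) UNIV" by simp
  show ?thesis
    unfolding complex_nonneg_Reals_iff
    using has_sum_nonneg[OF has_sum_Re[OF h]] has_sum_unique[OF has_sum_Im[OF h]] by simp
qed

section \<open>Limits of unitary groups\<close>

lemma carrier_limit_unitary_group: "carrier (limit_unitary_group E) = (\<Union>N\<in>{1..}. unitaries (E N))"
  by (simp add: limit_unitary_group_def)

lemma limit_unitary_group_simps [simp]:
  "mult (limit_unitary_group E) g h = g \<circ> h" "one (limit_unitary_group E) = id"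
  by (simp_all add: limit_unitary_group_def)

lemma m_inv_limit_unitary_group:
  assumes "g \<in> carrier (limit_unitary_group E)"
  shows "m_inv (limit_unitary_group E) g = inv g"
proof -
  obtain N where N: "N \<ge> 1" "g \<in> unitaries (E N)"
    using assms by (auto simp: carrier_limit_unitary_group)
  show ?thesis
    unfolding m_inv_def limit_unitary_group_simps
  proof (rule the_equality)
    show "inv g \<in> carrier (limit_unitary_group E) \<and> g \<circ> inv g = id \<and> inv g \<circ> g = id"
      using N unitaries_inv[OF N(2)] unitary_inv_cancel[OF N(2)] by (auto simp: carrier_limit_unitary_group)
    show "y = inv g" if "y \<in> carrier (limit_unitary_group E) \<and> g \<circ> y = id \<and> y \<circ> g = id" for y
      using that by (metis inv_unique_comp)
  qed
qed

text \<open>The universal property of the inductive limit topology.\<close>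

lemma continuous_map_limit_unitary_topology:
  "continuous_map (limit_unitary_topology E) euclidean \<phi> \<longleftrightarrow> (\<forall>N\<ge>1. continuous_on (unitaries (E N)) \<phi>)"
proof -
  let ?U = "\<Union>N\<in>{1..}. unitaries (E N)"
  have "openin (limit_unitary_topology E) ?U"
    unfolding openin_limit_unitary_topology
  proof (intro conjI allI impI)
    fix N :: nat assume "1 \<le> N"
    then have "?U \<inter> unitaries (E N) = unitaries (E N)" by auto
    then show "openin (top_of_set (unitaries (E N))) (?U \<inter> unitaries (E N))" by simp
  qed simp
  then have top: "topspace (limit_unitary_topology E) = ?U"
    using openin_limit_unitary_topology[THEN iffD1, OF openin_topspace, of E, THEN conjunct1]
    by (intro equalityI) (auto dest: openin_subset)
  have "openin (limit_unitary_topology E) {x \<in> ?U. \<phi> x \<in> V} \<longleftrightarrow>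
      (\<forall>N\<ge>1. openin (top_of_set (unitaries (E N))) (unitaries (E N) \<inter> \<phi> -` V))" for V
  proof -
    have "{x \<in> ?U. \<phi> x \<in> V} \<inter> unitaries (E N) = unitaries (E N) \<inter> \<phi> -` V" if "N \<ge> 1" for N
      using that by auto
    then show ?thesis unfolding openin_limit_unitary_topology by auto
  qed
  then show ?thesis
    unfolding continuous_map top continuous_openin_preimage_eq open_openin[symmetric] by auto
qed

locale increasing_subspaces =
  fixes E :: "nat \<Rightarrow> 'h::complex_hilbert set"
  assumes Suc_mono: "\<And>N. N \<ge> 1 \<Longrightarrow> E N \<subseteq> E (Suc N)"
begin

abbreviation U :: "('h \<Rightarrow> 'h) set" where "U \<equiv> carrier (limit_unitary_group E)"

lemma mono: "1 \<le> M \<Longrightarrow> M \<le> N \<Longrightarrow> E M \<subseteq> E N"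
proof (induction N)
  case (Suc N)
  show ?case
  proof (cases "M = Suc N")
    case False
    then have "E M \<subseteq> E N" using Suc by auto
    also have "\<dots> \<subseteq> E (Suc N)" using Suc.prems False by (intro Suc_mono) auto
    finally show ?thesis .
  qed simp
qed simp

lemma in_U: "N \<ge> 1 \<Longrightarrow> u \<in> unitaries (E N) \<Longrightarrow> u \<in> U"
  by (auto simp: carrier_limit_unitary_group)

lemma unitaries_E_mono: "1 \<le> M \<Longrightarrow> M \<le> N \<Longrightarrow> unitaries (E M) \<subseteq> unitaries (E N)"
  by (rule unitaries_mono[OF mono])

text \<open>Any condition on finitely many group elements, positive definiteness in particular, can
  be checked in a single \<open>unitaries (E N)\<close>.\<close>

lemma finite_subset_U:
  assumes "finite S" "S \<subseteq> U"
  obtains N where "N \<ge> 1" "S \<subseteq> unitaries (E N)"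
proof -
  have "\<exists>N\<ge>1. S \<subseteq> unitaries (E N)"
    using assms
  proof (induction S)
    case (insert u S)
    then obtain N where N: "N \<ge> 1" "S \<subseteq> unitaries (E N)" by auto
    obtain M where M: "M \<ge> 1" "u \<in> unitaries (E M)"
      using insert.prems by (auto simp: carrier_limit_unitary_group)
    have "insert u S \<subseteq> unitaries (E (max M N))"
      using unitaries_E_mono[OF M(1), of "max M N"] unitaries_E_mono[OF N(1), of "max M N"] M N by auto
    then show ?case using M(1) by (intro exI[of _ "max M N"]) auto
  qed auto
  then show ?thesis using that by blast
qed

lemma U_comp: "u \<in> U \<Longrightarrow> v \<in> U \<Longrightarrow> u \<circ> v \<in> U"
  using finite_subset_U[of "{u, v}"] unitaries_comp in_U by (metis finite.emptyI finite.insertI insert_subset empty_subsetI)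

lemma U_inv: "u \<in> U \<Longrightarrow> inv u \<in> U"
  using unitaries_inv by (auto simp: carrier_limit_unitary_group)

lemma id_in_U: "id \<in> U"
  using id_in_unitaries by (auto simp: carrier_limit_unitary_group)

lemma normalized_pd_iff:
  "\<phi> \<in> normalized_pd (limit_unitary_group E) (limit_unitary_topology E) \<longleftrightarrow>
    \<phi> \<in> extensional U \<and> (\<forall>N\<ge>1. continuous_on (unitaries (E N)) \<phi>) \<and>
    (\<forall>S c. finite S \<and> S \<subseteq> U \<longrightarrow> (\<Sum>g\<in>S. \<Sum>h\<in>S. c g * cnj (c h) * \<phi> (inv h \<circ> g)) \<in> \<real>\<^sub>\<ge>\<^sub>0) \<and> \<phi> id = 1"
proof -
  have "(\<Sum>g\<in>S. \<Sum>h\<in>S. c g * cnj (c h) * \<phi> (m_inv (limit_unitary_group E) h \<circ> g)) =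
      (\<Sum>g\<in>S. \<Sum>h\<in>S. c g * cnj (c h) * \<phi> (inv h \<circ> g))" if "S \<subseteq> U" for S c
    using that by (intro sum.cong refl) (auto simp: m_inv_limit_unitary_group)
  then show ?thesis
    unfolding normalized_pd_def positive_definite_def continuous_map_limit_unitary_topology by auto
qed

lemma conj_invariant_iff:
  assumes "K \<subseteq> U"
  shows "conj_invariant (limit_unitary_group E) K \<phi> \<longleftrightarrow> (\<forall>g\<in>U. \<forall>k\<in>K. \<phi> (k \<circ> g \<circ> inv k) = \<phi> g)"
proof -
  have "m_inv (limit_unitary_group E) k = inv k" if "k \<in> K" for k
    using that assms by (intro m_inv_limit_unitary_group) blast
  then show ?thesis unfolding conj_invariant_def by simp
qed

lemma convex_comb_normalized_pd:
  assumes \<phi>: "\<phi> \<in> normalized_pd (limit_unitary_group E) (limit_unitary_topology E)"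
    and \<psi>: "\<psi> \<in> normalized_pd (limit_unitary_group E) (limit_unitary_topology E)" and t: "t \<in> {0..1}"
  shows "convex_comb t \<phi> \<psi> \<in> normalized_pd (limit_unitary_group E) (limit_unitary_topology E)"
  unfolding normalized_pd_iff
proof (intro conjI allI impI)
  note \<phi>' = \<phi>[unfolded normalized_pd_iff] and \<psi>' = \<psi>[unfolded normalized_pd_iff]
  show "convex_comb t \<phi> \<psi> \<in> extensional U"
    using \<phi>' \<psi>' by (auto simp: extensional_def convex_comb_def distrib_right[symmetric] simp flip: of_real_add)
  show "continuous_on (unitaries (E N)) (convex_comb t \<phi> \<psi>)" if "N \<ge> 1" for N
    unfolding convex_comb_def using \<phi>' \<psi>' that by (intro continuous_intros) auto
  show "convex_comb t \<phi> \<psi> id = 1"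
    using \<phi>' \<psi>' by (simp add: convex_comb_def)
  fix S c assume S: "finite S \<and> S \<subseteq> U"
  have "(\<Sum>g\<in>S. \<Sum>h\<in>S. c g * cnj (c h) * convex_comb t \<phi> \<psi> (inv h \<circ> g)) =
      complex_of_real t * (\<Sum>g\<in>S. \<Sum>h\<in>S. c g * cnj (c h) * \<phi> (inv h \<circ> g)) +
      complex_of_real (1 - t) * (\<Sum>g\<in>S. \<Sum>h\<in>S. c g * cnj (c h) * \<psi> (inv h \<circ> g))"
    by (simp add: convex_comb_def sum_distrib_left sum.distrib distrib_left mult_ac del: of_real_diff)
  moreover have "complex_of_real t \<in> \<real>\<^sub>\<ge>\<^sub>0" "complex_of_real (1 - t) \<in> \<real>\<^sub>\<ge>\<^sub>0"
    using t by (simp_all add: complex_nonneg_Reals_iff)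
  ultimately show "(\<Sum>g\<in>S. \<Sum>h\<in>S. c g * cnj (c h) * convex_comb t \<phi> \<psi> (inv h \<circ> g)) \<in> \<real>\<^sub>\<ge>\<^sub>0"
    using \<phi>' \<psi>' S by (simp only: nonneg_Reals_add_I nonneg_Reals_mult_I)
qed

end

section \<open>Mixtures of states, and states fixed by a unitary\<close>

lemma has_sum_Plus:
  fixes f :: "'a + 'b \<Rightarrow> 'c::topological_comm_monoid_add"
  assumes "((\<lambda>x. f (Inl x)) has_sum a) UNIV" "((\<lambda>x. f (Inr x)) has_sum b) UNIV"
  shows "(f has_sum (a + b)) UNIV"
proof -
  have "(f has_sum a) (range Inl)" "(f has_sum b) (range Inr)"
    using assms by (simp_all add: has_sum_reindex o_def)
  then have "(f has_sum (a + b)) (range Inl \<union> range Inr)"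
    by (rule has_sum_Un_disjoint) auto
  then show ?thesis by (simp add: UNIV_sum)
qed

text \<open>Interleave the two sequences, with weights \<open>sqrt t\<close> and
  \<open>sqrt (1 - t)\<close>.\<close>

lemma fock_state_mix:
  fixes w1 w2 :: "nat \<Rightarrow> 'h::complex_hilbert list ell2"
  assumes st: "fock_state K w1" "fock_state K w2" and t: "t \<in> {0..1}"
  shows "\<exists>w. fock_state K w \<and> (\<forall>x. contractive x \<longrightarrow>
    fock_value w x = complex_of_real t * fock_value w1 x + complex_of_real (1 - t) * fock_value w2 x)"
proof -
  define v where "v = case_sum (\<lambda>k. complex_of_real (sqrt t) *\<^sub>C w1 k) (\<lambda>k. complex_of_real (sqrt (1 - t)) *\<^sub>C w2 k)"
  define w where "w k = v (sum_decode k)" for k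
  have bij: "bij_betw sum_decode UNIV UNIV" by (rule bij_sum_decode)
  have "((\<lambda>k. (norm (v k))\<^sup>2) has_sum (t * 1 + (1 - t) * 1)) UNIV"
  proof (rule has_sum_Plus)
    show "((\<lambda>x. (norm (v (Inl x)))\<^sup>2) has_sum t * 1) UNIV" "((\<lambda>x. (norm (v (Inr x)))\<^sup>2) has_sum (1 - t) * 1) UNIV"
      using has_sum_cmult_right[of "\<lambda>k. (norm (w1 k))\<^sup>2" UNIV 1 t]
        has_sum_cmult_right[of "\<lambda>k. (norm (w2 k))\<^sup>2" UNIV 1 "1 - t"] st t
      by (simp_all add: v_def norm_scaleC power_mult_distrib fock_state_def)
  qed
  then have n1: "((\<lambda>k. (norm (w k))\<^sup>2) has_sum 1) UNIV"
    unfolding w_def using has_sum_reindex_bij_betw[OF bij, of "\<lambda>k. (norm (v k))\<^sup>2"] by simp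
  have "v k \<in> fock K" for k
    using st by (cases k) (auto simp: v_def fock_state_def intro!: complex_vector.subspace_scale[OF fock.subspace])
  then have w: "fock_state K w" using n1 by (simp add: fock_state_def w_def)
  moreover have "fock_value w x = complex_of_real t * fock_value w1 x + complex_of_real (1 - t) * fock_value w2 x"
    if x: "contractive x" for x
  proof -
    have "((\<lambda>k. cinner (v k) (fock_op x (v k))) has_sum
        (complex_of_real t * fock_value w1 x + complex_of_real (1 - t) * fock_value w2 x)) UNIV"
    proof (rule has_sum_Plus)
      show "((\<lambda>k. cinner (v (Inl k)) (fock_op x (v (Inl k)))) has_sum complex_of_real t * fock_value w1 x) UNIV"
        "((\<lambda>k. cinner (v (Inr k)) (fock_op x (v (Inr k)))) has_sum complex_of_real (1 - t) * fock_value w2 x) UNIV"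
        using has_sum_cmult_right[OF fock_value_has_sum[OF st(1) x], of "complex_of_real t"]
          has_sum_cmult_right[OF fock_value_has_sum[OF st(2) x], of "complex_of_real (1 - t)"] t
        by (simp_all add: v_def bounded_clinear_scaleC[OF bounded_clinear_fock_op[OF x]] cinner_scaleC_left
            cinner_scaleC_right mult.assoc[symmetric] del: of_real_diff flip: of_real_mult)
    qed
    then have "((\<lambda>k. cinner (w k) (fock_op x (w k))) has_sum
        (complex_of_real t * fock_value w1 x + complex_of_real (1 - t) * fock_value w2 x)) UNIV"
      unfolding w_def using has_sum_reindex_bij_betw[OF bij, of "\<lambda>k. cinner (v k) (fock_op x (v k))"] by simp
    then show ?thesis using fock_value_has_sum[OF w x] has_sum_unique by blast
  qed
  ultimately show ?thesis by blast
qed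

lemma holomorphic_iff:
  fixes E :: "nat \<Rightarrow> 'h::complex_hilbert set"
  assumes "\<And>N. N \<ge> 1 \<Longrightarrow> \<exists>e\<in>E N. norm e = 1"
  shows "holomorphic E \<phi> \<longleftrightarrow> (\<forall>N\<ge>1. \<exists>w. fock_state (E N) w \<and> (\<forall>u\<in>unitaries (E N). \<phi> u = fock_value w u))"
  unfolding holomorphic_def
proof (intro iffI allI impI)
  fix N :: nat assume N: "N \<ge> 1"
  show "\<exists>w. fock_state (E N) w \<and> (\<forall>u\<in>unitaries (E N). \<phi> u = fock_value w u)"
    if "\<forall>N\<ge>1. \<exists>c A. holomorphic_expansion (E N) c A \<phi>"
    using that N fock_state_of_expansion[of "E N"] by blast
  show "\<exists>c A. holomorphic_expansion (E N) c A \<phi>"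
    if "\<forall>N\<ge>1. \<exists>w. fock_state (E N) w \<and> (\<forall>u\<in>unitaries (E N). \<phi> u = fock_value w u)"
    using that N assms[OF N] expansion_of_fock_state[of "E N" _ \<phi>] by blast
qed

lemma holomorphic_convex_comb:
  assumes E: "\<And>N. N \<ge> 1 \<Longrightarrow> \<exists>e\<in>E N. norm e = 1" and "holomorphic E \<phi>" "holomorphic E \<psi>" "t \<in> {0..1}"
  shows "holomorphic E (convex_comb t \<phi> \<psi>)"
proof -
  have iff: "holomorphic E \<phi> \<longleftrightarrow> (\<forall>N\<ge>1. \<exists>w. fock_state (E N) w \<and> (\<forall>u\<in>unitaries (E N). \<phi> u = fock_value w u))" for \<phi>
    by (rule holomorphic_iff) (rule E)
  show ?thesis
    unfolding iff
  proof (intro allI impI)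
    fix N :: nat assume N: "N \<ge> 1"
    obtain w1 where w1: "fock_state (E N) w1" "\<And>u. u \<in> unitaries (E N) \<Longrightarrow> \<phi> u = fock_value w1 u"
      using assms(2) N unfolding iff by blast
    obtain w2 where w2: "fock_state (E N) w2" "\<And>u. u \<in> unitaries (E N) \<Longrightarrow> \<psi> u = fock_value w2 u"
      using assms(3) N unfolding iff by blast
    obtain w where w: "fock_state (E N) w" "\<And>x. contractive x \<Longrightarrow>
        fock_value w x = complex_of_real t * fock_value w1 x + complex_of_real (1 - t) * fock_value w2 x"
      using fock_state_mix[OF w1(1) w2(1) assms(4)] by blast
    have "convex_comb t \<phi> \<psi> u = fock_value w u" if u: "u \<in> unitaries (E N)" for u
      unfolding convex_comb_def w(2)[OF unitary_contractive[OF u]] w1(2)[OF u] w2(2)[OF u] by (rule refl)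
    then show "\<exists>w. fock_state (E N) w \<and> (\<forall>u\<in>unitaries (E N). convex_comb t \<phi> \<psi> u = fock_value w u)"
      using w(1) by blast
  qed
qed

text \<open>The value 1 is the sum of the squared norms, so no term may lose anything: the real part
  of each coefficient equals the squared norm of \<open>w k\<close>. For a contraction this equality
  in Cauchy-Schwarz forces a fixed vector.\<close>

lemma fock_state_fixed:
  assumes st: "fock_state K w" and g: "contractive g" and 1: "fock_value w g = 1"
  shows "fock_op g (w k) = w k"
proof -
  have "((\<lambda>k. (norm (w k))\<^sup>2 + - Re (cinner (w k) (fock_op g (w k)))) has_sum (1 + - Re (fock_value w g))) UNIV"
    using st by (intro has_sum_add has_sum_uminusI has_sum_Re fock_value_has_sum[OF st] g) (auto simp: fock_state_def)
  moreover have "Re (cinner (w k) (fock_op g (w k))) \<le> (norm (w k))\<^sup>2" for k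
    using cinner_fock_op_le[OF g, of "w k"] complex_Re_le_cmod order_trans by blast
  ultimately have "(norm (w k))\<^sup>2 - Re (cinner (w k) (fock_op g (w k))) = 0"
    using nonneg_has_sum_le_0D[of "\<lambda>k. (norm (w k))\<^sup>2 - Re (cinner (w k) (fock_op g (w k)))" UNIV _ k] 1 by simp
  moreover have "(norm (fock_op g (w k)))\<^sup>2 \<le> (norm (w k))\<^sup>2"
    by (intro power_mono norm_fock_op g) simp
  ultimately have "(norm (w k - fock_op g (w k)))\<^sup>2 \<le> 0" by (simp add: norm_diff_square)
  then show ?thesis by simp
qed

lemma cinner_simple_tensor_eq_0:
  assumes "\<exists>v\<in>set vs. \<forall>u\<in>F. cinner u v = 0" "set us \<subseteq> F"
  shows "cinner (simple_tensor us) (simple_tensor vs) = 0"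
proof (cases "length us = length vs")
  case True
  then show ?thesis using assms by (induction us vs rule: list_induct2) auto
qed (rule cinner_simple_tensor_length)

text \<open>A tensor all of whose factors lie in \<open>F\<close> or in \<open>G\<close>, with \<open>m\<close> factors in \<open>G\<close>, is an eigenvector
  of \<open>dilate G z\<close> for the eigenvalue \<open>z ^ m\<close>; choose \<open>z\<close> with \<open>z ^ m = -1\<close>.\<close>

lemma fixed_in_fock:
  fixes K F :: "'h::complex_hilbert set"
  assumes K: "closed_complex_subspace K" and F: "closed_complex_subspace F" and FK: "F \<subseteq> K"
    and a: "a \<in> fock K" and fix_a: "\<And>z. cmod z = 1 \<Longrightarrow> fock_op (dilate (K \<inter> orthocomp F) z) a = a"
  shows "a \<in> fock F"
proof -
  interpret K: closed_complex_subspace K by (rule K)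
  interpret F: closed_complex_subspace F by (rule F)
  define G where "G = K \<inter> orthocomp F"
  have G: "closed_complex_subspace G"
    unfolding G_def by (auto simp: closed_complex_subspace_def complex_vector.subspace_inter K.subspace K.closed
        orthocomp_subspace closed_orthocomp closed_Int)
  define b where "b = a - orth_proj (fock F) a"
  have bo: "b \<in> orthocomp (fock F)" unfolding b_def by (rule fock.proj_orth)
  have pure: "cinner (simple_tensor us) b = 0" if us: "set us \<subseteq> F \<union> G" for us
  proof (cases "set us \<subseteq> F")
    case True
    then show ?thesis using orthocompD[OF bo simple_tensor_in_fock] by blast
  next
    case False
    then obtain v0 where v0: "v0 \<in> set us" "v0 \<notin> F" "v0 \<in> G" using us by blast
    define m where "m = length (filter (\<lambda>v. v \<notin> F) us)"
    have m: "m > 0" using v0 by (auto simp: m_def filter_empty_conv)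
    define z where "z = cis (pi / real m)"
    have z1: "cmod z = 1" by (simp add: z_def)
    have zm: "z ^ m = -1" using m Complex.DeMoivre[of "pi / real m" m] by (simp add: z_def)
    have gU: "dilate G z \<in> unitaries K" using dilate_unitary[OF G z1, of K] by (auto simp: G_def)
    have gc: "contractive (dilate G z)" by (rule unitary_contractive[OF gU])
    have FG: "v \<in> orthocomp G" if "v \<in> F" for v
      using orthocompD'[OF _ that] by (auto simp: G_def orthocomp_def[of "K \<inter> _"])
    have "map (dilate G z) us = map (\<lambda>v. (if v \<in> F then 1 else z) *\<^sub>C v) us"
      using us dilate_fix[OF G FG] dilate_in_G[OF G] by auto
    then have "fock_op (dilate G z) (simple_tensor us) =
        (\<Prod>v\<leftarrow>us. (if v \<in> F then 1 else z)) *\<^sub>C simple_tensor us"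
      by (simp only: fock_op_simple_tensor[OF gc] simple_tensor_scale)
    also have "(\<Prod>v\<leftarrow>us. (if v \<in> F then 1 else z)) = z ^ m"
      unfolding m_def by (induction us) auto
    finally have "fock_op (dilate G z) (simple_tensor us) = - simple_tensor us"
      by (simp add: zm scaleC_minus1)
    moreover have "cinner (fock_op (dilate G z) (simple_tensor us)) (fock_op (dilate G z) a) =
        cinner (fock_op id (simple_tensor us)) (fock_op id a)"
      by (rule cinner_fock_op_cong[OF gc gc contractive_id contractive_id _ simple_tensor_in_fock[OF subset_UNIV] a])
        (simp add: cinner_unitary[OF gU])
    moreover have "fock_op id a = a" using a fock_mono[of K UNIV] by (intro fock_op_id) auto
    moreover have "fock_op (dilate G z) a = a" using fix_a[OF z1] by (simp add: G_def)
    ultimately have "- cinner (simple_tensor us) a = cinner (simple_tensor us) a"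
      by (simp add: fock_op_simple_tensor[OF contractive_id] cinner.minus_left)
    then have 1: "cinner (simple_tensor us) a = 0" by simp
    have "simple_tensor us \<in> orthocomp (fock F)"
      unfolding fock_def orthocomp_closure_span
      using v0 by (auto simp: orthocomp_def G_def intro!: cinner_simple_tensor_eq_0)
    from orthocompD'[OF this fock.proj_in] show ?thesis using 1 by (simp add: b_def cinner.diff_right)
  qed
  \<comment> \<open>The factors are split into their components in \<open>F\<close> and
    \<open>G\<close> from left to right; \<open>us\<close> is the part already split.\<close>
  have "cinner (simple_tensor (us @ vs)) b = 0" if "set us \<subseteq> F \<union> G" "set vs \<subseteq> K" for us vs
    using that
  proof (induction vs arbitrary: us)
    case (Cons v vs)
    let ?p = "orth_proj F v"
    have "v - ?p \<in> G"
      unfolding G_def using Cons.prems F.proj_in[of v] FK F.proj_orth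
      by (auto intro!: complex_vector.subspace_diff[OF K.subspace])
    then have "cinner (simple_tensor ((us @ [?p]) @ vs)) b = 0" "cinner (simple_tensor ((us @ [v - ?p]) @ vs)) b = 0"
      using Cons.prems F.proj_in[of v] by (intro Cons.IH; simp)+
    then show ?case using simple_tensor_add[of us ?p "v - ?p" vs] by (simp add: cinner_add_left)
  qed (simp add: pure)
  from this[of "[]"] have "b \<in> orthocomp (fock K)"
    unfolding fock_def orthocomp_closure_span by (auto simp: orthocomp_def)
  moreover have "b \<in> fock K"
    unfolding b_def using fock_mono[OF FK] fock.proj_in
    by (intro complex_vector.subspace_diff[OF fock.subspace] a) blast
  ultimately have "b = 0" using orthocomp_disjoint by blast
  then show ?thesis using fock.proj_in[of F a] by (simp add: b_def)
qed

section \<open>The affine isomorphism\<close>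

locale orthonormal_flag =
  fixes H :: "nat \<Rightarrow> 'h::complex_hilbert set" and f :: "nat \<Rightarrow> 'h"
  assumes H_closed: "\<And>N. N \<ge> 1 \<Longrightarrow> closed_complex_subspace (H N)"
    and H_mono: "\<And>N. N \<ge> 1 \<Longrightarrow> H N \<subseteq> H (Suc N)"
    and f_in: "\<And>N. N \<ge> 1 \<Longrightarrow> f N \<in> H N"
    and f_orth: "\<And>N. N \<ge> 1 \<Longrightarrow> f N \<in> orthocomp (H (N - 1))"
    and f_norm: "\<And>N. N \<ge> 1 \<Longrightarrow> norm (f N) = 1"
begin

sublocale H: increasing_subspaces H
  by unfold_locales (rule H_mono)

sublocale F: increasing_subspaces "fspan f"
  by unfold_locales (auto simp: fspan_def intro!: complex_vector.span_mono)

abbreviation P :: "'h \<Rightarrow> 'h" where "P \<equiv> orth_proj (Hminus f)"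

sublocale Hminus: closed_complex_subspace "Hminus f"
  unfolding Hminus_def by (rule closed_complex_subspace_closure_span)

lemma f_orthonormal:
  assumes "1 \<le> i" "1 \<le> j"
  shows "cinner (f i) (f j) = (if i = j then 1 else 0)"
proof -
  have lt: "cinner (f i) (f j) = 0" if "1 \<le> i" "i < j" for i j
  proof (rule orthocompD[OF f_orth])
    have "i \<le> j - 1" using that by linarith
    then show "f i \<in> H (j - 1)" by (rule subsetD[OF H.mono[OF that(1)] f_in[OF that(1)]])
  qed (use that in auto)
  show ?thesis
  proof (cases i j rule: linorder_cases)
    case less then show ?thesis using lt[of i j] assms by simp
  next
    case equal then show ?thesis using f_norm[OF assms(1)] by (simp add: cinner_self)
  next
    case greater
    then show ?thesis using lt[of j i] assms cinner_commute[of "f i" "f j"] by simp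
  qed
qed

lemma orthonormal_set_f: "orthonormal_set (f ` {1..N})"
proof
  fix b b' assume "b \<in> f ` {1..N}" "b' \<in> f ` {1..N}"
  then obtain i j where ij: "b = f i" "b' = f j" "1 \<le> i" "1 \<le> j" by auto
  have "f i \<noteq> f j" if "i \<noteq> j"
    using f_orthonormal[of i j] f_orthonormal[of i i] ij that by auto
  then show "cinner b b' = (if b = b' then 1 else 0)" using f_orthonormal ij by auto
qed simp

lemma fspan_closed: "closed_complex_subspace (fspan f N)"
  unfolding fspan_def by (rule orthonormal_set.closed_complex_subspace_span[OF orthonormal_set_f])

lemma fspan_subset_H: "N \<ge> 1 \<Longrightarrow> fspan f N \<subseteq> H N"
proof -
  assume N: "N \<ge> 1"
  have "f ` {1..N} \<subseteq> H N"
  proof (intro image_subsetI)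
    fix k assume "k \<in> {1..N}"
    then have k: "1 \<le> k" "k \<le> N" by auto
    show "f k \<in> H N" by (rule subsetD[OF H.mono[OF k] f_in[OF k(1)]])
  qed
  then show ?thesis
    unfolding fspan_def
    using complex_vector.span_minimal closed_complex_subspace.subspace[OF H_closed[OF N]] by blast
qed

lemma fspan_subset_Hminus: "fspan f N \<subseteq> Hminus f"
proof -
  have "fspan f N \<subseteq> complex_vector.span (f ` {1..})"
    unfolding fspan_def by (intro complex_vector.span_mono) auto
  then show ?thesis unfolding Hminus_def using closure_subset by blast
qed

lemma f_in_fspan: "1 \<le> k \<Longrightarrow> k \<le> N \<Longrightarrow> f k \<in> fspan f N"
  unfolding fspan_def by (intro complex_vector.span_base) auto

lemma unit_vector_fspan: "N \<ge> 1 \<Longrightarrow> \<exists>e\<in>fspan f N. norm e = 1"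
  using f_in_fspan[of 1 N] f_norm[of 1] by auto

lemma unit_vector_H: "N \<ge> 1 \<Longrightarrow> \<exists>e\<in>H N. norm e = 1"
  using unit_vector_fspan fspan_subset_H by blast

text \<open>For \<open>k \<le> N\<close> the vector \<open>f k\<close> lies in the span, and for
  larger \<open>k\<close> it is orthogonal to \<open>H (k - 1)\<close>, which contains
  \<open>H N\<close>.\<close>

lemma in_orthocomp_Hminus:
  assumes N: "N \<ge> 1" and w: "w \<in> H N" "w \<in> orthocomp (fspan f N)"
  shows "w \<in> orthocomp (Hminus f)"
proof -
  have "cinner (f k) w = 0" if k: "k \<ge> 1" for k
  proof (cases "k \<le> N")
    case True then show ?thesis using orthocompD[OF w(2) f_in_fspan[OF k]] by blast
  next
    case False
    then have "N \<le> k - 1" by linarith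
    then have "w \<in> H (k - 1)" by (rule subsetD[OF H.mono[OF N] w(1)])
    then show ?thesis using orthocompD'[OF f_orth[OF k]] by blast
  qed
  then show ?thesis unfolding Hminus_def orthocomp_closure_span by (auto simp: orthocomp_def)
qed

text \<open>The residual of the projection to the finite span is in \<open>H N\<close> and
  orthogonal to that span, hence to \<open>Hminus f\<close>. So compressions of unitaries of
  \<open>H N\<close> preserve \<open>fspan f N\<close>.\<close>

lemma P_H:
  assumes N: "N \<ge> 1" and w: "w \<in> H N"
  shows "P w = orth_proj (fspan f N) w"
proof (rule Hminus.proj_eqI)
  interpret F: closed_complex_subspace "fspan f N" by (rule fspan_closed)
  interpret HN: closed_complex_subspace "H N" by (rule H_closed[OF N])
  show "orth_proj (fspan f N) w \<in> Hminus f" using F.proj_in fspan_subset_Hminus by blast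
  show "w - orth_proj (fspan f N) w \<in> orthocomp (Hminus f)"
    using F.proj_in fspan_subset_H[OF N]
    by (intro in_orthocomp_Hminus[OF N] complex_vector.subspace_diff[OF HN.subspace] w F.proj_orth) blast
qed

text \<open>Symmetry of \<open>P\<close> moves the question to the projection of \<open>H N\<close>,
  which is inside \<open>fspan f N\<close>. This is why compressions are the identity off
  \<open>fspan f N\<close>.\<close>

lemma Hminus_orthocomp_H:
  assumes N: "N \<ge> 1" and v: "v \<in> Hminus f" "v \<in> orthocomp (fspan f N)"
  shows "v \<in> orthocomp (H N)"
proof -
  interpret F: closed_complex_subspace "fspan f N" by (rule fspan_closed)
  have "cinner h v = 0" if h: "h \<in> H N" for h
  proof -
    have "cinner h v = cinner h (P v)" by (simp add: Hminus.proj_fix[OF v(1)])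
    also have "\<dots> = cinner (orth_proj (fspan f N) h) v"
      by (simp add: Hminus.cinner_proj_commute[symmetric] P_H[OF N h])
    also have "\<dots> = 0" by (rule orthocompD[OF v(2) F.proj_in])
    finally show ?thesis .
  qed
  then show ?thesis by (auto simp: orthocomp_def)
qed

section \<open>Compression of unitaries\<close>

definition compress :: "('h \<Rightarrow> 'h) \<Rightarrow> 'h \<Rightarrow> 'h"
  where "compress W = extend_id (Hminus f) (Phi f W)"

lemma compress_eq: "compress W v = P (W (P v)) + (v - P v)"
  by (simp add: compress_def extend_id_def Phi_def Hminus.proj_fix Hminus.proj_in)

lemma compress_contraction:
  assumes N: "N \<ge> 1" and W: "W \<in> unitaries (H N)"
  shows "compress W \<in> contractions (fspan f N)"
  unfolding contractions_def
proof (intro CollectI conjI allI ballI)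
  interpret F: closed_complex_subspace "fspan f N" by (rule fspan_closed)
  interpret HN: closed_complex_subspace "H N" by (rule H_closed[OF N])
  show "bounded_clinear (compress W)"
    using bounded_clinear_plus[OF bounded_clinear_comp[OF Hminus.bounded_clinear_proj
          bounded_clinear_comp[OF unitary_clinear[OF W] Hminus.bounded_clinear_proj]]
        bounded_clinear_minus[OF bounded_clinear_id Hminus.bounded_clinear_proj]]
    by (simp add: compress_eq[abs_def] o_def)
  show "norm (compress W v) \<le> norm v" for v
  proof -
    have "cinner (P (W (P v))) (v - P v) = 0" by (rule orthocompD[OF Hminus.proj_orth Hminus.proj_in])
    then have "(norm (compress W v))\<^sup>2 = (norm (P (W (P v))))\<^sup>2 + (norm (v - P v))\<^sup>2"
      by (simp add: compress_eq norm_add_square)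
    also have "\<dots> \<le> (norm (P v))\<^sup>2 + (norm (v - P v))\<^sup>2"
      using Hminus.norm_proj_le[of "W (P v)"] by (intro add_mono power_mono) (auto simp: norm_unitary[OF W])
    also have "\<dots> = (norm v)\<^sup>2" using Hminus.norm_proj_square[of v] by simp
    finally show ?thesis by (simp add: abs_le_square_iff[symmetric])
  qed
  show "compress W ` fspan f N \<subseteq> fspan f N"
  proof (intro image_subsetI)
    fix v assume v: "v \<in> fspan f N"
    have "P v = v" using v fspan_subset_Hminus by (intro Hminus.proj_fix) blast
    moreover have "W v \<in> H N" using HN.unitary_in[OF W] v fspan_subset_H[OF N] by blast
    ultimately show "compress W v \<in> fspan f N" by (simp add: compress_eq P_H[OF N] F.proj_in)
  qed
  show "compress W v = v" if v: "v \<in> orthocomp (fspan f N)" for v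
  proof -
    have "P v \<in> orthocomp (fspan f N)"
      unfolding orthocomp_def
    proof (intro CollectI ballI)
      fix y assume y: "y \<in> fspan f N"
      then have "P y = y" using fspan_subset_Hminus by (intro Hminus.proj_fix) blast
      then show "cinner y (P v) = 0"
        using orthocompD[OF v y] by (simp add: Hminus.cinner_proj_commute[symmetric])
    qed
    then have "P v \<in> orthocomp (H N)" by (rule Hminus_orthocomp_H[OF N Hminus.proj_in])
    then have "W (P v) = P v" by (rule unitary_orthocomp[OF W])
    then show ?thesis by (simp add: compress_eq Hminus.proj_fix Hminus.proj_in)
  qed
qed

lemma cinner_compress:
  assumes "v \<in> fspan f N" "w \<in> fspan f N"
  shows "cinner v (compress W w) = cinner v (W w)"
proof -
  have "P v = v" "P w = w" using assms fspan_subset_Hminus by (auto intro: Hminus.proj_fix)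
  then show ?thesis using Hminus.cinner_proj_commute[of v "W w"] by (simp add: compress_eq)
qed

text \<open>Vectors in the Fock space of \<open>fspan f N\<close> only see the matrix coefficients
  of \<open>W\<close> on that span, where \<open>W\<close> and its compression agree.\<close>

lemma fock_value_compress:
  assumes N: "N \<ge> 1" and W: "W \<in> unitaries (H N)" and st: "fock_state (fspan f N) w"
  shows "fock_value w (compress W) = fock_value w W"
  unfolding fock_value_def
proof (rule infsum_cong)
  fix k
  have wk: "w k \<in> fock (fspan f N)" using st by (simp add: fock_state_def)
  have "cinner (fock_op id (w k)) (fock_op (compress W) (w k)) = cinner (fock_op id (w k)) (fock_op W (w k))"
    by (rule cinner_fock_op_cong[OF contractive_id _ contractive_id _ _ wk wk])
      (simp_all add: cinner_compress contraction_contractive[OF compress_contraction[OF N W]] unitary_contractive[OF W])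
  then show "cinner (w k) (fock_op (compress W) (w k)) = cinner (w k) (fock_op W (w k))"
    using fock_op_id wk fock_mono[of "fspan f N" UNIV] by (metis subset_UNIV subsetD)
qed

lemma compress_Hminus_unitary:
  assumes u: "u \<in> unitaries (Hminus f)"
  shows "compress u = u"
proof
  fix v
  have "P (u (P v)) = u (P v)" by (intro Hminus.proj_fix Hminus.unitary_in[OF u] Hminus.proj_in)
  moreover have "u (v - P v) = v - P v" by (rule unitary_orthocomp[OF u Hminus.proj_orth])
  ultimately show "compress u v = u v"
    by (simp add: compress_eq bounded_clinear_diff[OF unitary_clinear[OF u]] algebra_simps)
qed

text \<open>Unitaries of \<open>Hminus f\<close> commute with the projection
  \<open>P\<close>.\<close>

lemma compress_conj:
  assumes k: "k \<in> unitaries (Hminus f)"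
  shows "compress (k \<circ> W \<circ> inv k) = k \<circ> compress W \<circ> inv k"
proof -
  have Pu: "P (u v) = u (P v)" if u: "u \<in> unitaries (Hminus f)" for u v
  proof (rule Hminus.proj_eqI)
    show "u (P v) \<in> Hminus f" by (intro Hminus.unitary_in[OF u] Hminus.proj_in)
    have "u v - u (P v) = v - P v"
      using unitary_orthocomp[OF u Hminus.proj_orth[of v]] by (simp add: bounded_clinear_diff[OF unitary_clinear[OF u]])
    then show "u v - u (P v) \<in> orthocomp (Hminus f)" using Hminus.proj_orth by simp
  qed
  show ?thesis
    by (simp add: fun_eq_iff compress_eq Pu[OF k] Pu[OF unitaries_inv[OF k]] unitary_inv_cancel[OF k]
        bounded_clinear_diff[OF unitary_clinear[OF k]] bounded_clinear_add[OF unitary_clinear[OF k]])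
qed

lemma compress_trivial:
  assumes "\<And>v. v \<in> Hminus f \<Longrightarrow> W v = v"
  shows "compress W = id"
  by (simp add: fun_eq_iff compress_eq assms Hminus.proj_in Hminus.proj_fix)

section \<open>Extension and restriction as mutually inverse maps\<close>

lemma holomorphic_fspan_iff: "holomorphic (fspan f) \<psi> \<longleftrightarrow>
    (\<forall>N\<ge>1. \<exists>w. fock_state (fspan f N) w \<and> (\<forall>u\<in>unitaries (fspan f N). \<psi> u = fock_value w u))"
  by (rule holomorphic_iff) (rule unit_vector_fspan)

lemma holomorphic_H_iff: "holomorphic H \<phi> \<longleftrightarrow>
    (\<forall>N\<ge>1. \<exists>w. fock_state (H N) w \<and> (\<forall>u\<in>unitaries (H N). \<phi> u = fock_value w u))"
  by (rule holomorphic_iff) (rule unit_vector_H)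

lemma fock_value_unique_fspan:
  assumes "fock_state K1 w1" "fock_state K2 w2"
    and "\<And>u. u \<in> unitaries (fspan f N) \<Longrightarrow> fock_value w1 u = fock_value w2 u"
    and x: "x \<in> contractions (fspan f N)"
  shows "fock_value w1 x = fock_value w2 x"
proof -
  have id: "id \<in> contractions (fspan f N)"
    using closed_complex_subspace.unitaries_subset_contractions[OF fspan_closed] id_in_unitaries by blast
  have "fock_value w1 (id \<circ> x \<circ> id) = fock_value w2 x"
    by (rule fock_value_unique[OF orthonormal_set_f assms(1,2), of id N id])
      (use assms(3) x id in \<open>simp_all add: fspan_def del: id_apply comp_apply\<close>)
  then show ?thesis by (simp only: id_comp comp_id)
qed

text \<open>Settles the definite description: every admissible \<open>N\<close> and every expansion
  yield a state with the same values at unitaries, and these fix the value at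
  \<open>x\<close>.\<close>

lemma holomorphic_extension_eq:
  assumes N: "N \<ge> 1" and st: "fock_state (fspan f N) w"
    and val: "\<And>u. u \<in> unitaries (fspan f N) \<Longrightarrow> \<psi> u = fock_value w u"
    and x: "x \<in> contractions (fspan f N)"
  shows "holomorphic_extension (fspan f) \<psi> x = fock_value w x"
  unfolding holomorphic_extension_def
proof (rule the_equality)
  have xc: "contractive x" by (rule contraction_contractive[OF x])
  obtain e where "e \<in> fspan f N" "norm e = 1" using unit_vector_fspan[OF N] by blast
  then obtain c A where cA: "holomorphic_expansion (fspan f N) c A \<psi>"
    using expansion_of_fock_state[OF st val] by blast
  obtain w' where w': "fock_state (fspan f N) w'" "\<And>u. u \<in> unitaries (fspan f N) \<Longrightarrow> \<psi> u = fock_value w' u"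
    "(\<lambda>n. complex_of_real (c n) * trace (A n \<circ> tensor_op n x)) sums fock_value w' x"
    using fock_state_of_expansion[OF cA] xc by blast
  have "fock_value w' x = fock_value w x"
    by (rule fock_value_unique_fspan[OF w'(1) st _ x]) (use w'(2) val in auto)
  then show "\<exists>N\<ge>1. \<exists>c A. x \<in> contractions (fspan f N) \<and> holomorphic_expansion (fspan f N) c A \<psi> \<and>
      (\<lambda>n. complex_of_real (c n) * trace (A n \<circ> tensor_op n x)) sums fock_value w x"
    using N x cA w'(3) by (intro exI[of _ N]) auto
  fix z assume "\<exists>N\<ge>1. \<exists>c A. x \<in> contractions (fspan f N) \<and> holomorphic_expansion (fspan f N) c A \<psi> \<and>
      (\<lambda>n. complex_of_real (c n) * trace (A n \<circ> tensor_op n x)) sums z"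
  then obtain M c A where M: "M \<ge> 1" "x \<in> contractions (fspan f M)" "holomorphic_expansion (fspan f M) c A \<psi>"
    "(\<lambda>n. complex_of_real (c n) * trace (A n \<circ> tensor_op n x)) sums z" by blast
  obtain w'' where w'': "fock_state (fspan f M) w''" "\<And>u. u \<in> unitaries (fspan f M) \<Longrightarrow> \<psi> u = fock_value w'' u"
    "(\<lambda>n. complex_of_real (c n) * trace (A n \<circ> tensor_op n x)) sums fock_value w'' x"
    using fock_state_of_expansion[OF M(3)] xc by blast
  have "z = fock_value w'' x" by (rule sums_unique2[OF M(4) w''(3)])
  also have "\<dots> = fock_value w x"
  \<comment> \<open>The comparison takes place on the smaller span: \<open>x\<close> is a
    contraction of it, and both states represent \<open>\<psi>\<close> on its unitaries.\<close>
  proof (cases "M \<le> N")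
    case True
    show ?thesis
      by (rule fock_value_unique_fspan[OF w''(1) st _ M(2)])
        (use w''(2) val F.unitaries_E_mono[OF M(1) True] in \<open>auto simp: subset_iff\<close>)
  next
    case False
    then have "unitaries (fspan f N) \<subseteq> unitaries (fspan f M)" using F.unitaries_E_mono[OF N, of M] by simp
    then show ?thesis
      using w''(2) val by (intro fock_value_unique_fspan[OF w''(1) st _ x]) (auto simp: subset_iff)
  qed
  finally show "z = fock_value w x" .
qed

text \<open>The inverse of restriction. Values off the group are \<open>undefined\<close>, as
  membership in \<open>C1 H f\<close> demands.\<close>

definition extend :: "(('h \<Rightarrow> 'h) \<Rightarrow> complex) \<Rightarrow> ('h \<Rightarrow> 'h) \<Rightarrow> complex"
  where "extend \<psi> = restrict (\<lambda>W. holomorphic_extension (fspan f) \<psi> (compress W)) H.U"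

lemma extend_eq:
  assumes N: "N \<ge> 1" and st: "fock_state (fspan f N) w"
    and val: "\<And>u. u \<in> unitaries (fspan f N) \<Longrightarrow> \<psi> u = fock_value w u"
    and W: "W \<in> unitaries (H N)"
  shows "extend \<psi> W = fock_value w W"
  using H.in_U[OF N W] holomorphic_extension_eq[OF N st val compress_contraction[OF N W]]
    fock_value_compress[OF N W st]
  by (simp add: extend_def)

lemma F_U_subset: "F.U \<subseteq> H.U"
  using unitaries_mono[OF fspan_subset_H] by (auto simp: carrier_limit_unitary_group)

lemma unitary_Hminus: "u \<in> F.U \<Longrightarrow> u \<in> unitaries (Hminus f)"
  using unitaries_mono[OF fspan_subset_Hminus] by (auto simp: carrier_limit_unitary_group)

lemma C2_iff: "\<psi> \<in> C2 f \<longleftrightarrow>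
    \<psi> \<in> normalized_pd (limit_unitary_group (fspan f)) (limit_unitary_topology (fspan f)) \<and>
    holomorphic (fspan f) \<psi> \<and> (\<forall>g\<in>F.U. \<forall>k\<in>F.U. \<psi> (k \<circ> g \<circ> inv k) = \<psi> g)"
  unfolding C2_def F.conj_invariant_iff[OF order_refl] by blast

lemma C1_iff: "\<phi> \<in> C1 H f \<longleftrightarrow>
    \<phi> \<in> normalized_pd (limit_unitary_group H) (limit_unitary_topology H) \<and>
    holomorphic H \<phi> \<and> (\<forall>g\<in>H.U. \<forall>k\<in>F.U. \<phi> (k \<circ> g \<circ> inv k) = \<phi> g) \<and>
    (\<forall>W\<in>H.U. (\<forall>v\<in>Hminus f. W v = v) \<longrightarrow> \<phi> W = 1)"
  unfolding C1_def H.conj_invariant_iff[OF F_U_subset] by blast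

lemma C2_state:
  assumes "\<psi> \<in> C2 f" "N \<ge> 1"
  obtains w where "fock_state (fspan f N) w" "\<And>u. u \<in> unitaries (fspan f N) \<Longrightarrow> \<psi> u = fock_value w u"
  using assms unfolding C2_iff holomorphic_fspan_iff by blast

lemma extend_restrict:
  assumes \<psi>: "\<psi> \<in> C2 f" and u: "u \<in> F.U"
  shows "extend \<psi> u = \<psi> u"
proof -
  obtain N where N: "N \<ge> 1" "u \<in> unitaries (fspan f N)" using u by (auto simp: carrier_limit_unitary_group)
  obtain w where w: "fock_state (fspan f N) w" "\<And>u. u \<in> unitaries (fspan f N) \<Longrightarrow> \<psi> u = fock_value w u"
    using C2_state[OF \<psi> N(1)] by blast
  show ?thesis
    using extend_eq[OF N(1) w, of u] w(2)[OF N(2)] N(2) unitaries_mono[OF fspan_subset_H[OF N(1)]] by auto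
qed

text \<open>Unitaries in the limit group are their own compressions, so a holomorphic function is
  recovered from its extension; uniqueness in the second part of the theorem follows from
  this.\<close>

lemma holomorphic_extension_unitary:
  assumes \<psi>: "holomorphic (fspan f) \<psi>" and u: "u \<in> F.U"
  shows "holomorphic_extension (fspan f) \<psi> (compress u) = \<psi> u"
proof -
  obtain N where N: "N \<ge> 1" "u \<in> unitaries (fspan f N)" using u by (auto simp: carrier_limit_unitary_group)
  obtain w where w: "fock_state (fspan f N) w" "\<And>u. u \<in> unitaries (fspan f N) \<Longrightarrow> \<psi> u = fock_value w u"
    using \<psi> N(1) unfolding holomorphic_fspan_iff by blast
  have "u \<in> contractions (fspan f N)"
    using closed_complex_subspace.unitaries_subset_contractions[OF fspan_closed] N(2) by blast
  then show ?thesis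
    unfolding compress_Hminus_unitary[OF unitary_Hminus[OF u]]
    using holomorphic_extension_eq[OF N(1) w] w(2)[OF N(2)] by simp
qed

text \<open>For each \<open>N\<close> one state in the Fock space of \<open>fspan f N\<close>
  represents both \<open>\<psi>\<close> on the small unitary group and the extension on
  \<open>unitaries (H N)\<close>, so continuity, positivity and holomorphy are read off from that
  state.\<close>

lemma extend_in_C1:
  assumes \<psi>: "\<psi> \<in> C2 f"
  shows "extend \<psi> \<in> C1 H f"
  unfolding C1_iff H.normalized_pd_iff
proof (intro conjI allI impI ballI)
  note \<psi>' = \<psi>[unfolded C2_iff F.normalized_pd_iff]
  show "extend \<psi> \<in> extensional H.U" by (simp add: extend_def)
  have idc: "extend \<psi> id = 1" using extend_restrict[OF \<psi> F.id_in_U] \<psi>' by simp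
  then show "extend \<psi> id = 1" .
  show "continuous_on (unitaries (H N)) (extend \<psi>)" if N: "N \<ge> 1" for N
  proof -
    obtain w where w: "fock_state (fspan f N) w" "\<And>u. u \<in> unitaries (fspan f N) \<Longrightarrow> \<psi> u = fock_value w u"
      using C2_state[OF \<psi> N] by blast
    show ?thesis
      using fock_value_continuous[OF w(1), of "H N"]
      by (rule continuous_on_eq) (simp add: extend_eq[OF N w])
  qed
  show "holomorphic H (extend \<psi>)"
    unfolding holomorphic_H_iff
  proof (intro allI impI)
    fix N :: nat assume N: "N \<ge> 1"
    obtain w where w: "fock_state (fspan f N) w" "\<And>u. u \<in> unitaries (fspan f N) \<Longrightarrow> \<psi> u = fock_value w u"
      using C2_state[OF \<psi> N] by blast
    have "fock_state (H N) w"
      using w(1) fock_mono[OF fspan_subset_H[OF N]] by (auto simp: fock_state_def)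
    then show "\<exists>w. fock_state (H N) w \<and> (\<forall>u\<in>unitaries (H N). extend \<psi> u = fock_value w u)"
      using extend_eq[OF N w] by blast
  qed
  fix S :: "('h \<Rightarrow> 'h) set" and c assume S: "finite S \<and> S \<subseteq> H.U"
  obtain N where N: "N \<ge> 1" "S \<subseteq> unitaries (H N)" using H.finite_subset_U S by blast
  obtain w where w: "fock_state (fspan f N) w" "\<And>u. u \<in> unitaries (fspan f N) \<Longrightarrow> \<psi> u = fock_value w u"
    using C2_state[OF \<psi> N(1)] by blast
  have "(\<Sum>g\<in>S. \<Sum>h\<in>S. c g * cnj (c h) * extend \<psi> (inv h \<circ> g)) =
      (\<Sum>g\<in>S. \<Sum>h\<in>S. c g * cnj (c h) * fock_value w (inv h \<circ> g))"
  proof (intro sum.cong refl)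
    fix g h assume "g \<in> S" "h \<in> S"
    then have "inv h \<circ> g \<in> unitaries (H N)" using N(2) by (intro unitaries_comp unitaries_inv) auto
    then show "c g * cnj (c h) * extend \<psi> (inv h \<circ> g) = c g * cnj (c h) * fock_value w (inv h \<circ> g)"
      by (simp only: extend_eq[OF N(1) w])
  qed
  then show "(\<Sum>g\<in>S. \<Sum>h\<in>S. c g * cnj (c h) * extend \<psi> (inv h \<circ> g)) \<in> \<real>\<^sub>\<ge>\<^sub>0"
    using fock_value_positive_definite[OF w(1) conjunct1[OF S] N(2), of c] by (simp only:)
next
  note \<psi>' = \<psi>[unfolded C2_iff F.normalized_pd_iff]
  fix W k assume W: "W \<in> H.U" and k: "k \<in> F.U"
  obtain N where N: "N \<ge> 1" "{W, k} \<subseteq> unitaries (H N)"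
    using H.finite_subset_U[of "{W, k}"] W k F_U_subset by blast
  obtain M where M: "M \<ge> 1" "k \<in> unitaries (fspan f M)" using k by (auto simp: carrier_limit_unitary_group)
  \<comment> \<open>The levels of \<open>W\<close> in the groups of \<open>H\<close> and of
    \<open>k\<close> in the groups of \<open>fspan f\<close> may differ; at level \<open>L\<close>
    both are available.\<close>
  define L where "L = max M N"
  have L: "L \<ge> 1" "W \<in> unitaries (H L)" "k \<in> unitaries (fspan f L)" "k \<in> unitaries (H L)"
    using N M H.unitaries_E_mono[OF N(1), of L] F.unitaries_E_mono[OF M(1), of L] by (auto simp: L_def)
  obtain w where w: "fock_state (fspan f L) w" "\<And>u. u \<in> unitaries (fspan f L) \<Longrightarrow> \<psi> u = fock_value w u"
    using C2_state[OF \<psi> L(1)] by blast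
  have kW: "k \<circ> W \<circ> inv k \<in> unitaries (H L)" by (intro unitaries_comp unitaries_inv L)
  have kc: "k \<in> contractions (fspan f L)" "inv k \<in> contractions (fspan f L)"
    using closed_complex_subspace.unitaries_subset_contractions[OF fspan_closed] L(3) unitaries_inv[OF L(3)] by blast+
  \<comment> \<open>Centrality concerns unitaries, whereas \<open>compress W\<close> is only a
    contraction; \<open>fock_value_unique\<close> bridges the gap.\<close>
  have "fock_value w (k \<circ> compress W \<circ> inv k) = fock_value w (compress W)"
  proof (rule fock_value_unique[OF orthonormal_set_f w(1) w(1), folded fspan_def, OF kc _ compress_contraction[OF L(1,2)]])
    fix u assume u: "u \<in> unitaries (fspan f L)"
    have "k \<circ> u \<circ> inv k \<in> unitaries (fspan f L)" by (intro unitaries_comp unitaries_inv L u)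
    then show "fock_value w (k \<circ> u \<circ> inv k) = fock_value w u"
      using \<psi>' k F.in_U[OF L(1) u] w(2) u by metis
  qed
  then have "fock_value w (k \<circ> W \<circ> inv k) = fock_value w W"
    unfolding compress_conj[OF unitary_Hminus[OF k], symmetric] fock_value_compress[OF L(1) kW w(1)]
      fock_value_compress[OF L(1,2) w(1)] .
  then show "extend \<psi> (k \<circ> W \<circ> inv k) = extend \<psi> W"
    by (simp only: extend_eq[OF L(1) w kW] extend_eq[OF L(1) w L(2)])
next
  note \<psi>' = \<psi>[unfolded C2_iff F.normalized_pd_iff]
  fix W assume W: "W \<in> H.U" "\<forall>v\<in>Hminus f. W v = v"
  \<comment> \<open>A unitary that is trivial on \<open>Hminus f\<close> has the same compression as
    the identity.\<close>
  have "compress W = compress id" using compress_trivial[of W] compress_trivial[of id] W(2) by simp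
  then have "extend \<psi> W = extend \<psi> id" using W(1) H.id_in_U by (simp add: extend_def del: id_apply)
  then show "extend \<psi> W = 1" using extend_restrict[OF \<psi> F.id_in_U] \<psi>' by simp
qed

text \<open>Combines \<open>fock_state_fixed\<close> with \<open>fixed_in_fock\<close>; by
  \<open>in_orthocomp_Hminus\<close> the dilations used are trivial on \<open>Hminus f\<close>, so
  \<open>\<phi>\<close> is 1 there.\<close>

lemma C1_state:
  assumes \<phi>: "\<phi> \<in> C1 H f" and N: "N \<ge> 1"
  obtains w where "fock_state (fspan f N) w" "\<And>u. u \<in> unitaries (H N) \<Longrightarrow> \<phi> u = fock_value w u"
proof -
  obtain w where w: "fock_state (H N) w" "\<And>u. u \<in> unitaries (H N) \<Longrightarrow> \<phi> u = fock_value w u"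
    using \<phi> N unfolding C1_iff holomorphic_H_iff by blast
  let ?G = "H N \<inter> orthocomp (fspan f N)"
  interpret HN: closed_complex_subspace "H N" by (rule H_closed[OF N])
  have G: "closed_complex_subspace ?G"
    by (auto simp: closed_complex_subspace_def complex_vector.subspace_inter HN.subspace HN.closed
        orthocomp_subspace closed_orthocomp closed_Int)
  have "fock_op (dilate ?G z) (w k) = w k" if z: "cmod z = 1" for z k
  proof (rule fock_state_fixed[OF w(1)])
    have u: "dilate ?G z \<in> unitaries (H N)" by (rule dilate_unitary[OF G z]) simp
    then show "contractive (dilate ?G z)" by (rule unitary_contractive)
    have "dilate ?G z v = v" if v: "v \<in> Hminus f" for v
    proof (rule dilate_fix[OF G])
      show "v \<in> orthocomp ?G"
        using orthocompD'[OF in_orthocomp_Hminus[OF N] v] by (auto simp: orthocomp_def[of ?G])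
    qed
    then have "\<phi> (dilate ?G z) = 1" using \<phi> H.in_U[OF N u] unfolding C1_iff by blast
    then show "fock_value w (dilate ?G z) = 1" using w(2)[OF u] by simp
  qed
  then have "w k \<in> fock (fspan f N)" for k
    using w(1) by (intro fixed_in_fock[OF H_closed[OF N] fspan_closed fspan_subset_H[OF N]])
      (auto simp: fock_state_def)
  then have "fock_state (fspan f N) w" using w(1) by (simp add: fock_state_def)
  then show ?thesis using that w(2) by blast
qed

lemma restrict_in_C2:
  assumes \<phi>: "\<phi> \<in> C1 H f"
  shows "restrict \<phi> F.U \<in> C2 f"
  unfolding C2_iff F.normalized_pd_iff
proof (intro conjI allI impI ballI)
  note \<phi>' = \<phi>[unfolded C1_iff H.normalized_pd_iff]
  show "restrict \<phi> F.U \<in> extensional F.U" by simp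
  show "continuous_on (unitaries (fspan f N)) (restrict \<phi> F.U)" if N: "N \<ge> 1" for N
  proof -
    have "continuous_on (unitaries (H N)) \<phi>" using \<phi>' N by simp
    then have "continuous_on (unitaries (fspan f N)) \<phi>"
      by (rule continuous_on_subset[OF _ unitaries_mono[OF fspan_subset_H[OF N]]])
    then show ?thesis
      by (rule continuous_on_eq) (simp only: restrict_apply'[OF F.in_U[OF N]])
  qed
  show "restrict \<phi> F.U id = 1" using \<phi>' F.id_in_U by simp
  show "holomorphic (fspan f) (restrict \<phi> F.U)"
    unfolding holomorphic_fspan_iff
  proof (intro allI impI)
    fix N :: nat assume N: "N \<ge> 1"
    obtain w where w: "fock_state (fspan f N) w" "\<And>u. u \<in> unitaries (H N) \<Longrightarrow> \<phi> u = fock_value w u"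
      using C1_state[OF \<phi> N] by blast
    have "restrict \<phi> F.U u = fock_value w u" if u: "u \<in> unitaries (fspan f N)" for u
      using w(2) u unitaries_mono[OF fspan_subset_H[OF N]] F.in_U[OF N u] by auto
    then show "\<exists>w. fock_state (fspan f N) w \<and> (\<forall>u\<in>unitaries (fspan f N). restrict \<phi> F.U u = fock_value w u)"
      using w(1) by blast
  qed
  show "restrict \<phi> F.U (k \<circ> g \<circ> inv k) = restrict \<phi> F.U g" if "g \<in> F.U" "k \<in> F.U" for g k
  proof -
    have c: "k \<circ> g \<circ> inv k \<in> F.U" by (intro F.U_comp F.U_inv that)
    have "g \<in> H.U" using that F_U_subset by blast
    then have "\<phi> (k \<circ> g \<circ> inv k) = \<phi> g" using \<phi>' that(2) by blast
    then show ?thesis by (simp only: restrict_apply'[OF c] restrict_apply'[OF that(1)])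
  qed
  fix S :: "('h \<Rightarrow> 'h) set" and c assume S: "finite S \<and> S \<subseteq> F.U"
  have "(\<Sum>g\<in>S. \<Sum>h\<in>S. c g * cnj (c h) * restrict \<phi> F.U (inv h \<circ> g)) =
      (\<Sum>g\<in>S. \<Sum>h\<in>S. c g * cnj (c h) * \<phi> (inv h \<circ> g))"
  proof (intro sum.cong refl)
    fix g h assume "g \<in> S" "h \<in> S"
    then have "inv h \<circ> g \<in> F.U" using S by (intro F.U_comp F.U_inv) auto
    then show "c g * cnj (c h) * restrict \<phi> F.U (inv h \<circ> g) = c g * cnj (c h) * \<phi> (inv h \<circ> g)"
      by (simp only: restrict_apply')
  qed
  moreover have "finite S \<and> S \<subseteq> H.U" using S F_U_subset by blast
  ultimately show "(\<Sum>g\<in>S. \<Sum>h\<in>S. c g * cnj (c h) * restrict \<phi> F.U (inv h \<circ> g)) \<in> \<real>\<^sub>\<ge>\<^sub>0"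
    using \<phi>' by (simp only:)
qed

text \<open>The state of \<open>C1_state\<close> represents \<open>\<phi>\<close> on
  \<open>unitaries (H N)\<close> and its restriction on the smaller group, and
  \<open>extend_eq\<close> computes the extension from that same state.\<close>

lemma extend_of_restrict:
  assumes \<phi>: "\<phi> \<in> C1 H f"
  shows "extend (restrict \<phi> F.U) = \<phi>"
proof
  fix W
  show "extend (restrict \<phi> F.U) W = \<phi> W"
  proof (cases "W \<in> H.U")
    case True
    then obtain N where N: "N \<ge> 1" "W \<in> unitaries (H N)" by (auto simp: carrier_limit_unitary_group)
    obtain w where w: "fock_state (fspan f N) w" "\<And>u. u \<in> unitaries (H N) \<Longrightarrow> \<phi> u = fock_value w u"
      using C1_state[OF \<phi> N(1)] by blast
    have "restrict \<phi> F.U u = fock_value w u" if u: "u \<in> unitaries (fspan f N)" for u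
      using w(2) u unitaries_mono[OF fspan_subset_H[OF N(1)]] F.in_U[OF N(1) u] by auto
    from extend_eq[OF N(1) w(1) this N(2)] show ?thesis unfolding w(2)[OF N(2)] .
  next
    case False
    then show ?thesis using \<phi> by (auto simp: extend_def C1_iff H.normalized_pd_iff extensional_def)
  qed
qed

lemma restrict_of_extend:
  assumes \<psi>: "\<psi> \<in> C2 f"
  shows "restrict (extend \<psi>) F.U = \<psi>"
proof
  fix u show "restrict (extend \<psi>) F.U u = \<psi> u"
    using extend_restrict[OF \<psi>] \<psi> by (cases "u \<in> F.U") (auto simp: C2_iff F.normalized_pd_iff extensional_def)
qed

lemma restrict_convex_comb:
  "restrict (convex_comb t \<phi> \<psi>) A = convex_comb t (restrict \<phi> A) (restrict \<psi> A)"
  by (auto simp: fun_eq_iff convex_comb_def restrict_def distrib_right[symmetric])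

lemma convex_C1: "convex_functions (C1 H f)"
  unfolding convex_functions_def
proof (intro ballI)
  fix \<phi> \<psi> and t :: real assume *: "\<phi> \<in> C1 H f" "\<psi> \<in> C1 H f" "t \<in> {0..1}"
  have "holomorphic H (convex_comb t \<phi> \<psi>)"
    by (rule holomorphic_convex_comb[OF unit_vector_H]) (use * C1_iff in auto)
  moreover have "complex_of_real t + complex_of_real (1 - t) = 1" by simp
  ultimately show "convex_comb t \<phi> \<psi> \<in> C1 H f"
    using * H.convex_comb_normalized_pd[of \<phi> \<psi> t] unfolding C1_iff by (auto simp: convex_comb_def)
qed

lemma convex_C2: "convex_functions (C2 f)"
  unfolding convex_functions_def
proof (intro ballI)
  fix \<phi> \<psi> and t :: real assume *: "\<phi> \<in> C2 f" "\<psi> \<in> C2 f" "t \<in> {0..1}"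
  have "holomorphic (fspan f) (convex_comb t \<phi> \<psi>)"
    by (rule holomorphic_convex_comb[OF unit_vector_fspan]) (use * C2_iff in auto)
  then show "convex_comb t \<phi> \<psi> \<in> C2 f"
    using * F.convex_comb_normalized_pd[of \<phi> \<psi> t] unfolding C2_iff by (auto simp: convex_comb_def)
qed

theorem C1_C2_affinely_isomorphic: "affinely_isomorphic (C1 H f) (C2 f)"
  unfolding affinely_isomorphic_def
proof (intro conjI exI ballI)
  show "bij_betw (\<lambda>\<phi>. restrict \<phi> F.U) (C1 H f) (C2 f)"
    by (rule bij_betwI[of _ _ _ extend])
      (auto simp: restrict_in_C2 extend_in_C1 extend_of_restrict restrict_of_extend)
qed (rule convex_C1 convex_C2 restrict_convex_comb)+

end

section \<open>Dominated positive definite functions\<close>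

text \<open>Test at elements of \<open>M\<close> converging to \<open>\<xi>\<close> itself. The
  alternative \<open>\<xi> = 0\<close> covers negative \<open>C\<close>.\<close>

lemma norm_le_if_cinner_le:
  assumes \<xi>: "\<xi> \<in> closure M" and C: "\<And>x. x \<in> M \<Longrightarrow> cmod (cinner \<xi> x) \<le> C * norm x"
  shows "norm \<xi> \<le> C \<or> \<xi> = 0"
proof -
  obtain a where a: "\<And>n. a n \<in> M" "a \<longlonglongrightarrow> \<xi>" using \<xi> by (metis closure_sequential)
  have "(\<lambda>n. cmod (cinner \<xi> (a n))) \<longlonglongrightarrow> cmod (cinner \<xi> \<xi>)"
    by (intro tendsto_intros cinner.tendsto a)
  moreover have "(\<lambda>n. C * norm (a n)) \<longlonglongrightarrow> C * norm \<xi>" by (intro tendsto_intros a)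
  ultimately have "cmod (cinner \<xi> \<xi>) \<le> C * norm \<xi>"
    by (rule LIMSEQ_le) (use C a(1) in auto)
  then have "norm \<xi> * norm \<xi> \<le> C * norm \<xi>" by (simp add: cinner_self norm_power) (simp add: power2_eq_square)
  then show ?thesis by auto
qed

text \<open>The bound makes the assignment of \<open>\<alpha> i\<close> to \<open>x i\<close> well
  defined and continuous on the span even if the family is linearly dependent.\<close>

lemma riesz_on_family:
  fixes x :: "'i \<Rightarrow> 'a::complex_hilbert"
  assumes bound: "\<And>S c. finite S \<Longrightarrow> S \<subseteq> I \<Longrightarrow> cmod (\<Sum>i\<in>S. c i * \<alpha> i) \<le> C * norm (\<Sum>i\<in>S. c i *\<^sub>C x i)"
    and C: "0 \<le> C"
  shows "\<exists>\<xi>\<in>closure (complex_vector.span (x ` I)). (\<forall>i\<in>I. cinner \<xi> (x i) = \<alpha> i) \<and> norm \<xi> \<le> C"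
proof -
  \<comment> \<open>The graph of the functional. Coefficients vanish off \<open>S\<close>, so two
    representations can be added over the union of their supports.\<close>
  define rep where "rep v z \<longleftrightarrow> (\<exists>S c. finite S \<and> S \<subseteq> I \<and> (\<forall>i. i \<notin> S \<longrightarrow> c i = 0) \<and>
    v = (\<Sum>i\<in>S. c i *\<^sub>C x i) \<and> z = (\<Sum>i\<in>S. c i * \<alpha> i))" for v z
  have rep_bound: "cmod z \<le> C * norm v" if "rep v z" for v z
    using that bound unfolding rep_def by blast
  have rep_add: "rep (v + v') (z + z')" if vz: "rep v z" "rep v' z'" for v z v' z'
  proof -
    obtain S c where S: "finite S" "S \<subseteq> I" "\<And>i. i \<notin> S \<Longrightarrow> c i = 0" "v = (\<Sum>i\<in>S. c i *\<^sub>C x i)" "z = (\<Sum>i\<in>S. c i * \<alpha> i)"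
      using vz(1) unfolding rep_def by blast
    obtain S' c' where S': "finite S'" "S' \<subseteq> I" "\<And>i. i \<notin> S' \<Longrightarrow> c' i = 0" "v' = (\<Sum>i\<in>S'. c' i *\<^sub>C x i)" "z' = (\<Sum>i\<in>S'. c' i * \<alpha> i)"
      using vz(2) unfolding rep_def by blast
    have "v = (\<Sum>i\<in>S \<union> S'. c i *\<^sub>C x i)" "z = (\<Sum>i\<in>S \<union> S'. c i * \<alpha> i)"
      "v' = (\<Sum>i\<in>S \<union> S'. c' i *\<^sub>C x i)" "z' = (\<Sum>i\<in>S \<union> S'. c' i * \<alpha> i)"
      using S S' by (auto intro!: sum.mono_neutral_left)
    then show ?thesis
      unfolding rep_def using S(1-3) S'(1-3)
      by (intro exI[of _ "S \<union> S'"] exI[of _ "\<lambda>i. c i + c' i"])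
        (auto simp: sum.distrib scaleC_add_left distrib_right)
  qed
  have rep_scale: "rep (a *\<^sub>C v) (a * z)" if vz: "rep v z" for a v z
  proof -
    obtain S c where "finite S" "S \<subseteq> I" "\<And>i. i \<notin> S \<Longrightarrow> c i = 0" "v = (\<Sum>i\<in>S. c i *\<^sub>C x i)" "z = (\<Sum>i\<in>S. c i * \<alpha> i)"
      using vz unfolding rep_def by blast
    then show ?thesis
      unfolding rep_def
      by (intro exI[of _ S] exI[of _ "\<lambda>i. a * c i"])
        (auto simp: complex_vector.scale_sum_right scaleC_scaleC sum_distrib_left mult.assoc)
  qed
  have rep_base: "rep (x i) (\<alpha> i)" if "i \<in> I" for i
    unfolding rep_def using that
    by (intro exI[of _ "{i}"] exI[of _ "\<lambda>j. if j = i then 1 else 0"]) auto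
  have rep_unique: "z = z'" if "rep v z" "rep v z'" for v z z'
    using rep_bound[OF rep_add[OF that(1) rep_scale[OF that(2), of "-1"]]] by (simp add: scaleC_minus1)
  have ex: "\<exists>z. rep v z" if "v \<in> complex_vector.span (x ` I)" for v
    using that
  proof (induction rule: complex_vector.span_induct_alt)
    case base
    show ?case unfolding rep_def by (intro exI[of _ 0] exI[of _ "{}"] exI[of _ "\<lambda>_. 0"]) auto
  next
    case (step c y v)
    then show ?case using rep_add[OF rep_scale[OF rep_base]] by blast
  qed
  define l where "l v = (SOME z. rep v z)" for v
  have l: "rep v (l v)" if "v \<in> complex_vector.span (x ` I)" for v
    unfolding l_def by (rule someI_ex[OF ex[OF that]])
  have "\<exists>\<xi>\<in>closure (complex_vector.span (x ` I)). \<forall>v\<in>complex_vector.span (x ` I). cinner \<xi> v = l v"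
  proof (rule riesz_on_subspace[where C = C])
    show "l (v + v') = l v + l v'" if "v \<in> complex_vector.span (x ` I)" "v' \<in> complex_vector.span (x ` I)" for v v'
      using that by (intro rep_unique[OF l] rep_add l complex_vector.span_add)
    show "l (a *\<^sub>C v) = a * l v" if "v \<in> complex_vector.span (x ` I)" for a v
      using that by (intro rep_unique[OF l] rep_scale l complex_vector.span_scale)
  qed (auto intro: rep_bound l)
  then obtain \<xi> where \<xi>: "\<xi> \<in> closure (complex_vector.span (x ` I))" "\<And>v. v \<in> complex_vector.span (x ` I) \<Longrightarrow> cinner \<xi> v = l v"
    by blast
  have "norm \<xi> \<le> C \<or> \<xi> = 0"
    by (rule norm_le_if_cinner_le[OF \<xi>(1)]) (simp add: \<xi>(2) rep_bound[OF l])
  then have "norm \<xi> \<le> C" using C by auto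
  moreover have "cinner \<xi> (x i) = \<alpha> i" if "i \<in> I" for i
    using that \<xi>(2)[of "x i"] rep_unique[OF l rep_base, of i] by (simp add: complex_vector.span_base)
  ultimately show ?thesis using \<xi>(1) by blast
qed

lemma eq_if_cinner_eq:
  assumes "u \<in> closure (complex_vector.span X)" "v \<in> closure (complex_vector.span X)"
    and "\<And>x. x \<in> X \<Longrightarrow> cinner u x = cinner v x"
  shows "u = v"
proof -
  have "u - v \<in> closure (complex_vector.span X)"
    by (intro complex_vector.subspace_diff[OF subspace_closure_span] assms)
  moreover have "cinner x (u - v) = 0" if "x \<in> X" for x
    using assms(3)[OF that] cinner_commute[of x u] cinner_commute[of x v] by (simp add: cinner.diff_right)
  then have "u - v \<in> orthocomp (closure (complex_vector.span X))"
    unfolding orthocomp_closure_span by (simp add: orthocomp_def)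
  ultimately show ?thesis using orthocomp_disjoint by fastforce
qed

text \<open>\<open>B = (\<Sum>j. (B\<^sub>j)\<^sup>2)\<close> with \<open>B\<^sub>0 = B\<close> and \<open>B\<^sub>j\<^sub>+\<^sub>1 = B\<^sub>j - (B\<^sub>j)\<^sup>2\<close>; this replaces a square root of \<open>B\<close>.\<close>

primrec square_seq :: "('a::complex_hilbert \<Rightarrow> 'a) \<Rightarrow> nat \<Rightarrow> 'a \<Rightarrow> 'a" where
  "square_seq B 0 = B"
| "square_seq B (Suc j) = (\<lambda>v. square_seq B j v - square_seq B j (square_seq B j v))"

context
  fixes B :: "'a::complex_hilbert \<Rightarrow> 'a"
  assumes pos: "positive_op B" and le: "\<And>v. norm (B v) \<le> norm v"
begin

lemma square_seq_positive: "positive_op (square_seq B j) \<and> (\<forall>v. norm (square_seq B j v) \<le> norm v)"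
proof (induction j)
  case 0 show ?case using pos le by simp
next
  case (Suc j)
  define A where "A = square_seq B j"
  have A: "positive_op A" and An: "\<And>v. norm (A v) \<le> norm v" using Suc by (auto simp: A_def)
  have lin: "bounded_clinear A" using A by (simp add: positive_op_def)
  have form: "cinner v (A v - A (A v)) = complex_of_real (Re (cinner v (A v)) - (norm (A v))\<^sup>2)" for v
    using positive_op_real[OF A, of v] positive_op_hermitian[OF A, of v "A v"]
    by (simp add: cinner.diff_right cinner_self)
  \<comment> \<open>The square of a positive contraction lies below it: Cauchy-Schwarz for the form
    of \<open>A\<close> at \<open>A v\<close> and \<open>v\<close>.\<close>
  have sq: "(norm (A v))\<^sup>2 \<le> Re (cinner v (A v))" for v
  proof (cases "A v = 0")
    case False
    have "((norm (A v))\<^sup>2)\<^sup>2 = (cmod (cinner (A v) (A v)))\<^sup>2" by (simp add: cinner_self norm_power)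
    also have "\<dots> \<le> Re (cinner (A v) (A (A v))) * Re (cinner v (A v))"
      by (rule positive_op_Cauchy_Schwarz[OF A])
    also have "\<dots> \<le> (norm (A v))\<^sup>2 * Re (cinner v (A v))"
    proof (rule mult_right_mono[OF _ positive_op_Re[OF A]])
      have "Re (cinner (A v) (A (A v))) \<le> norm (A v) * norm (A (A v))"
        using cinner_Cauchy_Schwarz complex_Re_le_cmod order_trans by blast
      also have "\<dots> \<le> norm (A v) * norm (A v)" by (intro mult_left_mono An) simp
      finally show "Re (cinner (A v) (A (A v))) \<le> (norm (A v))\<^sup>2" by (simp add: power2_eq_square)
    qed
    finally have "(norm (A v))\<^sup>2 * (norm (A v))\<^sup>2 \<le> (norm (A v))\<^sup>2 * Re (cinner v (A v))"
      by (simp only: power2_eq_square)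
    then show ?thesis by (rule mult_left_le_imp_le) (simp add: False)
  qed (simp add: positive_op_Re[OF A])
  have "bounded_clinear (\<lambda>v. A v - A (A v))"
    using bounded_clinear_minus[OF lin bounded_clinear_comp[OF lin lin]] by (simp add: o_def)
  then have P: "positive_op (\<lambda>v. A v - A (A v))"
    unfolding positive_op_def form using sq by (auto simp: complex_nonneg_Reals_iff)
  have "norm (A v - A (A v)) \<le> 1 * norm v" for v
  proof (rule norm_positive_op_le[OF P])
    fix v
    have "Re (cinner v (A v - A (A v))) \<le> Re (cinner v (A v))" unfolding form by simp
    also have "\<dots> \<le> norm v * norm (A v)"
      using cinner_Cauchy_Schwarz complex_Re_le_cmod order_trans by blast
    also have "\<dots> \<le> norm v * norm v" by (intro mult_left_mono An) simp
    finally show "Re (cinner v (A v - A (A v))) \<le> 1 * (norm v)\<^sup>2" by (simp add: power2_eq_square)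
  qed simp
  then show ?case using P by (simp add: A_def)
qed

lemma square_seq_sum: "(\<Sum>j<n. square_seq B j (square_seq B j w)) = B w - square_seq B n w"
  by (induction n) simp_all

text \<open>The telescoping sum bounds the total of the squared norms by the quadratic form of
  \<open>B\<close> at \<open>w\<close>, so the terms tend to 0.\<close>

lemma square_seq_tendsto: "(\<lambda>n. square_seq B n w) \<longlonglongrightarrow> 0"
proof -
  have sq: "(norm (square_seq B j w))\<^sup>2 = Re (cinner w (square_seq B j (square_seq B j w)))" for j
    using positive_op_hermitian[OF conjunct1[OF square_seq_positive], of j w "square_seq B j w"]
    by (metis Re_cinner_self)
  have "(\<Sum>j<n. (norm (square_seq B j w))\<^sup>2) \<le> Re (cinner w (B w))" for n
  proof -
    have "(\<Sum>j<n. (norm (square_seq B j w))\<^sup>2) = Re (cinner w (B w - square_seq B n w))"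
      unfolding sq square_seq_sum[symmetric] by (simp add: cinner.sum_right)
    then show ?thesis
      using positive_op_Re[OF conjunct1[OF square_seq_positive], of w n] by (simp add: cinner.diff_right)
  qed
  then have "summable (\<lambda>j. (norm (square_seq B j w))\<^sup>2)" by (intro summableI_nonneg_bounded) auto
  then have "(\<lambda>j. (norm (square_seq B j w))\<^sup>2) \<longlonglongrightarrow> 0" by (rule summable_LIMSEQ_zero)
  from tendsto_real_sqrt[OF this] have "(\<lambda>j. norm (square_seq B j w)) \<longlonglongrightarrow> 0" by simp
  then show ?thesis by (rule tendsto_norm_zero_cancel)
qed

lemma square_seq_sums: "(\<lambda>j. cinner v (square_seq B j (square_seq B j w))) sums cinner v (B w)"
proof -
  have "(\<lambda>n. cinner v (B w - square_seq B n w)) \<longlonglongrightarrow> cinner v (B w - 0)"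
    by (intro cinner.tendsto tendsto_diff tendsto_const square_seq_tendsto)
  then show ?thesis unfolding sums_def cinner.sum_right[symmetric] square_seq_sum by simp
qed

end

text \<open>Radon-Nikodym: a positive definite function \<open>\<eta>\<close> dominated by \<open>\<langle>\<Omega>, V u \<Omega>\<rangle>\<close> has the form
  \<open>\<langle>\<Omega>, V u (B \<Omega>)\<rangle>\<close> with \<open>0 \<le> B \<le> 1\<close> commuting with the representation.\<close>

lemma dominated_positive_definite:
  fixes V :: "('h::complex_hilbert \<Rightarrow> 'h) \<Rightarrow> 'a::complex_hilbert \<Rightarrow> 'a" and \<Omega> :: 'a and K :: "'h set"
    and \<eta> :: "('h \<Rightarrow> 'h) \<Rightarrow> complex"
  defines "G \<equiv> unitaries K"
  defines "M \<equiv> closure (complex_vector.span ((\<lambda>g. V g \<Omega>) ` G))"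
  assumes lin: "\<And>u. u \<in> G \<Longrightarrow> bounded_clinear (V u)"
    and Vn: "\<And>u v. u \<in> G \<Longrightarrow> norm (V u v) \<le> norm v"
    and adj: "\<And>u v w. u \<in> G \<Longrightarrow> cinner (V (inv u) v) w = cinner v (V u w)"
    and comp: "\<And>u g. u \<in> G \<Longrightarrow> g \<in> G \<Longrightarrow> V u (V g \<Omega>) = V (u \<circ> g) \<Omega>"
    and id: "V id \<Omega> = \<Omega>"
    and pd: "\<And>S c. finite S \<Longrightarrow> S \<subseteq> G \<Longrightarrow> (\<Sum>g\<in>S. \<Sum>h\<in>S. c g * cnj (c h) * \<eta> (inv h \<circ> g)) \<in> \<real>\<^sub>\<ge>\<^sub>0"
    and dom: "\<And>S c. finite S \<Longrightarrow> S \<subseteq> G \<Longrightarrow>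
      Re (\<Sum>g\<in>S. \<Sum>h\<in>S. c g * cnj (c h) * \<eta> (inv h \<circ> g)) \<le> (norm (\<Sum>g\<in>S. c g *\<^sub>C V g \<Omega>))\<^sup>2"
  shows "\<exists>v :: nat \<Rightarrow> 'a. (\<forall>j. v j \<in> M) \<and> ((\<lambda>j. (norm (v j))\<^sup>2) has_sum Re (\<eta> id)) UNIV \<and>
    (\<forall>u\<in>G. ((\<lambda>j. cinner (v j) (V u (v j))) has_sum \<eta> u) UNIV)"
proof -
  define x where "x g = V g \<Omega>" for g
  \<comment> \<open>The sesquilinear form of the operator \<open>B\<close> to be constructed: it
    will equal the inner product of the combination with coefficients \<open>d\<close> and
    \<open>B\<close> applied to that with coefficients \<open>c\<close>.\<close>
  define q where "q S c d = (\<Sum>g\<in>S. \<Sum>h\<in>S. c g * cnj (d h) * \<eta> (inv h \<circ> g))"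
    for S :: "('h \<Rightarrow> 'h) set" and c d
  interpret M: closed_complex_subspace M unfolding M_def by (rule closed_complex_subspace_closure_span)
  have M_eq: "M = closure (complex_vector.span (x ` G))" by (simp add: M_def x_def[abs_def])
  have idG: "id \<in> G" by (simp add: G_def id_in_unitaries)
  have invG: "inv u \<in> G" and compG: "u \<circ> g \<in> G" if "u \<in> G" "g \<in> G" for u g
    using that by (auto simp: G_def unitaries_inv unitaries_comp)
  have cancel: "u \<circ> inv u = id" "inv u \<circ> u = id" if "u \<in> G" for u
    using that unitary_inv_cancel[of u K] by (simp_all add: G_def)
  have inv_inv: "inv (inv u) = u" if "u \<in> G" for u
    using that bij_unitary[of u K] by (simp add: G_def inv_inv_eq)
  have inv_comp: "inv (u \<circ> g) = inv g \<circ> inv u" if "u \<in> G" "g \<in> G" for u g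
    using that bij_unitary[of u K] bij_unitary[of g K] by (simp add: G_def o_inv_distrib)
  have pos: "q S c c \<in> \<real>\<^sub>\<ge>\<^sub>0" and dom': "Re (q S c c) \<le> (norm (\<Sum>g\<in>S. c g *\<^sub>C x g))\<^sup>2"
    if "finite S" "S \<subseteq> G" for S c
    using pd[OF that, of c] dom[OF that, of c] by (simp_all add: q_def x_def)
  have q_form: "q S c d = cnj (q S d c) \<and> (cmod (q S c d))\<^sup>2 \<le> Re (q S d d) * Re (q S c c)"
    if S: "finite S" "S \<subseteq> G" for S c d
  proof -
    have quad: "q S d d + z * q S c d + cnj z * q S d c + z * cnj z * q S c c \<in> \<real>\<^sub>\<ge>\<^sub>0" for z
    proof -
      have "q S d d + z * q S c d + cnj z * q S d c + z * cnj z * q S c c = q S (\<lambda>g. d g + z * c g) (\<lambda>g. d g + z * c g)"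
        unfolding q_def sum_distrib_left sum.distrib[symmetric]
        by (intro sum.cong refl) (simp add: algebra_simps)
      then show ?thesis using pos[OF S] by simp
    qed
    show ?thesis using psd_quadratic[OF quad pos[OF S]] by auto
  qed
  have herm: "\<eta> (inv h \<circ> g) = cnj (\<eta> (inv g \<circ> h))" if gh: "g \<in> G" "h \<in> G" for g h
  proof (cases "g = h")
    case True
    have "q {g} (\<lambda>_. 1) (\<lambda>_. 1) \<in> \<real>\<^sub>\<ge>\<^sub>0" using gh by (intro pos) auto
    then show ?thesis using True by (simp add: q_def complex_nonneg_Reals_iff complex_eq_iff)
  next
    case False
    have "q {g, h} (\<lambda>k. if k = g then 1 else 0) (\<lambda>k. if k = h then 1 else 0) =
        cnj (q {g, h} (\<lambda>k. if k = h then 1 else 0) (\<lambda>k. if k = g then 1 else 0))"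
      by (rule conjunct1[OF q_form]) (use gh in auto)
    then show ?thesis using False by (simp add: q_def)
  qed
  have eta_id: "\<eta> id = complex_of_real (Re (\<eta> id))" "0 \<le> Re (\<eta> id)"
    using pos[of "{id}" "\<lambda>_. 1"] idG by (auto simp: q_def complex_nonneg_Reals_iff complex_eq_iff)
  have q_bound: "cmod (q S c d) \<le> norm (\<Sum>g\<in>S. c g *\<^sub>C x g) * norm (\<Sum>g\<in>S. d g *\<^sub>C x g)"
    if S: "finite S" "S \<subseteq> G" for S c d
  proof -
    have "(cmod (q S c d))\<^sup>2 \<le> Re (q S d d) * Re (q S c c)" using q_form[OF S] by blast
    also have "\<dots> \<le> (norm (\<Sum>g\<in>S. d g *\<^sub>C x g))\<^sup>2 * (norm (\<Sum>g\<in>S. c g *\<^sub>C x g))\<^sup>2"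
      using pos[OF S] by (intro mult_mono dom' S) (auto simp: complex_nonneg_Reals_iff)
    finally have "(cmod (q S c d))\<^sup>2 \<le> (norm (\<Sum>g\<in>S. c g *\<^sub>C x g) * norm (\<Sum>g\<in>S. d g *\<^sub>C x g))\<^sup>2"
      by (simp add: power_mult_distrib mult.commute)
    then show ?thesis by (rule power2_le_imp_le) simp
  qed
  \<comment> \<open>These vectors are the future values \<open>B (x g)\<close>. The functional is
    bounded by Cauchy-Schwarz for \<open>q\<close> together with domination.\<close>
  have "\<exists>\<xi>\<in>closure (complex_vector.span (x ` G)). (\<forall>h\<in>G. cinner \<xi> (x h) = \<eta> (inv g \<circ> h)) \<and> norm \<xi> \<le> sqrt (Re (\<eta> id))"
    if g: "g \<in> G" for g
  proof (rule riesz_on_family)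
    fix S :: "('h \<Rightarrow> 'h) set" and c :: "('h \<Rightarrow> 'h) \<Rightarrow> complex" assume S: "finite S" "S \<subseteq> G"
    \<comment> \<open>Adjoining \<open>g\<close> puts the coefficients \<open>c\<close> and the unit
      coefficient at \<open>g\<close> on a common finite set.\<close>
    define T where "T = insert g S"
    define c' where "c' h = (if h \<in> S then c h else 0)" for h
    define d where "d h = (if h = g then 1 else 0 :: complex)" for h
    have T: "finite T" "T \<subseteq> G" using S g by (auto simp: T_def)
    have "q T c' d = (\<Sum>h\<in>T. c' h * \<eta> (inv g \<circ> h))"
      unfolding q_def using T(1)
      by (intro sum.cong refl) (simp add: d_def T_def if_distrib if_distribR cong: if_cong)
    also have "\<dots> = (\<Sum>h\<in>S. c h * \<eta> (inv g \<circ> h))"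
      using T S by (intro sum.mono_neutral_cong_right) (auto simp: c'_def T_def)
    finally have 1: "q T c' d = (\<Sum>h\<in>S. c h * \<eta> (inv g \<circ> h))" .
    have 2: "(\<Sum>h\<in>T. c' h *\<^sub>C x h) = (\<Sum>h\<in>S. c h *\<^sub>C x h)"
      using T S by (intro sum.mono_neutral_cong_right) (auto simp: c'_def T_def)
    have "q T d d = (\<Sum>k\<in>T. if k = g then \<eta> (inv g \<circ> g) else 0)"
      unfolding q_def
    proof (intro sum.cong refl)
      fix k assume "k \<in> T"
      have "(\<Sum>h\<in>T. d k * cnj (d h) * \<eta> (inv h \<circ> k)) = (\<Sum>h\<in>T. if h = g then d k * \<eta> (inv g \<circ> k) else 0)"
        by (intro sum.cong refl) (simp add: d_def)
      then show "(\<Sum>h\<in>T. d k * cnj (d h) * \<eta> (inv h \<circ> k)) = (if k = g then \<eta> (inv g \<circ> g) else 0)"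
        using T(1) by (simp add: T_def d_def)
    qed
    then have 3: "q T d d = \<eta> id" using T(1) cancel[OF g] by (simp add: T_def)
    have "(cmod (q T c' d))\<^sup>2 \<le> Re (q T d d) * Re (q T c' c')" using q_form[OF T] by blast
    also have "\<dots> \<le> Re (\<eta> id) * (norm (\<Sum>h\<in>S. c h *\<^sub>C x h))\<^sup>2"
      using dom'[OF T, of c'] eta_id unfolding 2 3 by (intro mult_left_mono) auto
    also have "\<dots> = (sqrt (Re (\<eta> id)) * norm (\<Sum>h\<in>S. c h *\<^sub>C x h))\<^sup>2"
      using eta_id(2) by (simp add: power_mult_distrib)
    finally show "cmod (\<Sum>h\<in>S. c h * \<eta> (inv g \<circ> h)) \<le> sqrt (Re (\<eta> id)) * norm (\<Sum>h\<in>S. c h *\<^sub>C x h)"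
      unfolding 1 by (rule power2_le_imp_le) (simp add: eta_id(2))
  qed (simp add: eta_id(2))
  then have "\<forall>g. \<exists>\<xi>. g \<in> G \<longrightarrow> \<xi> \<in> M \<and> (\<forall>h\<in>G. cinner \<xi> (x h) = \<eta> (inv g \<circ> h))" unfolding M_eq by blast
  from choice[OF this] obtain y where y: "\<And>g. g \<in> G \<Longrightarrow> y g \<in> M"
    "\<And>g h. g \<in> G \<Longrightarrow> h \<in> G \<Longrightarrow> cinner (y g) (x h) = \<eta> (inv g \<circ> h)" by blast
  have xM: "x g \<in> M" if "g \<in> G" for g
    unfolding M_eq by (rule subsetD[OF subset_closure_span]) (use that in blast)
  have yx: "cinner (x h) (y g) = \<eta> (inv h \<circ> g)" if "g \<in> G" "h \<in> G" for g h
    using y(2)[OF that] herm[OF that] cinner_commute[of "x h" "y g"] by simp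
  \<comment> \<open>So sending \<open>x g\<close> to \<open>y g\<close> extends to a
    contraction.\<close>
  have y_bound: "norm (\<Sum>g\<in>S. c g *\<^sub>C y g) \<le> norm (\<Sum>g\<in>S. c g *\<^sub>C x g)"
    if S: "finite S" "S \<subseteq> G" for S and c :: "('h \<Rightarrow> 'h) \<Rightarrow> complex"
  proof -
    define Y where "Y = (\<Sum>g\<in>S. c g *\<^sub>C y g)"
    have YM: "Y \<in> M" unfolding Y_def
      using S y(1) by (intro complex_vector.subspace_sum[OF M.subspace] complex_vector.subspace_scale[OF M.subspace]) auto
    have "cmod (cinner Y w) \<le> norm (\<Sum>g\<in>S. c g *\<^sub>C x g) * norm w" if w: "w \<in> complex_vector.span (x ` G)" for w
    proof -
      obtain t r where t: "finite t" "t \<subseteq> x ` G" "w = (\<Sum>a\<in>t. r a *\<^sub>C a)"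
        using w unfolding complex_vector.span_explicit by blast
      \<comment> \<open>The span is expressed through vectors, the form \<open>q\<close> through
        group elements; pick one group element for each vector.\<close>
      obtain T where T: "T \<subseteq> G" "inj_on x T" "t = x ` T"
        using subset_image_inj[of t x G] t(2) by blast
      have Tf: "finite T" using t(1) T finite_image_iff by blast
      define c' d' where "c' g = (if g \<in> S then c g else 0)" and "d' g = (if g \<in> T then r (x g) else 0)" for g
      let ?R = "S \<union> T"
      have R: "finite ?R" "?R \<subseteq> G" using S T Tf by auto
      have c': "(\<Sum>g\<in>?R. c' g *\<^sub>C z g) = (\<Sum>g\<in>S. c g *\<^sub>C z g)" for z :: "('h \<Rightarrow> 'h) \<Rightarrow> 'a"
        using R by (intro sum.mono_neutral_cong_right) (auto simp: c'_def)
      have "w = (\<Sum>g\<in>T. r (x g) *\<^sub>C x g)" unfolding t(3) T(3) by (rule sum.reindex_cong[OF T(2)]) auto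
      also have "\<dots> = (\<Sum>g\<in>?R. d' g *\<^sub>C x g)"
        using R by (intro sum.mono_neutral_cong_left) (auto simp: d'_def)
      finally have w': "w = (\<Sum>g\<in>?R. d' g *\<^sub>C x g)" .
      have "cinner Y w = (\<Sum>h\<in>?R. \<Sum>g\<in>?R. cnj (c' h) * d' g * cinner (y h) (x g))"
        unfolding Y_def w' c'[of y, symmetric] cinner.sum_left unfolding cinner.sum_right
        by (simp add: cinner_scaleC_left cinner_scaleC_right mult_ac)
      also have "\<dots> = (\<Sum>h\<in>?R. \<Sum>g\<in>?R. d' g * cnj (c' h) * \<eta> (inv h \<circ> g))"
        using R by (intro sum.cong refl) (auto simp: y(2) subset_iff)
      also have "\<dots> = q ?R d' c'" unfolding q_def by (rule sum.swap)
      finally have "cinner Y w = q ?R d' c'" .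
      then show ?thesis using q_bound[OF R, of d' c'] unfolding w'[symmetric] c' by (simp add: mult.commute)
    qed
    then have "norm Y \<le> norm (\<Sum>g\<in>S. c g *\<^sub>C x g) \<or> Y = 0"
      using norm_le_if_cinner_le[of Y "complex_vector.span (x ` G)"] YM unfolding M_eq by blast
    then show ?thesis unfolding Y_def by auto
  qed
  \<comment> \<open>\<open>B\<close> is obtained as the adjoint of sending \<open>x g\<close> to
    \<open>y g\<close>, which defines it on the whole space with values in \<open>M\<close>. Since
    \<open>\<eta>\<close> is hermitian, it agrees with that map.\<close>
  have "\<exists>\<xi>\<in>closure (complex_vector.span (x ` G)). (\<forall>g\<in>G. cinner \<xi> (x g) = cinner w (y g)) \<and> norm \<xi> \<le> norm w" for w
  proof (rule riesz_on_family)
    fix S :: "('h \<Rightarrow> 'h) set" and c :: "('h \<Rightarrow> 'h) \<Rightarrow> complex" assume S: "finite S" "S \<subseteq> G"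
    have "(\<Sum>g\<in>S. c g * cinner w (y g)) = cinner w (\<Sum>g\<in>S. c g *\<^sub>C y g)"
      by (simp add: cinner.sum_right cinner_scaleC_right)
    then show "cmod (\<Sum>g\<in>S. c g * cinner w (y g)) \<le> norm w * norm (\<Sum>g\<in>S. c g *\<^sub>C x g)"
      using order_trans[OF cinner_Cauchy_Schwarz mult_left_mono[OF y_bound[OF S]]] by simp
  qed simp
  then have "\<forall>w. \<exists>\<xi>. \<xi> \<in> M \<and> (\<forall>g\<in>G. cinner \<xi> (x g) = cinner w (y g)) \<and> norm \<xi> \<le> norm w" unfolding M_eq by blast
  from choice[OF this] obtain B where B: "\<And>w. B w \<in> M" "\<And>w g. g \<in> G \<Longrightarrow> cinner (B w) (x g) = cinner w (y g)"
    "\<And>w. norm (B w) \<le> norm w" by blast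
  have eqM: "u = v" if "u \<in> M" "v \<in> M" "\<And>g. g \<in> G \<Longrightarrow> cinner u (x g) = cinner v (x g)" for u v
    using that unfolding M_eq by (intro eq_if_cinner_eq[of u "x ` G" v]) auto
  have Blin: "bounded_clinear B"
  proof (rule bounded_clinearI[where C = 1])
    show "B (v + w) = B v + B w" for v w
      by (rule eqM) (auto simp: B cinner_add_left complex_vector.subspace_add[OF M.subspace])
    show "B (a *\<^sub>C v) = a *\<^sub>C B v" for a v
      by (rule eqM) (auto simp: B cinner_scaleC_left complex_vector.subspace_scale[OF M.subspace])
  qed (simp add: B(3))
  have Bx: "B (x h) = y h" if "h \<in> G" for h
    by (rule eqM) (use that in \<open>auto simp: B y yx\<close>)
  have span_pos: "cinner v (B v) \<in> \<real>\<^sub>\<ge>\<^sub>0" if v: "v \<in> complex_vector.span (x ` G)" for v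
  proof -
    obtain t r where t: "finite t" "t \<subseteq> x ` G" "v = (\<Sum>a\<in>t. r a *\<^sub>C a)"
      using v unfolding complex_vector.span_explicit by blast
    obtain T where T: "T \<subseteq> G" "inj_on x T" "t = x ` T"
      using subset_image_inj[of t x G] t(2) by blast
    have Tf: "finite T" using t(1) T finite_image_iff by blast
    have v': "v = (\<Sum>g\<in>T. r (x g) *\<^sub>C x g)" unfolding t(3) T(3) by (rule sum.reindex_cong[OF T(2)]) auto
    have "B v = (\<Sum>g\<in>T. r (x g) *\<^sub>C y g)"
      unfolding v' using T(1) by (auto simp: bounded_clinear_sum[OF Blin] bounded_clinear_scaleC[OF Blin] Bx intro!: sum.cong)
    then have "cinner v (B v) = (\<Sum>h\<in>T. \<Sum>g\<in>T. cnj (r (x h)) * r (x g) * cinner (x h) (y g))"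
      unfolding v' cinner.sum_left unfolding cinner.sum_right
      by (simp add: cinner_scaleC_left cinner_scaleC_right cinner.sum_right sum_distrib_left mult_ac)
    also have "\<dots> = (\<Sum>h\<in>T. \<Sum>g\<in>T. r (x g) * cnj (r (x h)) * \<eta> (inv h \<circ> g))"
      using T(1) by (intro sum.cong refl) (auto simp: yx subset_iff)
    also have "\<dots> = q T (\<lambda>g. r (x g)) (\<lambda>g. r (x g))" unfolding q_def by (rule sum.swap)
    finally show ?thesis using pos[OF Tf T(1)] by simp
  qed
  have M_pos: "cinner v (B v) \<in> \<real>\<^sub>\<ge>\<^sub>0" if v: "v \<in> M" for v
  proof -
    obtain a where a: "\<And>n. a n \<in> complex_vector.span (x ` G)" "a \<longlonglongrightarrow> v"
      using v unfolding M_eq by (metis closure_sequential)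
    have "(\<lambda>n. cinner (a n) (B (a n))) \<longlonglongrightarrow> cinner v (B v)"
      by (intro cinner.tendsto a bounded_linear.tendsto[OF bounded_clinear_bounded_linear[OF Blin]])
    then show ?thesis
      by (rule closed_sequentially[OF closed_nonneg_Reals_complex span_pos[OF a(1)]])
  qed
  have Bpos: "positive_op B"
    unfolding positive_op_def
  proof (intro conjI allI Blin)
    fix w
    let ?p = "orth_proj M w"
    have "B (w - ?p) = 0"
    proof (rule eqM)
      show "cinner (B (w - ?p)) (x g) = cinner 0 (x g)" if "g \<in> G" for g
        using orthocompD'[OF M.proj_orth y(1)[OF that]] that by (simp add: B)
    qed (auto simp: B complex_vector.subspace_0[OF M.subspace])
    then have "B w = B ?p" by (simp add: bounded_clinear_diff[OF Blin])
    moreover have "cinner (w - ?p) (B ?p) = 0" by (rule orthocompD'[OF M.proj_orth B(1)])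
    ultimately have "cinner w (B w) = cinner ?p (B ?p)" by (simp add: cinner.diff_left)
    then show "cinner w (B w) \<in> \<real>\<^sub>\<ge>\<^sub>0" using M_pos[OF M.proj_in] by simp
  qed
  have VM: "V u w \<in> M" if u: "u \<in> G" and w: "w \<in> M" for u w
  proof (rule bounded_clinear_closure_span_in[OF lin[OF u] M.subspace M.closed _ w[unfolded M_eq]])
    fix s assume "s \<in> x ` G"
    then show "V u s \<in> M" using comp[OF u] xM compG[OF u] by (auto simp: x_def)
  qed
  \<comment> \<open>On the generators this is the invariance of
    \<open>\<eta> (inv h \<circ> g)\<close> under left translation of both \<open>g\<close> and
    \<open>h\<close>.\<close>
  have commute: "V u (B w) = B (V u w)" if u: "u \<in> G" and w: "w \<in> M" for u w
  proof -
    have "(V u \<circ> B) w = (B \<circ> V u) w"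
    proof (rule bounded_clinear_eq_closure_span[OF _ _ _ w[unfolded M_eq]])
      show "bounded_clinear (V u \<circ> B)" "bounded_clinear (B \<circ> V u)"
        by (intro bounded_clinear_comp lin u Blin)+
      fix s assume "s \<in> x ` G"
      then obtain h where h: "h \<in> G" "s = x h" by blast
      have uh: "V u (x h) = x (u \<circ> h)" using comp[OF u h(1)] by (simp add: x_def)
      have "V u (y h) = y (u \<circ> h)"
      proof (rule eqM)
        show "V u (y h) \<in> M" by (rule VM[OF u y(1)[OF h(1)]])
        show "y (u \<circ> h) \<in> M" by (rule y(1)[OF compG[OF u h(1)]])
        fix g assume g: "g \<in> G"
        have iu: "inv u \<in> G" using invG[OF u u] .
        have "cinner (V u (y h)) (x g) = cinner (y h) (V (inv u) (x g))"
          using adj[OF iu] inv_inv[OF u] by metis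
        also have "V (inv u) (x g) = x (inv u \<circ> g)" using comp[OF iu g] by (simp add: x_def)
        also have "cinner (y h) (x (inv u \<circ> g)) = \<eta> (inv h \<circ> (inv u \<circ> g))" by (rule y(2)[OF h(1) compG[OF iu g]])
        also have "inv h \<circ> (inv u \<circ> g) = inv (u \<circ> h) \<circ> g" by (simp only: inv_comp[OF u h(1)] comp_assoc)
        also have "\<eta> (inv (u \<circ> h) \<circ> g) = cinner (y (u \<circ> h)) (x g)" by (rule y(2)[OF compG[OF u h(1)] g, symmetric])
        finally show "cinner (V u (y h)) (x g) = cinner (y (u \<circ> h)) (x g)" .
      qed
      then show "(V u \<circ> B) s = (B \<circ> V u) s"
        unfolding h(2) comp_apply uh Bx[OF h(1)] Bx[OF compG[OF u h(1)]] .
    qed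
    then show ?thesis by simp
  qed
  let ?B = "square_seq B"
  note B_pos = square_seq_positive[OF Bpos B(3)] and B_sums = square_seq_sums[OF Bpos B(3)]
  have BM: "?B j w \<in> M" for j w
    by (induction j arbitrary: w) (auto simp: B complex_vector.subspace_diff[OF M.subspace])
  have Bcomm: "V u (?B j w) = ?B j (V u w)" if u: "u \<in> G" and w: "w \<in> M" for u j w
    using w
  proof (induction j arbitrary: w)
    case 0 then show ?case by (simp add: commute[OF u])
  next
    case (Suc j)
    then show ?case by (simp add: bounded_clinear_diff[OF lin[OF u]] Suc.IH[OF BM])
  qed
  \<comment> \<open>The operators \<open>?B j\<close> are symmetric and commute with the
    representation, so their squares can be collected on the right and add up to
    \<open>B\<close>.\<close>
  define v where "v j = ?B j \<Omega>" for j
  have \<Omega>: "\<Omega> \<in> M" "\<Omega> = x id" using xM[OF idG] id by (simp_all add: x_def)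
  have herm_B: "cinner (?B j a) b = cinner a (?B j b)" for j a b
    by (rule positive_op_hermitian[OF conjunct1[OF B_pos]])
  have vu: "(\<lambda>j. cinner (v j) (V u (v j))) sums \<eta> u" if u: "u \<in> G" for u
  proof -
    have "cinner (v j) (V u (v j)) = cinner \<Omega> (?B j (?B j (x u)))" for j
      unfolding v_def Bcomm[OF u \<Omega>(1)] herm_B x_def ..
    moreover have "cinner \<Omega> (B (x u)) = \<eta> u"
      unfolding Bx[OF u] \<Omega>(2) yx[OF u idG] by simp
    ultimately show ?thesis using B_sums[of \<Omega> "x u"] by simp
  qed
  have n: "((\<lambda>j. (norm (v j))\<^sup>2) has_sum Re (\<eta> id)) UNIV"
  proof (rule sums_nonneg_imp_has_sum)
    have "Re (cinner (v j) (V id (v j))) = (norm (v j))\<^sup>2" for j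
      unfolding v_def Bcomm[OF idG \<Omega>(1)] id by (rule Re_cinner_self)
    then show "(\<lambda>j. (norm (v j))\<^sup>2) sums Re (\<eta> id)" using sums_Re[OF vu[OF idG]] by simp
  qed simp
  have "((\<lambda>j. cinner (v j) (V u (v j))) has_sum \<eta> u) UNIV" if u: "u \<in> G" for u
  proof -
    have "(\<lambda>j. cinner (v j) (V u (v j))) summable_on UNIV"
    proof (rule abs_summable_summable, rule Infinite_Sum.abs_summable_on_comparison_test'[OF has_sum_imp_summable[OF n]])
      show "norm (cinner (v j) (V u (v j))) \<le> (norm (v j))\<^sup>2" for j
        using order_trans[OF cinner_Cauchy_Schwarz mult_left_mono[OF Vn[OF u]]] by (simp add: power2_eq_square)
    qed
    then have h: "((\<lambda>j. cinner (v j) (V u (v j))) has_sum (\<Sum>\<^sub>\<infinity>j. cinner (v j) (V u (v j)))) UNIV" by (rule has_sum_infsum)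
    then show ?thesis using sums_unique2[OF has_sum_imp_sums[OF h] vu[OF u]] by simp
  qed
  moreover have "v j \<in> M" for j unfolding v_def by (rule BM)
  ultimately show ?thesis using n by (intro exI[of _ v]) simp
qed

section \<open>Multiples of Fock space\<close>

lift_definition slice :: "'k \<Rightarrow> ('k \<times> 'i) ell2 \<Rightarrow> 'i ell2" is "\<lambda>k x i. x (k, i)"
proof -
  fix k :: 'k and x :: "'k \<times> 'i \<Rightarrow> complex"
  assume "(\<lambda>z. (cmod (x z))\<^sup>2) summable_on UNIV"
  then have "(\<lambda>z. (cmod (x z))\<^sup>2) summable_on range (Pair k)" by (rule summable_on_subset) simp
  then show "(\<lambda>i. (cmod (x (k, i)))\<^sup>2) summable_on UNIV"
    by (subst (asm) summable_on_reindex) (auto simp: inj_on_def o_def)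
qed

lemma coord_slice: "coord (slice k x) i = coord x (k, i)"
  by transfer simp

lemma slice_eqI: "(\<And>k. slice k x = slice k y) \<Longrightarrow> x = y"
  by (rule ell2_eqI) (metis coord_slice surj_pair)

lemma cinner_slice_has_sum: "((\<lambda>k. cinner (slice k x) (slice k y)) has_sum cinner x y) UNIV"
proof (rule has_sum_SigmaD)
  show "((\<lambda>z. cnj (coord x z) * coord y z) has_sum cinner x y) (UNIV \<times> UNIV)"
    using cinner_ell2_has_sum[of x y] by simp
  show "((\<lambda>i. cnj (coord x (k, i)) * coord y (k, i)) has_sum cinner (slice k x) (slice k y)) UNIV" for k
    using cinner_ell2_has_sum[of "slice k x" "slice k y"] by (simp add: coord_slice)
qed

lemma norm_slice_has_sum: "((\<lambda>k. (norm (slice k x))\<^sup>2) has_sum (norm x)\<^sup>2) UNIV"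
  using has_sum_Re[OF cinner_slice_has_sum[of x x]] by (simp add: Re_cinner_self)

lemma bounded_clinear_slice: "bounded_clinear (slice k :: ('k \<times> 'i) ell2 \<Rightarrow> 'i ell2)"
proof (rule bounded_clinearI[where C = 1])
  show "norm (slice k x) \<le> 1 * norm x" for x :: "('k \<times> 'i) ell2"
    using finite_sum_le_has_sum[OF norm_slice_has_sum[of x], of "{k}"]
      power2_le_imp_le[of "norm (slice k x)" "norm x"] by simp
qed (auto intro!: ell2_eqI simp: coord_slice coord_add coord_scaleC)

lemma slice_exists:
  assumes "(\<lambda>k. (norm (v k))\<^sup>2) summable_on UNIV"
  shows "\<exists>x. \<forall>k. slice k x = v k"
proof -
  let ?g = "\<lambda>(k, i). coord (v k) i"
  have "(\<lambda>(k, i). (cmod (coord (v k) i))\<^sup>2) summable_on UNIV \<times> UNIV"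
    by (rule summable_on_SigmaI[OF _ assms]) (use norm_ell2_has_sum in auto)
  then have "?g \<in> {x. (\<lambda>i. (cmod (x i))\<^sup>2) summable_on UNIV}" by (simp add: case_prod_unfold)
  then have "coord (Abs_ell2 ?g) = ?g" by (rule Abs_ell2_inverse)
  then have "slice k (Abs_ell2 ?g) = v k" for k by (intro ell2_eqI) (simp add: coord_slice)
  then show ?thesis by blast
qed

text \<open>The operator \<open>1 \<otimes> T\<close> on the Hilbert sum of copies of
  \<open>'i ell2\<close> indexed by \<open>'k\<close>, whose components are the slices.\<close>

definition amplify :: "('i ell2 \<Rightarrow> 'i ell2) \<Rightarrow> ('k \<times> 'i) ell2 \<Rightarrow> ('k \<times> 'i) ell2"
  where "amplify T x = (SOME y. \<forall>k. slice k y = T (slice k x))"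

context
  fixes T :: "'i ell2 \<Rightarrow> 'i ell2"
  assumes T: "bounded_clinear T" "\<And>v. norm (T v) \<le> norm v"
begin

lemma slice_amplify: "slice k (amplify T x) = T (slice k x)"
proof -
  have "(\<lambda>k. (norm (T (slice k x)))\<^sup>2) summable_on UNIV"
    by (rule summable_on_comparison_test[OF has_sum_imp_summable[OF norm_slice_has_sum[of x]]])
      (auto intro: power_mono T)
  from someI_ex[OF slice_exists[OF this]] show ?thesis by (simp add: amplify_def)
qed

lemma norm_amplify: "norm (amplify T x) \<le> norm x"
proof -
  have "(norm (amplify T x))\<^sup>2 \<le> (norm x)\<^sup>2"
    by (rule has_sum_mono[OF norm_slice_has_sum norm_slice_has_sum])
      (auto simp: slice_amplify intro: power_mono T)
  then show ?thesis using power2_le_imp_le[of "norm (amplify T x)" "norm x"] by simp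
qed

lemma bounded_clinear_amplify: "bounded_clinear (amplify T)"
proof (rule bounded_clinearI[where C = 1])
  show "amplify T (x + y) = amplify T x + amplify T y" for x y
    by (rule slice_eqI) (simp add: slice_amplify bounded_clinear_add[OF bounded_clinear_slice] bounded_clinear_add[OF T(1)])
  show "amplify T (a *\<^sub>C x) = a *\<^sub>C amplify T x" for a x
    by (rule slice_eqI)
      (simp add: slice_amplify bounded_clinear_scaleC[OF bounded_clinear_slice] bounded_clinear_scaleC[OF T(1)])
qed (simp add: norm_amplify)

end

text \<open>On Fock space this is \<open>cinner_fock_op_unitary\<close>; other vectors are first
  projected there, since second quantization ignores the complement and maps into Fock
  space.\<close>

lemma cinner_fock_op_inv:
  assumes u: "u \<in> unitaries K"
  shows "cinner (fock_op (inv u) v) w = cinner v (fock_op u w)"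
proof -
  let ?Q = "orth_proj (fock UNIV)"
  have u': "inv u \<in> unitaries K" by (rule unitaries_inv[OF u])
  have c: "contractive u" "contractive (inv u)" by (rule unitary_contractive[OF u], rule unitary_contractive[OF u'])
  have inv: "inv (inv u) = u" by (rule inv_inv_eq[OF bij_unitary[OF u]])
  have "cinner (fock_op (inv u) v) w = cinner (fock_op (inv u) v) (?Q w)"
    using fock.proj_fix[OF fock_op_in_fock_UNIV[OF c(2)], of v] fock.cinner_proj_commute[where K = UNIV] by metis
  also have "\<dots> = cinner (fock_op (inv u) (?Q v)) (fock_op id (?Q w))"
    by (simp add: fock_op_id fock.proj_in fock_op_proj[OF c(2), of v])
  also have "\<dots> = cinner (?Q v) (fock_op (inv (inv u) \<circ> id) (?Q w))"
    by (rule cinner_fock_op_unitary[OF u' id_in_unitaries]) (rule fock.proj_in)+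
  also have "\<dots> = cinner (?Q v) (fock_op u w)"
    unfolding inv comp_id fock_op_proj[OF c(1), of w, symmetric] ..
  also have "\<dots> = cinner v (fock_op u w)"
    using fock.proj_fix[OF fock_op_in_fock_UNIV[OF c(1)], of w] fock.cinner_proj_commute[where K = UNIV] by metis
  finally show ?thesis .
qed

text \<open>The vector \<open>\<Omega>\<close> with slices \<open>w k\<close> turns the sum of
  coefficients into one vector state, which dominates \<open>t\<close> times \<open>\<psi>1\<close>
  because \<open>\<psi>2\<close> is positive definite. The slices of the resulting vectors, divided
  by \<open>sqrt t\<close>, form the new state.\<close>

lemma fock_state_dominated:
  fixes K :: "'h::complex_hilbert set"
  assumes st: "fock_state K w" and K: "closed_complex_subspace K" and t: "0 < t" "t < 1"
    and eq: "\<And>u. u \<in> unitaries K \<Longrightarrow>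
      fock_value w u = complex_of_real t * \<psi>1 u + complex_of_real (1 - t) * \<psi>2 u"
    and pd1: "\<And>S c. finite S \<Longrightarrow> S \<subseteq> unitaries K \<Longrightarrow> (\<Sum>g\<in>S. \<Sum>h\<in>S. c g * cnj (c h) * \<psi>1 (inv h \<circ> g)) \<in> \<real>\<^sub>\<ge>\<^sub>0"
    and pd2: "\<And>S c. finite S \<Longrightarrow> S \<subseteq> unitaries K \<Longrightarrow> (\<Sum>g\<in>S. \<Sum>h\<in>S. c g * cnj (c h) * \<psi>2 (inv h \<circ> g)) \<in> \<real>\<^sub>\<ge>\<^sub>0"
    and 1: "\<psi>1 id = 1"
  shows "\<exists>w1. fock_state K w1 \<and> (\<forall>u\<in>unitaries K. \<psi>1 u = fock_value w1 u)"
proof -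
  interpret K: closed_complex_subspace K by (rule K)
  have wK: "w k \<in> fock K" and wU: "w k \<in> fock UNIV" for k
    using st fock_mono[of K UNIV] by (auto simp: fock_state_def)
  have "(\<lambda>k. (norm (w k))\<^sup>2) summable_on UNIV" using st by (auto simp: fock_state_def intro: has_sum_imp_summable)
  from slice_exists[OF this] obtain \<Omega> :: "(nat \<times> 'h list) ell2" where \<Omega>: "\<And>k. slice k \<Omega> = w k" by blast
  define V where "V u = (amplify (fock_op u) :: (nat \<times> 'h list) ell2 \<Rightarrow> _)" for u :: "'h \<Rightarrow> 'h"
  have slice_V: "slice k (V u x) = fock_op u (slice k x)" if "contractive u" for u k x
    unfolding V_def using that by (intro slice_amplify bounded_clinear_fock_op norm_fock_op)
  note uc = unitary_contractive[of _ K]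
  define \<eta> where "\<eta> u = complex_of_real t * \<psi>1 u" for u
  let ?M = "closure (complex_vector.span ((\<lambda>g. V g \<Omega>) ` unitaries K))"
  have inner_V: "cinner (V h \<Omega>) (V g \<Omega>) = fock_value w (inv h \<circ> g)" if gh: "g \<in> unitaries K" "h \<in> unitaries K" for g h
  proof -
    have "((\<lambda>k. cinner (slice k (V h \<Omega>)) (slice k (V g \<Omega>))) has_sum cinner (V h \<Omega>) (V g \<Omega>)) UNIV"
      by (rule cinner_slice_has_sum)
    moreover have "cinner (slice k (V h \<Omega>)) (slice k (V g \<Omega>)) = cinner (w k) (fock_op (inv h \<circ> g) (w k))" for k
      unfolding slice_V[OF uc[OF gh(1)]] slice_V[OF uc[OF gh(2)]] \<Omega>
      by (rule cinner_fock_op_unitary[OF gh(2,1) wU wU])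
    moreover have "((\<lambda>k. cinner (w k) (fock_op (inv h \<circ> g) (w k))) has_sum fock_value w (inv h \<circ> g)) UNIV"
      using gh by (intro fock_value_has_sum[OF st] uc unitaries_comp unitaries_inv)
    ultimately show ?thesis using has_sum_unique by simp
  qed
  have "\<exists>v :: nat \<Rightarrow> (nat \<times> 'h list) ell2. (\<forall>j. v j \<in> ?M) \<and> ((\<lambda>j. (norm (v j))\<^sup>2) has_sum Re (\<eta> id)) UNIV \<and>
    (\<forall>u\<in>unitaries K. ((\<lambda>j. cinner (v j) (V u (v j))) has_sum \<eta> u) UNIV)"
  proof (rule dominated_positive_definite)
    fix u assume u: "u \<in> unitaries K"
    show "bounded_clinear (V u)"
      unfolding V_def by (intro bounded_clinear_amplify bounded_clinear_fock_op norm_fock_op uc u)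
    show "norm (V u v) \<le> norm v" for v
      unfolding V_def by (intro norm_amplify bounded_clinear_fock_op norm_fock_op uc u)
    show "cinner (V (inv u) v) y = cinner v (V u y)" for v y
    proof (rule has_sum_unique[OF cinner_slice_has_sum])
      show "((\<lambda>k. cinner (slice k (V (inv u) v)) (slice k y)) has_sum cinner v (V u y)) UNIV"
        using cinner_slice_has_sum[of v "V u y"]
        unfolding slice_V[OF uc[OF u]] slice_V[OF uc[OF unitaries_inv[OF u]]] cinner_fock_op_inv[OF u] .
    qed
    show "V u (V g \<Omega>) = V (u \<circ> g) \<Omega>" if g: "g \<in> unitaries K" for g
      by (rule slice_eqI)
        (simp only: slice_V[OF uc[OF u]] slice_V[OF uc[OF g]] slice_V[OF uc[OF unitaries_comp[OF u g]]]
          fock_op_comp[OF uc[OF u] uc[OF g]])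
  next
    show "V id \<Omega> = \<Omega>"
      by (rule slice_eqI) (simp only: slice_V[OF contractive_id] \<Omega> fock_op_id[OF wU])
    fix S :: "('h \<Rightarrow> 'h) set" and c assume S: "finite S" "S \<subseteq> unitaries K"
    have e: "(\<Sum>g\<in>S. \<Sum>h\<in>S. c g * cnj (c h) * \<eta> (inv h \<circ> g)) =
        complex_of_real t * (\<Sum>g\<in>S. \<Sum>h\<in>S. c g * cnj (c h) * \<psi>1 (inv h \<circ> g))"
      by (simp add: \<eta>_def sum_distrib_left mult_ac)
    show "(\<Sum>g\<in>S. \<Sum>h\<in>S. c g * cnj (c h) * \<eta> (inv h \<circ> g)) \<in> \<real>\<^sub>\<ge>\<^sub>0"
      unfolding e using t by (intro nonneg_Reals_mult_I pd1 S) (simp add: complex_nonneg_Reals_iff)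
    have real_part: "a = Re A + r * Re B" if "complex_of_real a = A + complex_of_real r * B" for a r :: real and A B
      using arg_cong[OF that, of Re] by simp
    have "complex_of_real ((norm (\<Sum>g\<in>S. c g *\<^sub>C V g \<Omega>))\<^sup>2) =
        (\<Sum>h\<in>S. \<Sum>g\<in>S. c g * cnj (c h) * cinner (V h \<Omega>) (V g \<Omega>))"
      unfolding cinner_self[symmetric] cinner.sum_left unfolding cinner.sum_right
      by (simp add: cinner_scaleC_left cinner_scaleC_right mult_ac)
    also have "\<dots> = (\<Sum>g\<in>S. \<Sum>h\<in>S. c g * cnj (c h) * cinner (V h \<Omega>) (V g \<Omega>))" by (rule sum.swap)
    also have "\<dots> = (\<Sum>g\<in>S. \<Sum>h\<in>S. c g * cnj (c h) * \<eta> (inv h \<circ> g)) +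
        complex_of_real (1 - t) * (\<Sum>g\<in>S. \<Sum>h\<in>S. c g * cnj (c h) * \<psi>2 (inv h \<circ> g))"
      unfolding sum_distrib_left sum.distrib[symmetric]
    proof (intro sum.cong refl)
      fix g h assume "g \<in> S" "h \<in> S"
      then have gh: "g \<in> unitaries K" "h \<in> unitaries K" using S by auto
      show "c g * cnj (c h) * cinner (V h \<Omega>) (V g \<Omega>) =
          c g * cnj (c h) * \<eta> (inv h \<circ> g) + complex_of_real (1 - t) * (c g * cnj (c h) * \<psi>2 (inv h \<circ> g))"
        unfolding inner_V[OF gh] eq[OF unitaries_comp[OF unitaries_inv[OF gh(2)] gh(1)]] \<eta>_def
        by (simp add: algebra_simps)
    qed
    finally have "(norm (\<Sum>g\<in>S. c g *\<^sub>C V g \<Omega>))\<^sup>2 = Re (\<Sum>g\<in>S. \<Sum>h\<in>S. c g * cnj (c h) * \<eta> (inv h \<circ> g)) +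
        (1 - t) * Re (\<Sum>g\<in>S. \<Sum>h\<in>S. c g * cnj (c h) * \<psi>2 (inv h \<circ> g))"
      by (rule real_part)
    moreover have "0 \<le> (1 - t) * Re (\<Sum>g\<in>S. \<Sum>h\<in>S. c g * cnj (c h) * \<psi>2 (inv h \<circ> g))"
      using pd2[OF S, of c] t by (simp add: complex_nonneg_Reals_iff)
    ultimately show "Re (\<Sum>g\<in>S. \<Sum>h\<in>S. c g * cnj (c h) * \<eta> (inv h \<circ> g)) \<le> (norm (\<Sum>g\<in>S. c g *\<^sub>C V g \<Omega>))\<^sup>2"
      by linarith
  qed
  then obtain v :: "nat \<Rightarrow> (nat \<times> 'h list) ell2" where v: "\<And>j. v j \<in> ?M"
    "((\<lambda>j. (norm (v j))\<^sup>2) has_sum Re (\<eta> id)) UNIV"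
    "\<And>u. u \<in> unitaries K \<Longrightarrow> ((\<lambda>j. cinner (v j) (V u (v j))) has_sum \<eta> u) UNIV" by blast
  \<comment> \<open>The vectors lie in the closed span of the orbit of \<open>\<Omega>\<close>, and
    unitaries of \<open>K\<close> keep the slices of the orbit in \<open>fock K\<close>.\<close>
  have vK: "slice k (v j) \<in> fock K" for j k
  proof (rule bounded_clinear_closure_span_in[OF bounded_clinear_slice fock.subspace fock.closed _ v(1)])
    fix s assume "s \<in> (\<lambda>g. V g \<Omega>) ` unitaries K"
    then obtain g where g: "g \<in> unitaries K" "s = V g \<Omega>" by blast
    show "slice k s \<in> fock K"
      unfolding g(2) slice_V[OF uc[OF g(1)]] \<Omega>
      by (rule fock_op_in_fock[OF uc[OF g(1)] K.unitary_in[OF g(1)] wK])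
  qed
  define b where "b = (\<lambda>(j, k). complex_of_real (inverse (sqrt t)) *\<^sub>C slice k (v j))"
  define w1 where "w1 m = b (prod_decode m)" for m
  have bij: "bij_betw prod_decode UNIV (UNIV \<times> UNIV)" by (simp only: UNIV_Times_UNIV bij_prod_decode)
  have Re_eta: "Re (\<eta> id) = t" by (simp add: \<eta>_def 1)
  have n1: "((\<lambda>k. (norm (b (j, k)))\<^sup>2) has_sum inverse t * (norm (v j))\<^sup>2) UNIV" for j
    using has_sum_cmult_right[OF norm_slice_has_sum[of "v j"], of "inverse t"] t
    by (simp add: b_def norm_scaleC power_mult_distrib power_inverse norm_inverse)
  have n2: "((\<lambda>j. inverse t * (norm (v j))\<^sup>2) has_sum 1) UNIV"
    using has_sum_cmult_right[OF v(2), of "inverse t"] t by (simp add: Re_eta)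
  have "(\<lambda>z. (norm (b z))\<^sup>2) summable_on UNIV \<times> UNIV"
    by (rule summable_on_SigmaI[OF n1 has_sum_imp_summable[OF n2]]) simp
  then have nb: "((\<lambda>z. (norm (b z))\<^sup>2) has_sum 1) (UNIV \<times> UNIV)"
    by (rule has_sum_SigmaI[OF n1 n2])
  have st1: "fock_state K w1"
    unfolding fock_state_def
  proof (intro conjI allI)
    show "((\<lambda>k. (norm (w1 k))\<^sup>2) has_sum 1) UNIV"
      unfolding w1_def using has_sum_reindex_bij_betw[OF bij, of "\<lambda>z. (norm (b z))\<^sup>2" 1] nb by simp
    show "w1 k \<in> fock K" for k
      unfolding w1_def b_def case_prod_unfold by (rule complex_vector.subspace_scale[OF fock.subspace vK])
  qed
  have "\<psi>1 u = fock_value w1 u" if u: "u \<in> unitaries K" for u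
  proof -
    have "((\<lambda>z. cinner (b z) (fock_op u (b z))) has_sum fock_value w1 u) (UNIV \<times> UNIV)"
      using fock_value_has_sum[OF st1 uc[OF u]] unfolding w1_def
      by (subst (asm) has_sum_reindex_bij_betw[OF bij, of "\<lambda>z. cinner (b z) (fock_op u (b z))"])
    then have "((\<lambda>j. complex_of_real (inverse t) * cinner (v j) (V u (v j))) has_sum fock_value w1 u) UNIV"
    proof (rule has_sum_SigmaD)
      fix j
      have "inverse (sqrt t) * inverse (sqrt t) = inverse t"
        using t by (simp flip: inverse_mult_distrib)
      then show "((\<lambda>k. cinner (b (j, k)) (fock_op u (b (j, k)))) has_sum
          complex_of_real (inverse t) * cinner (v j) (V u (v j))) UNIV"
        using has_sum_cmult_right[OF cinner_slice_has_sum[of "v j" "V u (v j)"], of "complex_of_real (inverse t)"]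
        by (simp add: b_def slice_V[OF uc[OF u]] bounded_clinear_scaleC[OF bounded_clinear_fock_op[OF uc[OF u]]]
            cinner_scaleC_left cinner_scaleC_right mult.assoc[symmetric] flip: of_real_mult of_real_inverse)
    qed
    moreover have "((\<lambda>j. complex_of_real (inverse t) * cinner (v j) (V u (v j))) has_sum \<psi>1 u) UNIV"
      using has_sum_cmult_right[OF v(3)[OF u], of "complex_of_real (inverse t)"] t by (simp add: \<eta>_def mult.assoc[symmetric])
    ultimately show ?thesis using has_sum_unique by blast
  qed
  then show ?thesis using st1 by blast
qed

section \<open>Extreme points\<close>

context orthonormal_flag
begin

text \<open>By \<open>fock_state_dominated\<close> at each level, a convex component of a
  holomorphic function is holomorphic. Thus \<open>C2 f\<close> is a face of the set of all central
  normalized positive definite functions.\<close>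

lemma C2_face:
  assumes \<psi>: "\<psi> \<in> C2 f" and t: "0 < t" "t < 1" and eq: "\<psi> = convex_comb t \<psi>1 \<psi>2"
    and \<psi>1: "\<psi>1 \<in> normalized_pd (limit_unitary_group (fspan f)) (limit_unitary_topology (fspan f))"
      "conj_invariant (limit_unitary_group (fspan f)) F.U \<psi>1"
    and \<psi>2: "\<psi>2 \<in> normalized_pd (limit_unitary_group (fspan f)) (limit_unitary_topology (fspan f))"
  shows "\<psi>1 \<in> C2 f"
proof -
  have "holomorphic (fspan f) \<psi>1"
    unfolding holomorphic_fspan_iff
  proof (intro allI impI)
    fix N :: nat assume N: "N \<ge> 1"
    obtain w where w: "fock_state (fspan f N) w" "\<And>u. u \<in> unitaries (fspan f N) \<Longrightarrow> \<psi> u = fock_value w u"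
      using C2_state[OF \<psi> N] by blast
    have sub: "S \<subseteq> F.U" if "S \<subseteq> unitaries (fspan f N)" for S using that F.in_U[OF N] by blast
    show "\<exists>w. fock_state (fspan f N) w \<and> (\<forall>u\<in>unitaries (fspan f N). \<psi>1 u = fock_value w u)"
    proof (rule fock_state_dominated[OF w(1) fspan_closed t])
      show "fock_value w u = complex_of_real t * \<psi>1 u + complex_of_real (1 - t) * \<psi>2 u"
        if "u \<in> unitaries (fspan f N)" for u
        using w(2)[OF that] unfolding eq convex_comb_def by simp
      show "(\<Sum>g\<in>S. \<Sum>h\<in>S. c g * cnj (c h) * \<psi>1 (inv h \<circ> g)) \<in> \<real>\<^sub>\<ge>\<^sub>0"
        "(\<Sum>g\<in>S. \<Sum>h\<in>S. c g * cnj (c h) * \<psi>2 (inv h \<circ> g)) \<in> \<real>\<^sub>\<ge>\<^sub>0"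
        if "finite S" "S \<subseteq> unitaries (fspan f N)" for S c
        using \<psi>1(1) \<psi>2 that sub[OF that(2)] unfolding F.normalized_pd_iff by blast+
      show "\<psi>1 id = 1" using \<psi>1(1) unfolding F.normalized_pd_iff by blast
    qed
  qed
  then show ?thesis
    using \<psi>1 unfolding C2_def by blast
qed

lemma convex_comb_swap: "convex_comb t \<phi> \<psi> = convex_comb (1 - t) \<psi> \<phi>"
  by (auto simp: convex_comb_def fun_eq_iff)

text \<open>The right side lies in the convex set \<open>C1 H f\<close> and restricts to the given
  combination, so it is the extension of that combination.\<close>

lemma extend_convex_comb:
  assumes "\<psi>1 \<in> C2 f" "\<psi>2 \<in> C2 f" "t \<in> {0..1}"
  shows "extend (convex_comb t \<psi>1 \<psi>2) = convex_comb t (extend \<psi>1) (extend \<psi>2)"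
proof -
  have C1: "convex_comb t (extend \<psi>1) (extend \<psi>2) \<in> C1 H f"
    using convex_C1 assms extend_in_C1 unfolding convex_functions_def by blast
  have "restrict (convex_comb t (extend \<psi>1) (extend \<psi>2)) F.U = convex_comb t \<psi>1 \<psi>2"
    by (simp only: restrict_convex_comb restrict_of_extend assms)
  then show ?thesis using extend_of_restrict[OF C1] by simp
qed

text \<open>A decomposition of the restriction into central functions has its parts in
  \<open>C2 f\<close> by \<open>C2_face\<close>. Extending them decomposes \<open>\<phi>\<close>
  into invariant functions, which extremality makes trivial; restricting again gives the
  claim.\<close>

lemma restrict_finite_character:
  assumes \<phi>: "\<phi> \<in> C1 H f" and gen: "\<phi> \<in> generalized_characters (limit_unitary_group H) (limit_unitary_topology H) F.U"
  shows "restrict \<phi> F.U \<in> finite_characters (limit_unitary_group (fspan f)) (limit_unitary_topology (fspan f))"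
proof -
  let ?C = "{\<psi> \<in> normalized_pd (limit_unitary_group (fspan f)) (limit_unitary_topology (fspan f)).
    conj_invariant (limit_unitary_group (fspan f)) F.U \<psi>}"
  let ?D = "{\<phi> \<in> normalized_pd (limit_unitary_group H) (limit_unitary_topology H).
    conj_invariant (limit_unitary_group H) F.U \<phi>}"
  have \<psi>: "restrict \<phi> F.U \<in> C2 f" by (rule restrict_in_C2[OF \<phi>])
  have "\<psi>1 = restrict \<phi> F.U \<and> \<psi>2 = restrict \<phi> F.U"
    if *: "\<psi>1 \<in> ?C" "\<psi>2 \<in> ?C" "t \<in> {0<..<1}" "restrict \<phi> F.U = convex_comb t \<psi>1 \<psi>2" for \<psi>1 \<psi>2 t
  proof -
    have C2: "\<psi>1 \<in> C2 f" "\<psi>2 \<in> C2 f"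
      using C2_face[OF \<psi>, of t \<psi>1 \<psi>2] C2_face[OF \<psi>, of "1 - t" \<psi>2 \<psi>1] * convex_comb_swap[of t \<psi>1 \<psi>2] by auto
    have "\<phi> = convex_comb t (extend \<psi>1) (extend \<psi>2)"
      using extend_of_restrict[OF \<phi>] extend_convex_comb[OF C2, of t] *(3,4) by simp
    moreover have "extend \<psi>1 \<in> ?D" "extend \<psi>2 \<in> ?D"
      using extend_in_C1[OF C2(1)] extend_in_C1[OF C2(2)] unfolding C1_def by auto
    ultimately have "extend \<psi>1 = \<phi>" "extend \<psi>2 = \<phi>"
      using gen *(3) unfolding generalized_characters_def extreme_functions_def by blast+
    then show ?thesis using restrict_of_extend[OF C2(1)] restrict_of_extend[OF C2(2)] by simp
  qed
  moreover have "restrict \<phi> F.U \<in> ?C" using \<psi> unfolding C2_def by blast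
  ultimately show ?thesis unfolding finite_characters_def extreme_functions_def by blast
qed

theorem generalized_character_extension:
  assumes \<phi>: "\<phi> \<in> C1 H f" and gen: "\<phi> \<in> generalized_characters (limit_unitary_group H) (limit_unitary_topology H) F.U"
  shows "\<exists>!\<psi>. \<psi> \<in> finite_characters (limit_unitary_group (fspan f)) (limit_unitary_topology (fspan f)) \<and>
    holomorphic (fspan f) \<psi> \<and>
    (\<forall>W\<in>H.U. \<phi> W = holomorphic_extension (fspan f) \<psi> (extend_id (Hminus f) (Phi f W)))"
proof (intro ex1I conjI ballI)
  have \<psi>: "restrict \<phi> F.U \<in> C2 f" by (rule restrict_in_C2[OF \<phi>])
  show "restrict \<phi> F.U \<in> finite_characters (limit_unitary_group (fspan f)) (limit_unitary_topology (fspan f))"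
    by (rule restrict_finite_character[OF \<phi> gen])
  show "holomorphic (fspan f) (restrict \<phi> F.U)" using \<psi> unfolding C2_def by blast
  show "\<phi> W = holomorphic_extension (fspan f) (restrict \<phi> F.U) (extend_id (Hminus f) (Phi f W))" if "W \<in> H.U" for W
    using fun_cong[OF extend_of_restrict[OF \<phi>], of W] that unfolding extend_def compress_def
    by (simp only: restrict_apply')
  \<comment> \<open>Uniqueness: at a unitary of the limit group of \<open>fspan f\<close> the
    compression changes nothing, so the formula forces \<open>\<psi>'\<close> to equal
    \<open>\<phi>\<close> there.\<close>
  fix \<psi>' assume *: "\<psi>' \<in> finite_characters (limit_unitary_group (fspan f)) (limit_unitary_topology (fspan f)) \<and>
    holomorphic (fspan f) \<psi>' \<and>
    (\<forall>W\<in>H.U. \<phi> W = holomorphic_extension (fspan f) \<psi>' (extend_id (Hminus f) (Phi f W)))"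
  then have ext: "\<psi>' \<in> extensional F.U"
    unfolding finite_characters_def extreme_functions_def F.normalized_pd_iff by blast
  show "\<psi>' = restrict \<phi> F.U"
  proof
    fix u
    show "\<psi>' u = restrict \<phi> F.U u"
    proof (cases "u \<in> F.U")
      case True
      then have "\<phi> u = holomorphic_extension (fspan f) \<psi>' (compress u)"
        using * F_U_subset unfolding compress_def by blast
      also have "\<dots> = \<psi>' u" using holomorphic_extension_unitary[OF _ True] * by blast
      finally show ?thesis by (simp only: restrict_apply'[OF True])
    next
      case False
      then show ?thesis using ext by (auto simp: extensional_def)
    qed
  qed
qed

end

theorem proposition8p1:
  fixes H :: "nat \<Rightarrow> 'h::complex_hilbert set" and f :: "nat \<Rightarrow> 'h"
  assumes H_0: "H 0 = {0}"
    and H_subspace: "\<And>N. N \<ge> 1 \<Longrightarrow> complex_vector.subspace (H N) \<and> closed (H N)"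
    and H_separable: "\<And>N. N \<ge> 1 \<Longrightarrow> separable_space (top_of_set (H N))"
    and H_infinite_dim: "\<And>N. N \<ge> 1 \<Longrightarrow> \<not> (\<exists>B. finite B \<and> H N \<subseteq> complex_vector.span B)"
    and H_mono: "\<And>N. N \<ge> 1 \<Longrightarrow> H N \<subseteq> H (Suc N)"
    and H_dense: "closure (\<Union>N\<in>{1..}. H N) = UNIV"
    and f: "\<And>N. N \<ge> 1 \<Longrightarrow> f N \<in> H N \<inter> orthocomp (H (N - 1)) \<and> norm (f N) = 1"
  shows "affinely_isomorphic (C1 H f) (C2 f) \<and>
    (\<forall>\<phi>. \<phi> \<in> generalized_characters (limit_unitary_group H) (limit_unitary_topology H)
              (carrier (limit_unitary_group (fspan f))) \<and> holomorphic H \<phi> \<and> \<phi> \<in> C1 H f \<longrightarrow>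
      (\<exists>!\<psi>. \<psi> \<in> finite_characters (limit_unitary_group (fspan f))
                    (limit_unitary_topology (fspan f)) \<and>
             holomorphic (fspan f) \<psi> \<and>
             (\<forall>W\<in>carrier (limit_unitary_group H).
                \<phi> W = holomorphic_extension (fspan f) \<psi> (extend_id (Hminus f) (Phi f W)))))"
proof -
  interpret orthonormal_flag H f
    using H_subspace H_mono f by unfold_locales auto
  show ?thesis using C1_C2_affinely_isomorphic generalized_character_extension by blast
qed

end
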